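(* Assume that for each $l=1,\ldots,p$, $K_l$ is a probability density function on $\mathbb{R}^{d_l}$. Let $h_n>0$ be such that, as $n\to\infty$, $h_n\to0$ and $nh_n^{3d}\to\infty$. If $\mathcal H_1:\ \int_{\mathbb{R}^d}\big|f(\tilde{\mathbf x})-\prod_{l=1}^pf_l(\mathbf x_l)\big|\,d\tilde{\mathbf x}>0$ is true, then, for any bounded Borel subset $\tilde D=D_1\times\cdots\times D_p\subset\mathbb{R}^d$ (with $D_l\subset\mathbb{R}^{d_l}$) such that $V(\tilde D)>0$, we have $$\lim_{n\to\infty}\mathbb P\{T_n(\tilde D)>z_{1-\alpha}\}=1 .$$
   Context: Setting. Let $p\ge 2$, $d_1,\ldots,d_p\ge 1$ and $d=d_1+\cdots+d_p$. Vectors of $\mathbb{R}^d$ are written $\tilde{\mathbf x}=(\mathbf x_1^\top,\ldots,\mathbf x_p^\top)^\top$ with $\mathbf x_l\in\mathbb{R}^{d_l}$. $\tilde{\mathbf X}=(\mathbb X^{1\top},\ldots,\mathbb X^{p\top})^\top$ is a random vector in $\mathbb{R}^d$ with Lebesgue density $f$, and $f_l$ is the Lebesgue density of the block $\mathbb X^l$ on $\mathbb{R}^{d_l}$. $\tilde{\mathbf X}_i=(\mathbb X_i^{1\top},\ldots,\mathbb X_i^{p\top})^\top$, $i\ge1$, are i.i.d. copies of $\tilde{\mathbf X}$. For kernels $K_l$ and bandwidths $h_n>0$ put $$f_n(\tilde{\mathbf x})=\frac{1}{nh_n^d}\sum_{i=1}^n\prod_{l=1}^pK_l\Big(\frac{\mathbf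 x_l-\mathbb X_i^l}{h_n}\Big),\qquad f_{n,l}(\mathbf x_l)=\frac{1}{nh_n^{d_l}}\sum_{i=1}^nK_l\Big(\frac{\mathbf x_l-\mathbb X_i^l}{h_n}\Big),$$ and, for Borel $A\subset\mathbb{R}^d$, $$V_n(A)=\int_A\Big|f_n(\tilde{\mathbf x})-\prod_{l=1}^pf_{n,l}(\mathbf x_l)\Big|\,d\tilde{\mathbf x},\qquad V(A)=\int_A\Big|f(\tilde{\mathbf x})-\prod_{l=1}^pf_l(\mathbf x_l)\Big|\,d\tilde{\mathbf x}.$$ The variance $\sigma^2$. Fix a norm $\|\cdot\|$ on each $\mathbb{R}^s$, let $\mathcal B_s=\{\mathbf u\in\mathbb{R}^s:\|\mathbf u\|\le1\}$ and $\tilde{\mathcal B}=\mathcal B_{d_1}\times\cdots\times\mathcal B_{d_p}$. Let $\tilde{\mathbf K}=\prod_{l=1}^p\|K_l\|_2^2$ ($\|\cdot\|_2$ the $L_2$-norm), $\rho_l(\mathbf t_l)=\|K_l\|_2^{-2}\int_{\mathbb{R}^{d_l}}K_l(\mathbf u_l)K_l(\mathbf u_l+\mathbf t_l)\,d\mathbf u_l$, $\rho(\tilde{\mathbf t})=\prod_{l=1}^p\rho_l(\mathbf t_l)$ (these quantities are meaningful for kernels of finite $L_2$-norm). With $Z_1,Z_2$ independent standard normal, $$\sigma^2=\tilde{\mathbf K}\int_{\tilde{\mathcal B}}\mathrm{Cov}\Big(\Big|\sqrt{1-\rho^2(\tilde{\mathbf t})}\,Z_1+\rho(\tilde{\mathbf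 t})Z_2\Big|,\,|Z_2|\Big)\,d\tilde{\mathbf t},\qquad \sigma=\sqrt{\sigma^2}.$$ The test statistic. Put $$\hat v_{n,l}(\mathbf x_l)=\frac{1}{nh_n^{2d_l}}\sum_{i=1}^nK_l^2\Big(\frac{\mathbf x_l-\mathbb X_i^l}{h_n}\Big),\quad g_{n,l}(\mathbf x_l)=\frac{1}{n(n-1)h_n^{2d_l}}\sum_{i=1}^n\sum_{j\ne i}K_l\Big(\frac{\mathbf x_l-\mathbb X_i^l}{h_n}\Big)K_l\Big(\frac{\mathbf x_l-\mathbb X_j^l}{h_n}\Big),$$ $$\hat{\mathcal L}_n(\tilde{\mathbf x})=\prod_{l=1}^p\hat v_{n,l}(\mathbf x_l)-\sum_{l=1}^p\hat v_{n,l}(\mathbf x_l)\prod_{j\ne l}g_{n,j}(\mathbf x_j)+(p-1)\prod_{l=1}^pg_{n,l}(\mathbf x_l),$$ $$a_n(A)=\mathbb E|Z_1|\int_A\sqrt{\hat{\mathcal L}_n(\tilde{\mathbf x})}\,d\tilde{\mathbf x},\qquad T_n(A)=\frac{\sqrt n\,V_n(A)-a_n(A)}{\sigma}.$$ For $\alpha\in(0,1)$, $z_{1-\alpha}$ is the upper $\alpha$ quantile of the standard normal law, i.e. $\mathbb P(Z_1>z_{1-\alpha})=\alpha$. *)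

theory Defs
  imports "HOL-Probability.Probability"
begin

text \<open>
  Since the block dimensions vary with the block, Euclidean space of dimension s is the finite
  product measure space over the index set {1..s}, with its Borel sets and Lebesgue measure.
  Its elements are functions that are undefined outside {1..s}, so vector operations
  re-restrict to that index set. A vector of the full space is the tuple of its blocks; its
  block l is x l, with coordinates x l k. All densities and kernels are Borel measurable versions.
\<close>

definition euclid :: "nat \<Rightarrow> (nat \<Rightarrow> real) measure" where
  "euclid s = (\<Pi>\<^sub>M k\<in>{1..s}. lborel)"

definition blocks :: "nat \<Rightarrow> (nat \<Rightarrow> nat) \<Rightarrow> (nat \<Rightarrow> nat \<Rightarrow> real) measure" where
  "blocks p d = (\<Pi>\<^sub>M l\<in>{1..p}. euclid (d l))"

definition vadd :: "nat \<Rightarrow> (nat \<Rightarrow> real) \<Rightarrow> (nat \<Rightarrow> real) \<Rightarrow> nat \<Rightarrow> real" where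
  "vadd s u t = (\<lambda>k\<in>{1..s}. u k + t k)"

definition vscale :: "nat \<Rightarrow> real \<Rightarrow> (nat \<Rightarrow> real) \<Rightarrow> nat \<Rightarrow> real" where
  "vscale s c u = (\<lambda>k\<in>{1..s}. c * u k)"

definition scaled_diff :: "nat \<Rightarrow> real \<Rightarrow> (nat \<Rightarrow> real) \<Rightarrow> (nat \<Rightarrow> real) \<Rightarrow> nat \<Rightarrow> real" where
  "scaled_diff s b x y = (\<lambda>k\<in>{1..s}. (x k - y k) / b)"

definition is_norm :: "nat \<Rightarrow> ((nat \<Rightarrow> real) \<Rightarrow> real) \<Rightarrow> bool" where
  "is_norm s N \<longleftrightarrow>
     (\<forall>u\<in>space (euclid s). 0 \<le> N u \<and> (N u = 0 \<longleftrightarrow> (\<forall>k\<in>{1..s}. u k = 0))) \<and>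
     (\<forall>c. \<forall>u\<in>space (euclid s). N (vscale s c u) = \<bar>c\<bar> * N u) \<and>
     (\<forall>u\<in>space (euclid s). \<forall>v\<in>space (euclid s). N (vadd s u v) \<le> N u + N v)"

definition is_pdf :: "'a measure \<Rightarrow> ('a \<Rightarrow> real) \<Rightarrow> bool" where
  "is_pdf N g \<longleftrightarrow> (\<forall>x\<in>space N. 0 \<le> g x) \<and> has_bochner_integral N g 1"

definition has_density :: "'w measure \<Rightarrow> 'a measure \<Rightarrow> ('w \<Rightarrow> 'a) \<Rightarrow> ('a \<Rightarrow> real) \<Rightarrow> bool" where
  "has_density M N Y g \<longleftrightarrow> (\<forall>x\<in>space N. 0 \<le> g x) \<and> distributed M N Y (\<lambda>x. ennreal (g x))"

definition bounded_blocks :: "nat \<Rightarrow> (nat \<Rightarrow> nat) \<Rightarrow> (nat \<Rightarrow> nat \<Rightarrow> real) set \<Rightarrow> bool" where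
  "bounded_blocks p d A \<longleftrightarrow> (\<exists>C. \<forall>x\<in>A. \<forall>l\<in>{1..p}. \<forall>k\<in>{1..d l}. \<bar>x l k\<bar> \<le> C)"

text \<open>
  In the estimators below, b is the bandwidth, Y 1, ..., Y n is the sample (Y i l being
  block l of the i-th observation), and s is the dimension of a single block with kernel k.
\<close>

definition f_joint ::
  "nat \<Rightarrow> (nat \<Rightarrow> nat) \<Rightarrow> (nat \<Rightarrow> (nat \<Rightarrow> real) \<Rightarrow> real) \<Rightarrow> real \<Rightarrow> nat
    \<Rightarrow> (nat \<Rightarrow> nat \<Rightarrow> nat \<Rightarrow> real) \<Rightarrow> (nat \<Rightarrow> nat \<Rightarrow> real) \<Rightarrow> real" where
  "f_joint p d K b n Y x =
     (\<Sum>i=1..n. \<Prod>l=1..p. K l (scaled_diff (d l) b (x l) (Y i l))) / (real n * b ^ (\<Sum>l=1..p. d l))"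

definition f_marg ::
  "nat \<Rightarrow> ((nat \<Rightarrow> real) \<Rightarrow> real) \<Rightarrow> real \<Rightarrow> nat \<Rightarrow> (nat \<Rightarrow> nat \<Rightarrow> real)
    \<Rightarrow> (nat \<Rightarrow> real) \<Rightarrow> real" where
  "f_marg s k b n Y x = (\<Sum>i=1..n. k (scaled_diff s b x (Y i))) / (real n * b ^ s)"

definition v_hat ::
  "nat \<Rightarrow> ((nat \<Rightarrow> real) \<Rightarrow> real) \<Rightarrow> real \<Rightarrow> nat \<Rightarrow> (nat \<Rightarrow> nat \<Rightarrow> real)
    \<Rightarrow> (nat \<Rightarrow> real) \<Rightarrow> real" where
  "v_hat s k b n Y x = (\<Sum>i=1..n. (k (scaled_diff s b x (Y i)))\<^sup>2) / (real n * b ^ (2 * s))"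

definition g_hat ::
  "nat \<Rightarrow> ((nat \<Rightarrow> real) \<Rightarrow> real) \<Rightarrow> real \<Rightarrow> nat \<Rightarrow> (nat \<Rightarrow> nat \<Rightarrow> real)
    \<Rightarrow> (nat \<Rightarrow> real) \<Rightarrow> real" where
  "g_hat s k b n Y x =
     (\<Sum>i=1..n. \<Sum>j\<in>{1..n} - {i}. k (scaled_diff s b x (Y i)) * k (scaled_diff s b x (Y j)))
       / (real n * (real n - 1) * b ^ (2 * s))"

definition L_hat ::
  "nat \<Rightarrow> (nat \<Rightarrow> nat) \<Rightarrow> (nat \<Rightarrow> (nat \<Rightarrow> real) \<Rightarrow> real) \<Rightarrow> real \<Rightarrow> nat
    \<Rightarrow> (nat \<Rightarrow> nat \<Rightarrow> nat \<Rightarrow> real) \<Rightarrow> (nat \<Rightarrow> nat \<Rightarrow> real) \<Rightarrow> real" where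
  "L_hat p d K b n Y x =
     (let v = (\<lambda>l. v_hat (d l) (K l) b n (\<lambda>i. Y i l) (x l));
          g = (\<lambda>l. g_hat (d l) (K l) b n (\<lambda>i. Y i l) (x l))
      in (\<Prod>l=1..p. v l) - (\<Sum>l=1..p. v l * (\<Prod>j\<in>{1..p} - {l}. g j))
           + (real p - 1) * (\<Prod>l=1..p. g l))"

definition V_emp ::
  "nat \<Rightarrow> (nat \<Rightarrow> nat) \<Rightarrow> (nat \<Rightarrow> (nat \<Rightarrow> real) \<Rightarrow> real) \<Rightarrow> real \<Rightarrow> nat
    \<Rightarrow> (nat \<Rightarrow> nat \<Rightarrow> nat \<Rightarrow> real) \<Rightarrow> (nat \<Rightarrow> nat \<Rightarrow> real) set \<Rightarrow> real" where
  "V_emp p d K b n Y A =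
     (LINT x:A|blocks p d.
        \<bar>f_joint p d K b n Y x - (\<Prod>l=1..p. f_marg (d l) (K l) b n (\<lambda>i. Y i l) (x l))\<bar>)"

definition V_pop ::
  "nat \<Rightarrow> (nat \<Rightarrow> nat) \<Rightarrow> ((nat \<Rightarrow> nat \<Rightarrow> real) \<Rightarrow> real) \<Rightarrow> (nat \<Rightarrow> (nat \<Rightarrow> real) \<Rightarrow> real)
    \<Rightarrow> (nat \<Rightarrow> nat \<Rightarrow> real) set \<Rightarrow> real" where
  "V_pop p d f fl A = (LINT x:A|blocks p d. \<bar>f x - (\<Prod>l=1..p. fl l (x l))\<bar>)"

definition L2_norm_on :: "'a measure \<Rightarrow> ('a \<Rightarrow> real) \<Rightarrow> real" where
  "L2_norm_on N g = sqrt (LINT u|N. (g u)\<^sup>2)"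

definition rho_block :: "nat \<Rightarrow> ((nat \<Rightarrow> real) \<Rightarrow> real) \<Rightarrow> (nat \<Rightarrow> real) \<Rightarrow> real" where
  "rho_block s k t =
     (LINT u|euclid s. k u * k (vadd s u t)) / (L2_norm_on (euclid s) k)\<^sup>2"

definition rho ::
  "nat \<Rightarrow> (nat \<Rightarrow> nat) \<Rightarrow> (nat \<Rightarrow> (nat \<Rightarrow> real) \<Rightarrow> real) \<Rightarrow> (nat \<Rightarrow> nat \<Rightarrow> real) \<Rightarrow> real" where
  "rho p d K t = (\<Prod>l=1..p. rho_block (d l) (K l) (t l))"

definition K_tilde :: "nat \<Rightarrow> (nat \<Rightarrow> nat) \<Rightarrow> (nat \<Rightarrow> (nat \<Rightarrow> real) \<Rightarrow> real) \<Rightarrow> real" where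
  "K_tilde p d K = (\<Prod>l=1..p. (L2_norm_on (euclid (d l)) (K l))\<^sup>2)"

definition covariance :: "'a measure \<Rightarrow> ('a \<Rightarrow> real) \<Rightarrow> ('a \<Rightarrow> real) \<Rightarrow> real" where
  "covariance M X Y = (LINT w|M. (X w - (LINT w|M. X w)) * (Y w - (LINT w|M. Y w)))"

text \<open>The coordinates of this space are the independent standard normal Z1 and Z2.\<close>

abbreviation normal_pair :: "(real \<times> real) measure" where
  "normal_pair \<equiv> std_normal_distribution \<Otimes>\<^sub>M std_normal_distribution"

definition ball_blocks ::
  "nat \<Rightarrow> (nat \<Rightarrow> nat) \<Rightarrow> (nat \<Rightarrow> (nat \<Rightarrow> real) \<Rightarrow> real) \<Rightarrow> (nat \<Rightarrow> nat \<Rightarrow> real) set" where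
  "ball_blocks p d nrm = (\<Pi>\<^sub>E l\<in>{1..p}. {u \<in> space (euclid (d l)). nrm (d l) u \<le> 1})"

definition sigma2 ::
  "nat \<Rightarrow> (nat \<Rightarrow> nat) \<Rightarrow> (nat \<Rightarrow> (nat \<Rightarrow> real) \<Rightarrow> real) \<Rightarrow> (nat \<Rightarrow> (nat \<Rightarrow> real) \<Rightarrow> real) \<Rightarrow> real" where
  "sigma2 p d nrm K =
     K_tilde p d K *
     (LINT t:ball_blocks p d nrm|blocks p d.
        covariance normal_pair
          (\<lambda>(z1, z2). \<bar>sqrt (1 - (rho p d K t)\<^sup>2) * z1 + rho p d K t * z2\<bar>)
          (\<lambda>(z1, z2). \<bar>z2\<bar>))"

definition a_center ::
  "nat \<Rightarrow> (nat \<Rightarrow> nat) \<Rightarrow> (nat \<Rightarrow> (nat \<Rightarrow> real) \<Rightarrow> real) \<Rightarrow> real \<Rightarrow> nat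
    \<Rightarrow> (nat \<Rightarrow> nat \<Rightarrow> nat \<Rightarrow> real) \<Rightarrow> (nat \<Rightarrow> nat \<Rightarrow> real) set \<Rightarrow> real" where
  "a_center p d K b n Y A =
     (LINT z|std_normal_distribution. \<bar>z\<bar>) * (LINT x:A|blocks p d. sqrt (L_hat p d K b n Y x))"

definition test_stat ::
  "nat \<Rightarrow> (nat \<Rightarrow> nat) \<Rightarrow> (nat \<Rightarrow> (nat \<Rightarrow> real) \<Rightarrow> real) \<Rightarrow> (nat \<Rightarrow> (nat \<Rightarrow> real) \<Rightarrow> real)
    \<Rightarrow> real \<Rightarrow> nat \<Rightarrow> (nat \<Rightarrow> nat \<Rightarrow> nat \<Rightarrow> real) \<Rightarrow> (nat \<Rightarrow> nat \<Rightarrow> real) set \<Rightarrow> real" where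
  "test_stat p d nrm K b n Y A =
     (sqrt (real n) * V_emp p d K b n Y A - a_center p d K b n Y A) / sqrt (sigma2 p d nrm K)"

end

theory Submission
  imports Defs
begin

text \<open>
Write \<open>V\<^sub>n\<close> and \<open>V\<close> for the integrals over the bounded set \<open>D\<close>, \<open>h\<close> for the bandwidth and \<open>d\<close> for
the total dimension. The test statistic is \<open>(sqrt n * V\<^sub>n - a\<^sub>n) / \<sigma>\<close>. Under the alternative \<open>V\<^sub>n\<close>
stays away from 0, while the centering \<open>a\<^sub>n\<close> grows more slowly than \<open>sqrt n\<close>; hence the statistic
tends to infinity in probability, and it exceeds every fixed \<open>z\<close> with probability tending to 1.
Three facts make this precise.

(1) \<open>V\<^sub>n \<ge> V - error\<close>, where the error is the \<open>L\<^sub>1\<close> distance on a cube around \<open>D\<close> of the joint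
estimator from \<open>f\<close>, plus the \<open>L\<^sub>1\<close> distances of the marginal estimators from the \<open>f\<^sub>l\<close>. This is the
triangle inequality together with a telescoping bound for products of densities
(\<open>L1_dist_prod_le\<close>, \<open>V_pop_le\<close>). The expected error vanishes by the mean consistency of kernel
density estimators (\<open>kde_L1_consistent\<close>): the bias is at most the average over the kernel of the
\<open>L\<^sub>1\<close> distance between the density and its translates by \<open>h u\<close>, which vanishes because translation
is continuous in \<open>L\<^sub>1\<close>; the stochastic part has, on a set of finite measure, mean of order
\<open>1 / sqrt (n h^d)\<close>. Markov's inequality turns this into convergence in probability.

(2) \<open>a\<^sub>n\<close> is at most a constant times \<open>h^(- d / 2)\<close> for every sample of two or more
observations (\<open>a_center_le\<close>). The inequality \<open>g_hat \<le> v_hat\<close> between cross terms and squares gives \<open>L_hat \<le> p * \<Prod> v_hat\<close>, and the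
integral of the product of the \<open>v_hat\<close> does not depend on the sample. Thus \<open>a\<^sub>n / sqrt n\<close> is of
order \<open>1 / sqrt (n h^d)\<close>.

(3) \<open>\<sigma>\<^sup>2 > 0\<close> (\<open>sigma2_pos\<close>). With \<open>m\<close> the mean of \<open>\<bar>Z2\<bar>\<close>, reflecting \<open>Z1\<close> turns the covariance at
correlation \<open>\<rho>\<close> into the mean of
\<open>(max \<bar>sqrt (1 - \<rho>\<^sup>2) Z1\<bar> \<bar>\<rho> Z2\<bar> - max \<bar>sqrt (1 - \<rho>\<^sup>2) Z1\<bar> (\<rho> m)) (\<bar>Z2\<bar> - m)\<close>, whose two
factors have the same sign; it is positive for \<open>\<rho> > 0\<close>. Finally \<open>\<rho>\<close>, the normalised
autocorrelation of the product kernel, cannot vanish almost everywhere on a neighbourhood of the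
origin, since a nonzero kernel has positive mass on some cell of an arbitrarily fine grid.

The same two geometric facts are needed on each block and on the product of the blocks: how
\<open>x \<mapsto> (x - y) / b\<close> and \<open>y \<mapsto> (x - y) / b\<close> transform the measure, and that translations converge to
the identity in \<open>L\<^sub>1\<close>. Both are therefore formulated for arbitrary measures and shown to pass to
finite products; from the real line they then reach the blocks, and from the blocks the full space.
\<close>

section \<open>Maps that rescale a measure, and maps that are nearly the identity in mean\<close>

text \<open>
The push-forward of the measure is a multiple of the measure. On Euclidean space the affine maps
have this property, with the reciprocal of the Jacobian as the constant.
\<close>

definition rescales :: "'a measure \<Rightarrow> ('a \<Rightarrow> 'a) \<Rightarrow> real \<Rightarrow> bool" where
  "rescales N \<phi> c \<longleftrightarrow> \<phi> \<in> measurable N N \<and> distr N N \<phi> = scale_measure (ennreal c) N"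

lemma rescales_nn_integral:
  assumes "rescales N \<phi> c" and g: "g \<in> borel_measurable N"
  shows "(\<integral>\<^sup>+x. g (\<phi> x) \<partial>N) = ennreal c * (\<integral>\<^sup>+x. g x \<partial>N)"
proof -
  have [measurable]: "\<phi> \<in> measurable N N" and eq: "distr N N \<phi> = scale_measure (ennreal c) N"
    using assms by (auto simp: rescales_def)
  have "(\<integral>\<^sup>+x. g (\<phi> x) \<partial>N) = (\<integral>\<^sup>+x. g x \<partial>distr N N \<phi>)"
    using g by (subst nn_integral_distr) auto
  then show ?thesis
    using g by (simp add: eq nn_integral_scale_measure)
qed

lemma rescales_integral:
  fixes g :: "'a \<Rightarrow> real"
  assumes "rescales N \<phi> c" and c: "0 \<le> c" and g: "integrable N g"
  shows "integrable N (\<lambda>x. g (\<phi> x))" and "(LINT x|N. g (\<phi> x)) = c * (LINT x|N. g x)"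
proof -
  have [measurable]: "\<phi> \<in> measurable N N" using assms by (auto simp: rescales_def)
  have [measurable]: "g \<in> borel_measurable N" using g by auto
  note nn = rescales_nn_integral[OF assms(1)]
  have "(\<integral>\<^sup>+x. ennreal (norm (g (\<phi> x))) \<partial>N) = ennreal c * (\<integral>\<^sup>+x. ennreal (norm (g x)) \<partial>N)"
    by (rule nn[of "\<lambda>x. ennreal (norm (g x))"]) measurable
  also have "\<dots> < \<infinity>"
    using g by (auto simp: integrable_iff_bounded ennreal_mult_less_top)
  finally show int: "integrable N (\<lambda>x. g (\<phi> x))"
    by (auto simp: integrable_iff_bounded)
  have "(LINT x|N. g (\<phi> x)) =
      enn2real (\<integral>\<^sup>+x. ennreal (g (\<phi> x)) \<partial>N) - enn2real (\<integral>\<^sup>+x. ennreal (- g (\<phi> x)) \<partial>N)"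
    by (rule real_lebesgue_integral_def[OF int])
  also have "\<dots> = c * enn2real (\<integral>\<^sup>+x. ennreal (g x) \<partial>N) - c * enn2real (\<integral>\<^sup>+x. ennreal (- g x) \<partial>N)"
    using nn[of "\<lambda>x. ennreal (g x)"] nn[of "\<lambda>x. ennreal (- g x)"] c by (simp add: enn2real_mult)
  finally show "(LINT x|N. g (\<phi> x)) = c * (LINT x|N. g x)"
    by (simp add: real_lebesgue_integral_def[OF g] right_diff_distrib)
qed

lemma rescales_affine:
  assumes "c \<noteq> (0::real)"
  shows "rescales lborel (\<lambda>x. t + c * x) (1 / \<bar>c\<bar>)"
  unfolding rescales_def
proof
  show "distr lborel lborel (\<lambda>x. t + c * x) = scale_measure (ennreal (1 / \<bar>c\<bar>)) lborel"
  proof (rule measure_eqI)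
    fix A assume "A \<in> sets (distr lborel lborel (\<lambda>x. t + c * x))"
    then have A[measurable]: "A \<in> sets borel" by simp
    have "emeasure (distr lborel lborel (\<lambda>x. t + c * x)) A = (\<integral>\<^sup>+x. indicator A (t + c * x) \<partial>lborel)"
      by (subst nn_integral_distr[symmetric, of _ _ lborel]) auto
    moreover have "emeasure lborel A = \<bar>c\<bar> * (\<integral>\<^sup>+x. indicator A (t + c * x) \<partial>lborel)"
      using nn_integral_real_affine[of "indicator A" c t] assms by simp
    moreover have "ennreal (1 / \<bar>c\<bar>) * (ennreal \<bar>c\<bar> * y) = y" for y
      using assms by (simp add: mult.assoc[symmetric] ennreal_mult[symmetric])
    ultimately show "emeasure (distr lborel lborel (\<lambda>x. t + c * x)) A =
        emeasure (scale_measure (ennreal (1 / \<bar>c\<bar>)) lborel) A" by simp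
  qed simp
qed simp

text \<open>
A product measure is determined by its values on rectangles, and the preimage of a rectangle under
a coordinatewise map is a rectangle. Since \<open>PiM_eqI\<close> characterises the unscaled product, the
constant is first divided out.
\<close>

lemma rescales_PiM:
  fixes M :: "'i \<Rightarrow> 'a measure"
  assumes "product_sigma_finite M" and I: "finite I"
    and resc: "\<And>i. i \<in> I \<Longrightarrow> rescales (M i) (\<phi> i) (c i)" and c: "\<And>i. i \<in> I \<Longrightarrow> 0 < c i"
  shows "rescales (PiM I M) (\<lambda>x. \<lambda>i\<in>I. \<phi> i (x i)) (\<Prod>i\<in>I. c i)"
proof -
  interpret product_sigma_finite M by fact
  let ?C = "\<Prod>i\<in>I. c i" and ?\<phi> = "\<lambda>x. \<lambda>i\<in>I. \<phi> i (x i)"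
  have C: "0 < ?C" using c by (auto intro: prod_pos)
  have m: "\<phi> i \<in> measurable (M i) (M i)" if "i \<in> I" for i using resc[OF that] by (simp add: rescales_def)
  have meas: "?\<phi> \<in> measurable (PiM I M) (PiM I M)"
    using m by (intro measurable_restrict measurable_compose[OF measurable_component_singleton]) auto
  have eq: "scale_measure (ennreal (1 / ?C)) (distr (PiM I M) (PiM I M) ?\<phi>) = PiM I M"
  proof (rule PiM_eqI[OF I])
    fix A assume A: "\<And>i. i \<in> I \<Longrightarrow> A i \<in> sets (M i)"
    have "?\<phi> -` Pi\<^sub>E I A \<inter> space (PiM I M) = Pi\<^sub>E I (\<lambda>i. \<phi> i -` A i \<inter> space (M i))"
      by (auto simp: space_PiM PiE_iff)
    moreover have "emeasure (M i) (\<phi> i -` A i \<inter> space (M i)) = ennreal (c i) * emeasure (M i) (A i)"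
      if i: "i \<in> I" for i
      using resc[OF i] A[OF i] emeasure_distr[OF m[OF i] A[OF i]] by (simp add: rescales_def)
    moreover have "\<phi> i -` A i \<inter> space (M i) \<in> sets (M i)" if "i \<in> I" for i
      using m[OF that] A[OF that] by (rule measurable_sets)
    ultimately have "emeasure (distr (PiM I M) (PiM I M) ?\<phi>) (Pi\<^sub>E I A) =
        (\<Prod>i\<in>I. ennreal (c i) * emeasure (M i) (A i))"
      using A I by (subst emeasure_distr[OF meas]) (auto intro!: sets_PiM_I_finite simp: emeasure_PiM)
    also have "\<dots> = ennreal ?C * (\<Prod>i\<in>I. emeasure (M i) (A i))"
      using c by (simp add: prod.distrib prod_ennreal less_imp_le)
    finally show "emeasure (scale_measure (ennreal (1 / ?C)) (distr (PiM I M) (PiM I M) ?\<phi>)) (Pi\<^sub>E I A) =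
        (\<Prod>i\<in>I. emeasure (M i) (A i))"
      using C by (simp add: mult.assoc[symmetric] ennreal_mult[symmetric])
  qed simp
  have "scale_measure (ennreal ?C) (PiM I M) =
      scale_measure (ennreal ?C) (scale_measure (ennreal (1 / ?C)) (distr (PiM I M) (PiM I M) ?\<phi>))"
    by (simp add: eq)
  also have "\<dots> = distr (PiM I M) (PiM I M) ?\<phi>"
    using C by (simp add: ennreal_mult[symmetric])
  finally show ?thesis using meas by (simp add: rescales_def)
qed

lemma tendsto_0_dominated_ennreal:
  fixes f g :: "nat \<Rightarrow> ennreal"
  assumes "g \<longlonglongrightarrow> 0" and "\<And>n. f n \<le> g n"
  shows "f \<longlonglongrightarrow> 0"
  using assms by (intro tendsto_sandwich[OF _ _ tendsto_const assms(1)]) auto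

lemma prod_less_top_ennreal:
  fixes g :: "'i \<Rightarrow> ennreal"
  assumes "finite I" and "\<And>i. i \<in> I \<Longrightarrow> g i \<noteq> \<infinity>"
  shows "(\<Prod>i\<in>I. g i) < \<infinity>"
  using assms by (induct I rule: finite_induct) (auto simp: ennreal_mult_less_top less_top)

lemma emeasure_PiM_less_top:
  assumes "product_sigma_finite M" and I: "finite I"
    and A: "\<And>i. i \<in> I \<Longrightarrow> A i \<in> sets (M i)" "\<And>i. i \<in> I \<Longrightarrow> emeasure (M i) (A i) < \<infinity>"
  shows "emeasure (PiM I M) (Pi\<^sub>E I A) < \<infinity>"
proof -
  interpret product_sigma_finite M by fact
  interpret finite_product_sigma_finite M I by standard fact
  have "emeasure (PiM I M) (Pi\<^sub>E I A) = (\<Prod>i\<in>I. emeasure (M i) (A i))"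
    using A(1) by (rule measure_times)
  also have "\<dots> < \<infinity>" by (intro prod_less_top_ennreal I less_imp_neq A(2))
  finally show ?thesis .
qed

definition L1_dist :: "'a measure \<Rightarrow> ('a \<Rightarrow> real) \<Rightarrow> ('a \<Rightarrow> real) \<Rightarrow> ennreal" where
  "L1_dist N f g = (\<integral>\<^sup>+x. ennreal \<bar>f x - g x\<bar> \<partial>N)"

lemma L1_dist_commute: "L1_dist N f g = L1_dist N g f"
  by (simp add: L1_dist_def abs_minus_commute)

lemma L1_dist_triangle:
  assumes [measurable]: "f \<in> borel_measurable N" "g \<in> borel_measurable N" "k \<in> borel_measurable N"
  shows "L1_dist N f k \<le> L1_dist N f g + L1_dist N g k"
proof -
  have "L1_dist N f k \<le> (\<integral>\<^sup>+x. ennreal \<bar>f x - g x\<bar> + ennreal \<bar>g x - k x\<bar> \<partial>N)"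
    unfolding L1_dist_def by (intro nn_integral_mono) (simp flip: ennreal_plus)
  then show ?thesis unfolding L1_dist_def by (subst (asm) nn_integral_add) auto
qed

text \<open>
Measure-preserving maps that converge to the identity as operators on \<open>L\<^sub>1\<close>. Translations by
vectors tending to 0 are the example of interest; the constant 1 makes each map an \<open>L\<^sub>1\<close> isometry.
\<close>

definition L1_near_identity :: "'a measure \<Rightarrow> (nat \<Rightarrow> 'a \<Rightarrow> 'a) \<Rightarrow> bool" where
  "L1_near_identity N T \<longleftrightarrow> (\<forall>n. rescales N (T n) 1) \<and>
     (\<forall>g. integrable N g \<longrightarrow> (\<lambda>n. L1_dist N (\<lambda>x. g (T n x)) g) \<longlonglongrightarrow> 0)"

text \<open>
The functions that are asymptotically fixed by the maps form an \<open>L\<^sub>1\<close>-closed set: composition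
with a measure-preserving map is an isometry, so replacing \<open>f\<close> by an approximation costs twice its
distance from \<open>f\<close>, uniformly in \<open>n\<close>.
\<close>

lemma L1_drift_closed:
  fixes N :: "'a measure" and f :: "'a \<Rightarrow> real" and s :: "nat \<Rightarrow> 'a \<Rightarrow> real"
  assumes T: "\<And>n. rescales N (T n) 1"
    and f[measurable]: "f \<in> borel_measurable N" and s[measurable]: "\<And>i. s i \<in> borel_measurable N"
    and lim: "(\<lambda>i. L1_dist N f (s i)) \<longlonglongrightarrow> 0"
    and van: "\<And>i. (\<lambda>n. L1_dist N (\<lambda>x. s i (T n x)) (s i)) \<longlonglongrightarrow> 0"
  shows "(\<lambda>n. L1_dist N (\<lambda>x. f (T n x)) f) \<longlonglongrightarrow> 0"
proof (rule order_tendstoI)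
  fix e :: ennreal assume e: "0 < e"
  have Tm[measurable]: "T n \<in> measurable N N" for n using T by (simp add: rescales_def)
  define a where "a = min e 1"
  have a: "0 < a" "a \<le> e" "a < \<top>" using e by (auto simp: a_def min_less_iff_disj)
  then obtain r where r: "a = ennreal r" "0 < r" by (cases a) auto
  have r3: "0 < ennreal (r / 3)" using r by simp
  obtain i where i: "L1_dist N f (s i) < ennreal (r/3)"
    using order_tendstoD(2)[OF lim r3] by (auto dest: eventually_happens)
  have "\<forall>\<^sub>F n in sequentially. L1_dist N (\<lambda>x. s i (T n x)) (s i) < ennreal (r/3)"
    using order_tendstoD(2)[OF van r3] .
  then show "\<forall>\<^sub>F n in sequentially. L1_dist N (\<lambda>x. f (T n x)) f < e"
  proof eventually_elim
    case (elim n)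
    have 1: "L1_dist N (\<lambda>x. f (T n x)) (\<lambda>x. s i (T n x)) = L1_dist N f (s i)"
      unfolding L1_dist_def
      using rescales_nn_integral[OF T, of "\<lambda>x. ennreal \<bar>f x - s i x\<bar>" n] by simp
    have "L1_dist N (\<lambda>x. f (T n x)) f \<le>
        L1_dist N (\<lambda>x. f (T n x)) (\<lambda>x. s i (T n x)) + L1_dist N (\<lambda>x. s i (T n x)) f"
      by (rule L1_dist_triangle) measurable
    also have "\<dots> \<le> L1_dist N (\<lambda>x. f (T n x)) (\<lambda>x. s i (T n x)) +
        (L1_dist N (\<lambda>x. s i (T n x)) (s i) + L1_dist N (s i) f)"
      by (intro add_left_mono L1_dist_triangle) measurable
    also have "\<dots> = L1_dist N f (s i) + L1_dist N (\<lambda>x. s i (T n x)) (s i) + L1_dist N f (s i)"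
      using 1 by (simp add: L1_dist_commute[of N "s i"] ac_simps)
    also have "\<dots> < ennreal (r/3) + ennreal (r/3) + ennreal (r/3)"
      using i elim by (intro add_strict_mono) 
    also have "\<dots> = a" using r by (simp flip: ennreal_plus)
    finally show ?case using a by simp
  qed
qed simp

text \<open>
Covers sums, differences and disjoint unions at once, since only the increments of \<open>h\<close> have to be
controlled by those of \<open>f\<close> and \<open>g\<close>.
\<close>

lemma L1_drift_triangle:
  fixes N :: "'a measure" and f g :: "'a \<Rightarrow> real" and a b :: real
  assumes T: "\<And>n. rescales N (T n) 1"
    and [measurable]: "f \<in> borel_measurable N" "g \<in> borel_measurable N"
    and F: "(\<lambda>n. L1_dist N (\<lambda>x. f (T n x)) f) \<longlonglongrightarrow> 0" and G: "(\<lambda>n. L1_dist N (\<lambda>x. g (T n x)) g) \<longlonglongrightarrow> 0"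
    and lin: "\<And>n x y. x \<in> space N \<Longrightarrow> y \<in> space N \<Longrightarrow> \<bar>h x - h y\<bar> \<le> \<bar>f x - f y\<bar> + \<bar>g x - g y\<bar>"
  shows "(\<lambda>n. L1_dist N (\<lambda>x. h (T n x)) h) \<longlonglongrightarrow> 0"
proof (rule tendsto_0_dominated_ennreal)
  have Tm[measurable]: "T n \<in> measurable N N" for n using T by (simp add: rescales_def)
  have Ts: "T n x \<in> space N" if "x \<in> space N" for n x using measurable_space[OF Tm that] .
  show "(\<lambda>n. L1_dist N (\<lambda>x. f (T n x)) f + L1_dist N (\<lambda>x. g (T n x)) g) \<longlonglongrightarrow> 0"
    using tendsto_add[OF F G] by simp
  show "L1_dist N (\<lambda>x. h (T n x)) h \<le> L1_dist N (\<lambda>x. f (T n x)) f + L1_dist N (\<lambda>x. g (T n x)) g" for n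
    unfolding L1_dist_def
    by (subst nn_integral_add[symmetric])
       (auto intro!: nn_integral_mono lin Ts simp flip: ennreal_plus)
qed

lemma L1_drift_incseq:
  fixes N :: "'a measure"
  assumes T: "\<And>n. rescales N (T n) 1"
    and A: "\<And>i. A i \<in> sets N" "incseq A" "(\<Union>i. A i) = B" "emeasure N B < \<infinity>"
    and van: "\<And>i. (\<lambda>n. L1_dist N (\<lambda>x. indicator (A i) (T n x)) (indicator (A i))) \<longlonglongrightarrow> 0"
  shows "(\<lambda>n. L1_dist N (\<lambda>x. indicator B (T n x)) (indicator B)) \<longlonglongrightarrow> 0"
proof (rule L1_drift_closed[OF T _ _ _ van])
  have B: "B \<in> sets N" using A by auto
  show "indicator B \<in> borel_measurable N" "\<And>i. indicator (A i) \<in> borel_measurable N" using A B by auto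
  have "L1_dist N (indicator B) (indicator (A i)) = emeasure N (B - A i)" for i
  proof -
    have "L1_dist N (indicator B) (indicator (A i)) = (\<integral>\<^sup>+x. indicator (B - A i) x \<partial>N)"
      unfolding L1_dist_def using A(3) by (intro nn_integral_cong) (auto split: split_indicator)
    then show ?thesis using A B by simp
  qed
  moreover have "(\<lambda>i. emeasure N (B - A i)) \<longlonglongrightarrow> emeasure N (\<Inter>i. B - A i)"
  proof (rule Lim_emeasure_decseq)
    show "decseq (\<lambda>i. B - A i)" using A(2) by (auto simp: decseq_def incseq_def)
    fix i have "emeasure N (B - A i) \<le> emeasure N B" using B by (intro emeasure_mono) auto
    then show "emeasure N (B - A i) \<noteq> \<infinity>" using A(4) by (auto simp: top_unique)
  qed (use A B in auto)
  moreover have 0: "(\<Inter>i. B - A i) = {}" using A(3) by auto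
  ultimately show "(\<lambda>i. L1_dist N (indicator B) (indicator (A i))) \<longlonglongrightarrow> 0" by (simp only: emeasure_empty)
qed

text \<open>
It suffices to test the sets of an intersection-stable generator. After cutting off by the sets
\<open>F i\<close> of finite measure, the good sets form a Dynkin system; countable unions are limits in \<open>L\<^sub>1\<close>
because the cut-off makes all measures finite. Removing the cut-off is again a limit, and
simple functions are dense in \<open>L\<^sub>1\<close>.
\<close>

proposition L1_near_identityI:
  fixes N :: "'a measure" and F :: "nat \<Rightarrow> 'a set"
  assumes T: "\<And>n. rescales N (T n) 1"
    and E: "Int_stable E" "E \<subseteq> Pow (space N)" "sets N = sigma_sets (space N) E"
    and F: "\<And>i. F i \<in> E" "incseq F" "(\<Union>i. F i) = space N" "\<And>i. emeasure N (F i) < \<infinity>"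
    and van: "\<And>A i. A \<in> E \<Longrightarrow>
      (\<lambda>n. L1_dist N (\<lambda>x. indicator (A \<inter> F i) (T n x)) (indicator (A \<inter> F i))) \<longlonglongrightarrow> 0"
  shows "L1_near_identity N T"
proof -
  define V where "V g \<longleftrightarrow> (\<lambda>n. L1_dist N (\<lambda>x. g (T n x)) g) \<longlonglongrightarrow> 0" for g :: "'a \<Rightarrow> real"
  have EN: "A \<in> sets N" if "A \<in> E" for A using that E(3) by auto
  have FN: "F i \<in> sets N" for i using F EN by auto
  have Ffin: "emeasure N (A \<inter> F i) < \<infinity>" if "A \<in> sets N" for A i
    using emeasure_mono[of "A \<inter> F i" "F i" N] FN[of i] F(4)[of i] by (auto intro: le_less_trans)
  have VF: "V (indicator (F i))" for i using van[OF F(1), of i i] by (simp add: V_def)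
  have cut_off: "V (indicator (A \<inter> F i))" if "A \<in> sigma_sets (space N) E" for A i
    using E(1,2) that
  proof (induct rule: sigma_sets_induct_disjoint)
    case (basic A) then show ?case using van by (simp add: V_def)
  next
    case empty then show ?case by (simp add: V_def L1_dist_def)
  next
    case (compl A)
    then have [measurable]: "A \<in> sets N" using E(3) by auto
    show ?case unfolding V_def
      by (rule L1_drift_triangle[OF T _ _ VF[unfolded V_def] compl(2)[unfolded V_def]])
         (use FN in \<open>auto split: split_indicator\<close>)
  next
    case (union A)
    then have [measurable]: "A j \<in> sets N" for j using E(3) by auto
    have fin: "V (indicator ((\<Union>j<m. A j) \<inter> F i))" for m
    proof (induct m)
      case 0 then show ?case by (simp add: V_def L1_dist_def)
    next
      case (Suc m)
      have disj: "x \<notin> A m" if "x \<in> A j" "j < m" for x j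
        using disjoint_family_onD[OF union(1), of j m] that by auto
      show ?case unfolding V_def
        by (rule L1_drift_triangle[OF T _ _ Suc[unfolded V_def] union(3)[unfolded V_def], of m])
           (use FN in \<open>auto split: split_indicator simp: less_Suc_eq dest: disj\<close>)
    qed
    show ?case unfolding V_def
      by (rule L1_drift_incseq[OF T, where A = "\<lambda>m. (\<Union>j<m. A j) \<inter> F i"])
         (use FN Ffin fin in \<open>auto simp: incseq_def V_def intro: less_le_trans\<close>)
  qed
  have VA: "V (indicator A)" if A: "A \<in> sets N" "emeasure N A < \<infinity>" for A
    unfolding V_def
  proof (rule L1_drift_incseq[OF T, where A = "\<lambda>i. A \<inter> F i"])
    show "incseq (\<lambda>i. A \<inter> F i)" using F(2) by (auto simp: incseq_def)
    show "(\<Union>i. A \<inter> F i) = A" using F(3) A sets.sets_into_space by auto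
    show "(\<lambda>n. L1_dist N (\<lambda>x. indicator (A \<inter> F i) (T n x)) (indicator (A \<inter> F i))) \<longlonglongrightarrow> 0" for i
      using cut_off[of A i] A E(3) by (simp add: V_def)
  qed (use A FN in auto)
  have "V g" if "integrable N g" for g
    using that
  proof (induct rule: integrable_induct)
    case (base A c)
    have "L1_dist N (\<lambda>x. indicator A (T n x) *\<^sub>R c) (\<lambda>x. indicator A x *\<^sub>R c) =
        ennreal \<bar>c\<bar> * L1_dist N (\<lambda>x. indicator A (T n x)) (indicator A)" for n
    proof -
      have [measurable]: "T n \<in> measurable N N" "A \<in> sets N" using T base by (auto simp: rescales_def)
      have "ennreal \<bar>indicator A (T n x) *\<^sub>R c - indicator A x *\<^sub>R c\<bar> =
         ennreal \<bar>c\<bar> * ennreal \<bar>indicator A (T n x) - indicator A x\<bar>" for x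
        by (simp add: ennreal_mult'[symmetric] abs_mult[symmetric] algebra_simps)
      then show ?thesis unfolding L1_dist_def by (simp add: nn_integral_cmult)
    qed
    moreover have "(\<lambda>n. ennreal \<bar>c\<bar> * L1_dist N (\<lambda>x. indicator A (T n x)) (indicator A)) \<longlonglongrightarrow> ennreal \<bar>c\<bar> * 0"
      using VA[OF base] unfolding V_def by (intro ennreal_tendsto_cmult) auto
    ultimately show ?case unfolding V_def by simp
  next
    case (add f g)
    show ?case unfolding V_def
      by (rule L1_drift_triangle[OF T _ _ add(2)[unfolded V_def] add(4)[unfolded V_def]])
         (use add(1,3) in auto)
  next
    case (lim f s)
    show ?case unfolding V_def
    proof (rule L1_drift_closed[OF T _ _ _ lim(2)[unfolded V_def]])
      have "(\<lambda>i. (\<integral>\<^sup>+x. norm (f x - s i x) \<partial>N)) \<longlonglongrightarrow> 0"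
      proof (rule nn_integral_dominated_convergence_norm[where w = "\<lambda>x. 2 * norm (f x)"])
        show "(\<integral>\<^sup>+ x. ennreal (2 * norm (f x)) \<partial>N) < \<infinity>"
          using lim(5) by (auto simp: integrable_iff_bounded ennreal_mult nn_integral_cmult ennreal_mult_less_top)
      qed (use lim in auto)
      then show "(\<lambda>i. L1_dist N f (s i)) \<longlonglongrightarrow> 0" by (simp add: L1_dist_def)
    qed (use lim in auto)
  qed
  then show ?thesis using T by (auto simp: L1_near_identity_def V_def)
qed

text \<open>
Translating an interval by \<open>t\<close> changes it only within distance \<open>\<bar>t\<bar>\<close> of its two endpoints.
\<close>

lemma L1_near_identity_translation:
  fixes t :: "nat \<Rightarrow> real"
  assumes t: "t \<longlonglongrightarrow> 0"
  shows "L1_near_identity lborel (\<lambda>n x. x - t n)"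
proof (rule L1_near_identityI[where E = "range (\<lambda>(a, b). box a b :: real set)" and F = "\<lambda>i. {- real i<..<real i}"])
  show "rescales lborel (\<lambda>x. x - t n) 1" for n
    using rescales_affine[of 1 "- t n"] by simp
  show "Int_stable (range (\<lambda>(a, b). box a b :: real set))"
    by (auto simp: Int_stable_def box_real)
  show "sets lborel = sigma_sets (space lborel) (range (\<lambda>(a, b). box a b :: real set))"
    by (simp add: borel_eq_box)
  show "(\<Union>i. {- real i<..<real i}) = space lborel"
  proof -
    have "\<exists>i. - real i < x \<and> x < real i" for x
      using reals_Archimedean2[of "\<bar>x\<bar>"] by (auto simp: abs_less_iff) (smt (verit))
    then show ?thesis by auto
  qed
  fix A i assume "A \<in> range (\<lambda>(a, b). box a b :: real set)"
  then obtain a b where A: "A \<inter> {- real i<..<real i} = {a<..<b}"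
    by (auto simp: box_real)
  show "(\<lambda>n. L1_dist lborel (\<lambda>x. indicator (A \<inter> {- real i<..<real i}) (x - t n))
      (indicator (A \<inter> {- real i<..<real i}))) \<longlonglongrightarrow> 0"
    unfolding A
  proof (rule tendsto_0_dominated_ennreal)
    show "L1_dist lborel (\<lambda>x. indicator {a<..<b} (x - t n)) (indicator {a<..<b}) \<le> ennreal (4 * \<bar>t n\<bar>)" for n
    proof -
      have "L1_dist lborel (\<lambda>x. indicator {a<..<b} (x - t n)) (indicator {a<..<b}) \<le>
         (\<integral>\<^sup>+x. indicator {a - \<bar>t n\<bar>..a + \<bar>t n\<bar>} x + indicator {b - \<bar>t n\<bar>..b + \<bar>t n\<bar>} x \<partial>lborel)"
        unfolding L1_dist_def by (intro nn_integral_mono) (auto split: split_indicator)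
      also have "\<dots> = ennreal (4 * \<bar>t n\<bar>)"
        by (subst nn_integral_add) (auto simp flip: ennreal_plus)
      finally show ?thesis .
    qed
    have "(\<lambda>n. 4 * \<bar>t n\<bar>) \<longlonglongrightarrow> 0" using tendsto_mult_right_zero[OF tendsto_rabs_zero[OF t], of 4] by simp
    from tendsto_ennrealI[OF this] show "(\<lambda>n. ennreal (4 * \<bar>t n\<bar>)) \<longlonglongrightarrow> 0" by simp
  qed
qed (auto simp: incseq_def)

text \<open>
Telescoping: in \<open>a A - b B = a (A - B) + (a - b) B\<close> the difference of products is split into a
difference of shorter products and a difference of single factors. It is used with \<open>C = 1\<close> for
products of densities, and with a large \<open>C\<close> for indicators of rectangles.
\<close>

lemma L1_dist_prod_le:
  fixes M :: "'i \<Rightarrow> 'a measure" and a b :: "'i \<Rightarrow> 'a \<Rightarrow> real" and C :: ennreal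
  assumes "product_sigma_finite M" and I: "finite I" and C: "1 \<le> C"
    and m: "\<And>i. i \<in> I \<Longrightarrow> a i \<in> borel_measurable (M i)" "\<And>i. i \<in> I \<Longrightarrow> b i \<in> borel_measurable (M i)"
    and nn: "\<And>i x. i \<in> I \<Longrightarrow> x \<in> space (M i) \<Longrightarrow> 0 \<le> a i x" "\<And>i x. i \<in> I \<Longrightarrow> x \<in> space (M i) \<Longrightarrow> 0 \<le> b i x"
    and le: "\<And>i. i \<in> I \<Longrightarrow> (\<integral>\<^sup>+x. a i x \<partial>M i) \<le> C" "\<And>i. i \<in> I \<Longrightarrow> (\<integral>\<^sup>+x. b i x \<partial>M i) \<le> C"
  shows "L1_dist (PiM I M) (\<lambda>x. \<Prod>i\<in>I. a i (x i)) (\<lambda>x. \<Prod>i\<in>I. b i (x i)) \<le>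
    C ^ card I * (\<Sum>i\<in>I. L1_dist (M i) (a i) (b i))"
  using I m nn le
proof (induct I)
  case empty then show ?case by (simp add: L1_dist_def)
next
  case (insert i I)
  interpret product_sigma_finite M by fact
  interpret I: finite_product_sigma_finite M I by standard fact
  note [measurable] = insert.prems(1,2)
  let ?P = "PiM I M" and ?A = "\<lambda>x. \<Prod>j\<in>I. a j (x j)" and ?B = "\<lambda>x. \<Prod>j\<in>I. b j (x j)"
  have [measurable]: "?A \<in> borel_measurable ?P" "?B \<in> borel_measurable ?P"
    by (auto intro!: borel_measurable_prod measurable_compose[OF measurable_component_singleton] insert.prems)
  have ai[measurable]: "a i \<in> borel_measurable (M i)" "b i \<in> borel_measurable (M i)" using insert by auto
  let ?D = "L1_dist (M i) (a i) (b i)" and ?S = "\<Sum>j\<in>I. L1_dist (M j) (a j) (b j)"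
  have IH: "L1_dist ?P ?A ?B \<le> C ^ card I * ?S" using insert by auto
  have B: "(\<integral>\<^sup>+x. ennreal (?B x) \<partial>?P) \<le> C ^ card I"
  proof -
    have "(\<integral>\<^sup>+x. ennreal (?B x) \<partial>?P) = (\<integral>\<^sup>+x. (\<Prod>j\<in>I. ennreal (b j (x j))) \<partial>?P)"
      using insert by (intro nn_integral_cong) (auto simp: space_PiM PiE_iff intro!: prod_ennreal[symmetric])
    also have "\<dots> = (\<Prod>j\<in>I. \<integral>\<^sup>+x. ennreal (b j x) \<partial>M j)"
      using insert by (subst product_nn_integral_prod) auto
    also have "\<dots> \<le> (\<Prod>j\<in>I. C)" using insert by (intro prod_mono_ennreal) auto
    finally show ?thesis by simp
  qed
  have "L1_dist (PiM (insert i I) M) (\<lambda>x. \<Prod>j\<in>insert i I. a j (x j)) (\<lambda>x. \<Prod>j\<in>insert i I. b j (x j)) =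
     (\<integral>\<^sup>+x. (\<integral>\<^sup>+y. ennreal \<bar>(\<Prod>j\<in>insert i I. a j ((x(i := y)) j)) - (\<Prod>j\<in>insert i I. b j ((x(i := y)) j))\<bar> \<partial>M i) \<partial>?P)"
    unfolding L1_dist_def using insert by (subst product_nn_integral_insert) auto
  also have "\<dots> = (\<integral>\<^sup>+x. (\<integral>\<^sup>+y. ennreal \<bar>a i y * ?A x - b i y * ?B x\<bar> \<partial>M i) \<partial>?P)"
  proof -
    have "(\<Prod>j\<in>I. c j ((x(i := y)) j)) = (\<Prod>j\<in>I. c j (x j))" for c :: "'i \<Rightarrow> 'a \<Rightarrow> real" and x y
      using insert(2) by (intro prod.cong) auto
    then show ?thesis using insert(1,2) by simp
  qed
  also have "\<dots> \<le> (\<integral>\<^sup>+x. (\<integral>\<^sup>+y. ennreal (a i y) * ennreal \<bar>?A x - ?B x\<bar> + ennreal \<bar>a i y - b i y\<bar> * ennreal (?B x) \<partial>M i) \<partial>?P)"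
  proof (intro nn_integral_mono)
    fix x y assume x: "x \<in> space ?P" and y: "y \<in> space (M i)"
    have 0: "0 \<le> a i y" "0 \<le> ?B x"
      using insert.prems(3,4) x y by (auto simp: space_PiM PiE_iff intro!: prod_nonneg)
    have "a i y * ?A x - b i y * ?B x = a i y * (?A x - ?B x) + (a i y - b i y) * ?B x"
      by (simp add: algebra_simps)
    then have "\<bar>a i y * ?A x - b i y * ?B x\<bar> \<le> \<bar>a i y * (?A x - ?B x)\<bar> + \<bar>(a i y - b i y) * ?B x\<bar>"
      by (metis abs_triangle_ineq)
    then have "\<bar>a i y * ?A x - b i y * ?B x\<bar> \<le> a i y * \<bar>?A x - ?B x\<bar> + \<bar>a i y - b i y\<bar> * ?B x"
      using 0 by (simp add: abs_mult)
    then show "ennreal \<bar>a i y * ?A x - b i y * ?B x\<bar> \<le>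
        ennreal (a i y) * ennreal \<bar>?A x - ?B x\<bar> + ennreal \<bar>a i y - b i y\<bar> * ennreal (?B x)"
      using 0 by (simp flip: ennreal_mult ennreal_plus)
  qed
  also have "\<dots> = (\<integral>\<^sup>+y. a i y \<partial>M i) * L1_dist ?P ?A ?B + ?D * (\<integral>\<^sup>+x. ennreal (?B x) \<partial>?P)"
    unfolding L1_dist_def
    by (simp add: nn_integral_add nn_integral_multc nn_integral_cmult)
  also have "\<dots> \<le> C * (C ^ card I * ?S) + ?D * C ^ card I"
    using insert.prems(5) IH B by (intro add_mono mult_mono) auto
  also have "\<dots> \<le> C * (C ^ card I * ?S) + ?D * (C * C ^ card I)"
    using mult_right_mono[OF C, of "C ^ card I"] by (intro add_mono mult_mono) auto
  also have "\<dots> = C ^ card (insert i I) * (\<Sum>j\<in>insert i I. L1_dist (M j) (a j) (b j))"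
    using insert by (simp add: algebra_simps)
  finally show ?case .
qed

text \<open>
Rectangles with sides of finite measure generate the product. Their indicators are products of
one-dimensional indicators, so that the telescoping bound reduces the claim to the factors.
\<close>

proposition L1_near_identity_PiM:
  fixes M :: "'i \<Rightarrow> 'a measure"
  assumes "product_sigma_finite M" and I: "finite I"
    and T: "\<And>i. i \<in> I \<Longrightarrow> L1_near_identity (M i) (T i)"
  shows "L1_near_identity (PiM I M) (\<lambda>n x. \<lambda>i\<in>I. T i n (x i))"
proof -
  interpret product_sigma_finite M by fact
  interpret I: finite_product_sigma_finite M I by standard fact
  obtain F where F: "\<And>i. i \<in> I \<Longrightarrow> range (F i) \<subseteq> sets (M i)"
     "\<And>k i. i \<in> I \<Longrightarrow> emeasure (M i) (F i k) \<noteq> \<infinity>" "incseq (\<lambda>k. \<Pi>\<^sub>E i\<in>I. F i k)"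
     "(\<Union>k. \<Pi>\<^sub>E i\<in>I. F i k) = space (PiM I M)"
    using I.sigma_finite_pairs by metis
  have resc: "rescales (M i) (T i n) 1" if "i \<in> I" for i n
    using T[OF that] by (simp add: L1_near_identity_def)
  show ?thesis
  proof (rule L1_near_identityI[where E = "prod_algebra I M" and F = "\<lambda>k. \<Pi>\<^sub>E i\<in>I. F i k"])
    show "rescales (PiM I M) (\<lambda>x. \<lambda>i\<in>I. T i n (x i)) 1" for n
      using rescales_PiM[OF assms(1,2), of "\<lambda>i. T i n" "\<lambda>_. 1"] resc by simp
    show "Int_stable (prod_algebra I M)"
      by (rule Int_stable_prod_algebra)
    show "prod_algebra I M \<subseteq> Pow (space (PiM I M))"
      using prod_algebra_sets_into_space by (simp add: space_PiM)
    show "sets (PiM I M) = sigma_sets (space (PiM I M)) (prod_algebra I M)"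
      by (simp add: sets_PiM space_PiM)
    show "(\<Pi>\<^sub>E i\<in>I. F i k) \<in> prod_algebra I M" for k
      unfolding prod_algebra_eq_finite[OF I] using F(1) by blast
    show "emeasure (PiM I M) (\<Pi>\<^sub>E i\<in>I. F i k) < \<infinity>" for k
      using F(1,2) by (intro emeasure_PiM_less_top[OF assms(1) I]) (auto simp: less_top[symmetric])
    fix A k assume "A \<in> prod_algebra I M"
    then obtain X where X: "A = (\<Pi>\<^sub>E i\<in>I. X i)" "\<And>i. i \<in> I \<Longrightarrow> X i \<in> sets (M i)"
      by (auto simp: prod_algebra_eq_finite[OF I])
    define Y where "Y i = X i \<inter> F i k" for i
    have AY: "A \<inter> (\<Pi>\<^sub>E i\<in>I. F i k) = (\<Pi>\<^sub>E i\<in>I. Y i)" by (simp add: X(1) Y_def PiE_Int)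
    have Y[measurable]: "Y i \<in> sets (M i)" if "i \<in> I" for i
      using X(2)[OF that] F(1)[OF that] by (auto simp: Y_def)
    have Yfin: "emeasure (M i) (Y i) < \<infinity>" if "i \<in> I" for i
    proof -
      have "emeasure (M i) (Y i) \<le> emeasure (M i) (F i k)"
        using F(1)[OF that] by (intro emeasure_mono) (auto simp: Y_def)
      then show ?thesis using F(2)[OF that, of k] by (auto simp: less_top[symmetric] top_unique)
    qed
    \<comment> \<open>The telescoping bound requires a common bound for the sides that is at least 1.\<close>
    define C where "C = 1 + (\<Sum>i\<in>I. emeasure (M i) (Y i))"
    have C: "1 \<le> C" "C < \<infinity>" using Yfin I by (auto simp: C_def)
    have YC: "emeasure (M i) (Y i) \<le> C" if "i \<in> I" for i
      unfolding C_def using member_le_sum[OF that, of "\<lambda>i. emeasure (M i) (Y i)"] I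
      by (auto intro: add_increasing)
    have ind: "indicator (\<Pi>\<^sub>E i\<in>I. Y i) x = (\<Prod>i\<in>I. indicator (Y i) (x i) :: real)"
      if "x \<in> space (PiM I M)" for x
      using that I by (auto simp: space_PiM PiE_iff indicator_def intro!: prod_zero)
    have T_sp: "T i n x \<in> space (M i)" if "i \<in> I" "x \<in> space (M i)" for i n x
      using resc[OF that(1), of n] that(2) by (auto simp: rescales_def dest: measurable_space)
    show "(\<lambda>n. L1_dist (PiM I M) (\<lambda>x. indicator (A \<inter> (\<Pi>\<^sub>E i\<in>I. F i k)) (\<lambda>i\<in>I. T i n (x i)))
        (indicator (A \<inter> (\<Pi>\<^sub>E i\<in>I. F i k)))) \<longlonglongrightarrow> 0"
      unfolding AY
    proof (rule tendsto_0_dominated_ennreal)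
      show "L1_dist (PiM I M) (\<lambda>x. indicator (\<Pi>\<^sub>E i\<in>I. Y i) (\<lambda>i\<in>I. T i n (x i)))
          (indicator (\<Pi>\<^sub>E i\<in>I. Y i)) \<le>
          C ^ card I * (\<Sum>i\<in>I. L1_dist (M i) (\<lambda>x. indicator (Y i) (T i n x)) (indicator (Y i)))" for n
      proof -
        have Tm[measurable]: "T i n \<in> measurable (M i) (M i)" if "i \<in> I" for i
          using resc[OF that] by (simp add: rescales_def)
        have "L1_dist (PiM I M) (\<lambda>x. indicator (\<Pi>\<^sub>E i\<in>I. Y i) (\<lambda>i\<in>I. T i n (x i))) (indicator (\<Pi>\<^sub>E i\<in>I. Y i)) =
          L1_dist (PiM I M) (\<lambda>x. \<Prod>i\<in>I. indicator (Y i) (T i n (x i))) (\<lambda>x. \<Prod>i\<in>I. indicator (Y i) (x i))"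
          unfolding L1_dist_def
        proof (intro nn_integral_cong)
          fix x assume x: "x \<in> space (PiM I M)"
          then have "(\<lambda>i\<in>I. T i n (x i)) \<in> space (PiM I M)" using T_sp by (auto simp: space_PiM)
          from ind[OF this] ind[OF x]
          show "ennreal \<bar>indicator (\<Pi>\<^sub>E i\<in>I. Y i) (\<lambda>i\<in>I. T i n (x i)) - indicator (\<Pi>\<^sub>E i\<in>I. Y i) x\<bar> =
            ennreal \<bar>(\<Prod>i\<in>I. indicator (Y i) (T i n (x i))) - (\<Prod>i\<in>I. indicator (Y i) (x i))\<bar>"
            by simp
        qed
        also have "\<dots> \<le> C ^ card I * (\<Sum>i\<in>I. L1_dist (M i) (\<lambda>x. indicator (Y i) (T i n x)) (indicator (Y i)))"
        proof (rule L1_dist_prod_le[OF assms(1) I C(1)])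
          fix i assume i: "i \<in> I"
          show "(\<integral>\<^sup>+x. ennreal (indicator (Y i) x) \<partial>M i) \<le> C"
            using YC[OF i] Y[OF i] by (simp add: ennreal_indicator)
          then show "(\<integral>\<^sup>+x. ennreal (indicator (Y i) (T i n x)) \<partial>M i) \<le> C"
            using rescales_nn_integral[OF resc[OF i], of "\<lambda>x. ennreal (indicator (Y i) x)" n] Y[OF i] by simp
        qed (use Y Tm in auto)
        finally show "L1_dist (PiM I M) (\<lambda>x. indicator (\<Pi>\<^sub>E i\<in>I. Y i) (\<lambda>i\<in>I. T i n (x i)))
          (indicator (\<Pi>\<^sub>E i\<in>I. Y i)) \<le>
          C ^ card I * (\<Sum>i\<in>I. L1_dist (M i) (\<lambda>x. indicator (Y i) (T i n x)) (indicator (Y i)))" .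
      qed
      have "(\<lambda>n. \<Sum>i\<in>I. L1_dist (M i) (\<lambda>x. indicator (Y i) (T i n x)) (indicator (Y i))) \<longlonglongrightarrow> (\<Sum>i\<in>I. 0)"
        using T Y Yfin by (intro tendsto_sum) (auto simp: L1_near_identity_def)
      then show "(\<lambda>n. C ^ card I * (\<Sum>i\<in>I. L1_dist (M i) (\<lambda>x. indicator (Y i) (T i n x)) (indicator (Y i)))) \<longlonglongrightarrow> 0"
        using C(2) by (auto intro!: tendsto_eq_intros ennreal_tendsto_cmult[where x = 0, simplified] simp: power_less_top_ennreal)
    qed
  qed (use F in auto)
qed

section \<open>Mean consistency of kernel density estimators\<close>

text \<open>
The pointwise inequality \<open>2 \<epsilon> \<bar>u\<bar> \<le> \<epsilon>\<^sup>2 + u\<^sup>2\<close> replaces the Cauchy-Schwarz inequality: it needs no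
square roots of integrals and remains meaningful when the second moment is infinite.
\<close>

lemma (in prob_space) expectation_abs_le:
  assumes [measurable]: "U \<in> borel_measurable M" and e: "0 < e"
  shows "(\<integral>\<^sup>+\<omega>. ennreal \<bar>U \<omega>\<bar> \<partial>M) \<le> ennreal (e / 2) + ennreal (1 / (2 * e)) * (\<integral>\<^sup>+\<omega>. ennreal ((U \<omega>)\<^sup>2) \<partial>M)"
proof -
  have "\<bar>u\<bar> \<le> e / 2 + 1 / (2 * e) * u\<^sup>2" for u :: real
  proof -
    have "0 \<le> (\<bar>u\<bar> - e)\<^sup>2" by simp
    then have "2 * e * \<bar>u\<bar> \<le> e * e + u\<^sup>2" by (simp add: power2_eq_square algebra_simps)
    then show ?thesis using e by (simp add: field_simps)
  qed
  then have "ennreal \<bar>U \<omega>\<bar> \<le> ennreal (e / 2) + ennreal (1 / (2 * e)) * ennreal ((U \<omega>)\<^sup>2)" for \<omega>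
    using e by (simp flip: ennreal_mult ennreal_plus)
  then have "(\<integral>\<^sup>+\<omega>. ennreal \<bar>U \<omega>\<bar> \<partial>M) \<le> (\<integral>\<^sup>+\<omega>. ennreal (e / 2) + ennreal (1 / (2 * e)) * ennreal ((U \<omega>)\<^sup>2) \<partial>M)"
    by (intro nn_integral_mono)
  also have "\<dots> = ennreal (e / 2) + ennreal (1 / (2 * e)) * (\<integral>\<^sup>+\<omega>. ennreal ((U \<omega>)\<^sup>2) \<partial>M)"
    by (simp add: nn_integral_add nn_integral_cmult emeasure_space_1)
  finally show ?thesis .
qed

text \<open>
The covariances of distinct summands vanish, hence only the \<open>n\<close> variances remain, and each is at
most the second moment \<open>q\<close>.
\<close>

lemma (in prob_space) mean_deviation_square:
  fixes W :: "nat \<Rightarrow> 'a \<Rightarrow> real"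
  assumes ind: "indep_vars (\<lambda>_. borel) W {1..n}"
    and sq: "\<And>i. i \<in> {1..n} \<Longrightarrow> integrable M (\<lambda>\<omega>. (W i \<omega>)\<^sup>2)"
    and m: "\<And>i. i \<in> {1..n} \<Longrightarrow> expectation (W i) = m"
    and q: "\<And>i. i \<in> {1..n} \<Longrightarrow> expectation (\<lambda>\<omega>. (W i \<omega>)\<^sup>2) = q"
    and n: "1 \<le> n"
  shows "(\<integral>\<^sup>+\<omega>. ennreal (((\<Sum>i=1..n. W i \<omega>) / n - m)\<^sup>2) \<partial>M) \<le> ennreal (q / n)"
proof -
  have W[measurable]: "W i \<in> borel_measurable M" if "i \<in> {1..n}" for i
    using ind that by (auto simp: indep_vars_def)
  have int: "integrable M (W i)" if "i \<in> {1..n}" for i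
    using square_integrable_imp_integrable[OF W sq] that by auto
  let ?c = "\<lambda>i \<omega>. W i \<omega> - m"
  have prod: "integrable M (\<lambda>\<omega>. ?c i \<omega> * ?c j \<omega>) \<and>
      expectation (\<lambda>\<omega>. ?c i \<omega> * ?c j \<omega>) = (if i = j then q - m\<^sup>2 else 0)"
    if i: "i \<in> {1..n}" and j: "j \<in> {1..n}" for i j
  proof (cases "i = j")
    case True
    have "?c i \<omega> * ?c j \<omega> = (W i \<omega>)\<^sup>2 - 2 * m * W i \<omega> + m\<^sup>2" for \<omega>
      using True by (simp add: power2_eq_square algebra_simps)
    moreover have "integrable M (\<lambda>\<omega>. (W i \<omega>)\<^sup>2 - 2 * m * W i \<omega> + m\<^sup>2)" using sq int i by auto
    moreover have "expectation (\<lambda>\<omega>. (W i \<omega>)\<^sup>2 - 2 * m * W i \<omega> + m\<^sup>2) = q - m\<^sup>2"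
      using sq[OF i] int[OF i] q[OF i] m[OF i] by (simp add: prob_space) (simp add: power2_eq_square)
    ultimately show ?thesis using True by simp
  next
    case False
    have "indep_vars (\<lambda>_. borel) W {i, j}" using i j by (intro indep_vars_subset[OF ind]) auto
    then have iv: "indep_vars (\<lambda>_. borel) ?c {i, j}" by (rule indep_vars_compose2) auto
    have ic: "\<And>l. l \<in> {i, j} \<Longrightarrow> integrable M (?c l)" using int i j by auto
    have "expectation (?c i) = 0" using int[OF i] m[OF i] by (simp add: prob_space)
    with indep_vars_lebesgue_integral[OF _ iv ic] indep_vars_integrable[OF _ iv ic] False
    show ?thesis by simp
  qed
  have sum: "((\<Sum>i=1..n. W i \<omega>) / n - m)\<^sup>2 = (\<Sum>i=1..n. \<Sum>j=1..n. ?c i \<omega> * ?c j \<omega>) / (real n)\<^sup>2" for \<omega>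
  proof -
    have "(\<Sum>i=1..n. W i \<omega>) / n - m = (\<Sum>i=1..n. ?c i \<omega>) / n"
      using n by (simp add: sum_subtractf field_simps)
    then show ?thesis by (simp add: power_divide power2_eq_square sum_product)
  qed
  have int2: "integrable M (\<lambda>\<omega>. ((\<Sum>i=1..n. W i \<omega>) / n - m)\<^sup>2)"
    unfolding sum using prod by (intro integrable_divide Bochner_Integration.integrable_sum) blast
  have "expectation (\<lambda>\<omega>. ((\<Sum>i=1..n. W i \<omega>) / n - m)\<^sup>2) =
      (\<Sum>i=1..n. \<Sum>j=1..n. expectation (\<lambda>\<omega>. ?c i \<omega> * ?c j \<omega>)) / (real n)\<^sup>2"
    unfolding sum integral_divide_zero using prod
    by (subst Bochner_Integration.integral_sum) (auto intro!: arg_cong2[where f = "(/)"] sum.cong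
        Bochner_Integration.integral_sum Bochner_Integration.integrable_sum)
  also have "\<dots> = (\<Sum>i=1..n. \<Sum>j=1..n. if i = j then q - m\<^sup>2 else 0) / (real n)\<^sup>2"
    using prod by (intro arg_cong2[where f = "(/)"] sum.cong refl) auto
  also have "\<dots> = real n * (q - m\<^sup>2) / (real n)\<^sup>2"
    by (simp add: sum.delta)
  also have "\<dots> \<le> q / n" using n by (simp add: power2_eq_square divide_simps)
  finally have "expectation (\<lambda>\<omega>. ((\<Sum>i=1..n. W i \<omega>) / n - m)\<^sup>2) \<le> q / n" .
  then show ?thesis using int2 by (simp add: nn_integral_eq_integral ennreal_leI)
qed

text \<open>
The structure of Euclidean space that kernel estimation uses: \<open>sd b x y\<close> stands for \<open>(x - y) / b\<close>
and \<open>mv b x u\<close> for \<open>x - b u\<close>, so that \<open>y = mv b x u\<close> inverts \<open>u = sd b x y\<close>; \<open>s\<close> is the dimension.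
It has two instances, a single block and the product of all blocks.
\<close>

locale kernel_space = sigma_finite_measure N for N :: "'a measure" +
  fixes s :: nat and sd mv :: "real \<Rightarrow> 'a \<Rightarrow> 'a \<Rightarrow> 'a"
  assumes sd_measurable: "(\<lambda>(x, y). sd b x y) \<in> measurable (N \<Otimes>\<^sub>M N) N"
    and mv_measurable: "(\<lambda>(x, u). mv b x u) \<in> measurable (N \<Otimes>\<^sub>M N) N"
    and sd_left: "0 < b \<Longrightarrow> y \<in> space N \<Longrightarrow> rescales N (\<lambda>x. sd b x y) (b ^ s)"
    and sd_right: "0 < b \<Longrightarrow> x \<in> space N \<Longrightarrow> rescales N (\<lambda>y. sd b x y) (b ^ s)"
    and mv_sd: "0 < b \<Longrightarrow> x \<in> space N \<Longrightarrow> y \<in> space N \<Longrightarrow> mv b x (sd b x y) = y"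
    and mv_near: "u \<in> space N \<Longrightarrow> h \<longlonglongrightarrow> 0 \<Longrightarrow> L1_near_identity N (\<lambda>n x. mv (h n) x u)"
begin

lemma sd_measurable'[measurable (raw)]:
  "f \<in> measurable M N \<Longrightarrow> g \<in> measurable M N \<Longrightarrow> (\<lambda>x. sd b (f x) (g x)) \<in> measurable M N"
  using measurable_compose[OF measurable_Pair sd_measurable] by simp

lemma mv_measurable'[measurable (raw)]:
  "f \<in> measurable M N \<Longrightarrow> g \<in> measurable M N \<Longrightarrow> (\<lambda>x. mv b (f x) (g x)) \<in> measurable M N"
  using measurable_compose[OF measurable_Pair mv_measurable] by simp

definition kde :: "('a \<Rightarrow> real) \<Rightarrow> real \<Rightarrow> nat \<Rightarrow> (nat \<Rightarrow> 'a) \<Rightarrow> 'a \<Rightarrow> real" where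
  "kde k b n Y x = (\<Sum>i=1..n. k (sd b x (Y i))) / (real n * b ^ s)"

text \<open>
The convolution of \<open>f\<close> with the kernel of bandwidth \<open>b\<close>, which is the expectation of the estimator
when the observations have density \<open>f\<close>.
\<close>

definition smoothed :: "('a \<Rightarrow> real) \<Rightarrow> ('a \<Rightarrow> real) \<Rightarrow> real \<Rightarrow> 'a \<Rightarrow> real" where
  "smoothed k f b x = (LINT y|N. k (sd b x y) * f y) / b ^ s"

lemma kde_nn_integral:
  assumes k: "integrable N k" "\<And>u. u \<in> space N \<Longrightarrow> 0 \<le> k u" "(LINT u|N. k u) = 1"
    and b: "0 < b" and n: "1 \<le> n" and Y: "\<And>i. i \<in> {1..n} \<Longrightarrow> Y i \<in> space N"
  shows "(\<integral>\<^sup>+x. ennreal (kde k b n Y x) \<partial>N) = 1"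
proof -
  have km[measurable]: "k \<in> borel_measurable N" using k(1) by auto
  have Ym: "(\<lambda>x. sd b x (Y i)) \<in> measurable N N" if "i \<in> {1..n}" for i
    using Y[OF that] by measurable
  have sp: "sd b x (Y i) \<in> space N" if "i \<in> {1..n}" "x \<in> space N" for i x
    using measurable_space[OF Ym] that by blast
  have "(\<integral>\<^sup>+x. ennreal (kde k b n Y x) \<partial>N) = (\<integral>\<^sup>+x. (\<Sum>i=1..n. ennreal (k (sd b x (Y i)))) * ennreal (1 / (real n * b ^ s)) \<partial>N)"
  proof (intro nn_integral_cong)
    fix x assume "x \<in> space N"
    then have 0: "0 \<le> k (sd b x (Y i))" if "i \<in> {1..n}" for i using k(2) sp that by blast
    have "(\<Sum>i=1..n. ennreal (k (sd b x (Y i)))) = ennreal (\<Sum>i=1..n. k (sd b x (Y i)))"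
      using 0 by (intro sum_ennreal) auto
    moreover have "0 \<le> (\<Sum>i=1..n. k (sd b x (Y i)))" using 0 by (intro sum_nonneg) auto
    ultimately show "ennreal (kde k b n Y x) = (\<Sum>i=1..n. ennreal (k (sd b x (Y i)))) * ennreal (1 / (real n * b ^ s))"
      using b n by (simp add: kde_def flip: ennreal_mult)
  qed
  also have "\<dots> = (\<Sum>i=1..n. \<integral>\<^sup>+x. ennreal (k (sd b x (Y i))) \<partial>N) * ennreal (1 / (real n * b ^ s))"
  proof -
    have 1: "(\<lambda>x. ennreal (k (sd b x (Y i)))) \<in> borel_measurable N" if "i \<in> {1..n}" for i
      using Ym[OF that] by measurable
    then show ?thesis
      by (subst nn_integral_multc) (simp_all only: nn_integral_sum borel_measurable_sum)
  qed
  also have "(\<Sum>i=1..n. \<integral>\<^sup>+x. ennreal (k (sd b x (Y i))) \<partial>N) = (\<Sum>i=1..n. ennreal (b ^ s))"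
  proof (rule sum.cong[OF refl])
    fix i assume "i \<in> {1..n}"
    then have "(\<integral>\<^sup>+x. ennreal (k (sd b x (Y i))) \<partial>N) = ennreal (b ^ s) * (\<integral>\<^sup>+u. ennreal (k u) \<partial>N)"
      using rescales_nn_integral[OF sd_left[OF b Y], of i "\<lambda>u. ennreal (k u)"] by simp
    also have "(\<integral>\<^sup>+u. ennreal (k u) \<partial>N) = 1"
      using k by (subst nn_integral_eq_integral) auto
    finally show "(\<integral>\<^sup>+x. ennreal (k (sd b x (Y i))) \<partial>N) = ennreal (b ^ s)" by simp
  qed
  also have "(\<Sum>i=1..n. ennreal (b ^ s)) * ennreal (1 / (real n * b ^ s)) = 1"
    using b n by (simp add: ennreal_of_nat_eq_real_of_nat flip: ennreal_mult)
  finally show ?thesis .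
qed

text \<open>
Since the kernel integrates to 1, the bias at \<open>x\<close> is the kernel average of \<open>f y - f x\<close>. The
substitution \<open>y = x - b u\<close> and Fubini's theorem give the bound. The pointwise estimate holds at
every \<open>x\<close>: where the integral defining the convolution diverges, the right-hand side is infinite.
\<close>

lemma bias_le:
  assumes k: "integrable N k" "\<And>u. u \<in> space N \<Longrightarrow> 0 \<le> k u" "(LINT u|N. k u) = 1"
    and [measurable]: "f \<in> borel_measurable N" and b: "0 < b"
  shows "L1_dist N (smoothed k f b) f \<le> (\<integral>\<^sup>+u. ennreal (k u) * L1_dist N (\<lambda>x. f (mv b x u)) f \<partial>N)"
proof -
  have km[measurable]: "k \<in> borel_measurable N" using k(1) by auto
  have *: "ennreal \<bar>smoothed k f b x - f x\<bar> \<le> (\<integral>\<^sup>+u. ennreal (k u) * ennreal \<bar>f (mv b x u) - f x\<bar> \<partial>N)"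
    if x[measurable]: "x \<in> space N" for x
  proof -
    have sdx[measurable]: "(\<lambda>y. sd b x y) \<in> measurable N N" by measurable
    have sp: "sd b x y \<in> space N" if "y \<in> space N" for y using measurable_space[OF sdx that] .
    let ?H = "\<integral>\<^sup>+y. ennreal \<bar>k (sd b x y) * (f y - f x)\<bar> \<partial>N"
    have H: "?H = ennreal (b ^ s) * (\<integral>\<^sup>+u. ennreal (k u) * ennreal \<bar>f (mv b x u) - f x\<bar> \<partial>N)"
    proof -
      have "?H = (\<integral>\<^sup>+y. ennreal (k (sd b x y)) * ennreal \<bar>f (mv b x (sd b x y)) - f x\<bar> \<partial>N)"
        using b x k(2) sp by (intro nn_integral_cong) (simp add: mv_sd abs_mult flip: ennreal_mult)
      also have "\<dots> = ennreal (b ^ s) * (\<integral>\<^sup>+u. ennreal (k u) * ennreal \<bar>f (mv b x u) - f x\<bar> \<partial>N)"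
        by (rule rescales_nn_integral[OF sd_right[OF b x],
              of "\<lambda>u. ennreal (k u) * ennreal \<bar>f (mv b x u) - f x\<bar>"]) measurable
      finally show ?thesis .
    qed
    show ?thesis
    proof (cases "?H < \<infinity>")
      case False
      then have "(\<integral>\<^sup>+u. ennreal (k u) * ennreal \<bar>f (mv b x u) - f x\<bar> \<partial>N) = \<infinity>"
        unfolding H by (auto simp: less_top[symmetric] ennreal_mult_eq_top_iff)
      then show ?thesis by simp
    next
      case True
      then have i1: "integrable N (\<lambda>y. k (sd b x y) * (f y - f x))"
        by (auto simp: integrable_iff_bounded)
      note i2 = rescales_integral[OF sd_right[OF b x] _ k(1)]
      have bs: "0 < b ^ s" using b by simp
      have i3: "(LINT y|N. k (sd b x y)) = b ^ s" "integrable N (\<lambda>y. k (sd b x y))"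
        using i2 bs k(3) by auto
      have "k (sd b x y) * f y = k (sd b x y) * (f y - f x) + f x * k (sd b x y)" for y
        by (simp add: algebra_simps)
      then have "(LINT y|N. k (sd b x y) * f y) = (LINT y|N. k (sd b x y) * (f y - f x)) + f x * b ^ s"
        using i1 i3 by simp
      then have "smoothed k f b x - f x = (LINT y|N. k (sd b x y) * (f y - f x)) / b ^ s"
        using bs b by (simp add: smoothed_def add_divide_distrib)
      then have "\<bar>smoothed k f b x - f x\<bar> \<le> (LINT y|N. \<bar>k (sd b x y) * (f y - f x)\<bar>) / b ^ s"
        using bs integral_abs_bound[of N "\<lambda>y. k (sd b x y) * (f y - f x)"] by (simp add: abs_divide divide_right_mono)
      then have "ennreal \<bar>smoothed k f b x - f x\<bar> \<le> ennreal ((LINT y|N. \<bar>k (sd b x y) * (f y - f x)\<bar>) / b ^ s)"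
        by (rule ennreal_leI)
      also have "\<dots> = ennreal (1 / b ^ s) * ennreal (LINT y|N. \<bar>k (sd b x y) * (f y - f x)\<bar>)"
        using bs by (simp flip: ennreal_mult)
      also have "ennreal (LINT y|N. \<bar>k (sd b x y) * (f y - f x)\<bar>) = ?H"
        using i1 by (subst nn_integral_eq_integral) auto
      also have "ennreal (1 / b ^ s) * ?H = (\<integral>\<^sup>+u. ennreal (k u) * ennreal \<bar>f (mv b x u) - f x\<bar> \<partial>N)"
        unfolding H using bs b by (simp add: mult.assoc[symmetric] flip: ennreal_mult)
      finally show ?thesis .
    qed
  qed
  interpret NN: pair_sigma_finite N N ..
  have "L1_dist N (smoothed k f b) f \<le> (\<integral>\<^sup>+x. (\<integral>\<^sup>+u. ennreal (k u) * ennreal \<bar>f (mv b x u) - f x\<bar> \<partial>N) \<partial>N)"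
    unfolding L1_dist_def by (intro nn_integral_mono *)
  also have "\<dots> = (\<integral>\<^sup>+u. (\<integral>\<^sup>+x. ennreal (k u) * ennreal \<bar>f (mv b x u) - f x\<bar> \<partial>N) \<partial>N)"
    by (rule NN.Fubini'[symmetric]) measurable
  also have "\<dots> = (\<integral>\<^sup>+u. ennreal (k u) * L1_dist N (\<lambda>x. f (mv b x u)) f \<partial>N)"
    unfolding L1_dist_def by (intro nn_integral_cong nn_integral_cmult) measurable
  finally show ?thesis .
qed

text \<open>
For each fixed \<open>u\<close> the translates of \<open>f\<close> by \<open>h n u\<close> converge to \<open>f\<close> in \<open>L\<^sub>1\<close>, and their distance
from \<open>f\<close> never exceeds twice the norm of \<open>f\<close>; dominated convergence applies.
\<close>

lemma bias_tendsto:
  assumes k: "integrable N k" "\<And>u. u \<in> space N \<Longrightarrow> 0 \<le> k u" "(LINT u|N. k u) = 1"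
    and f: "integrable N f" and h: "h \<longlonglongrightarrow> 0" "\<And>n. n \<ge> 1 \<Longrightarrow> 0 < h n"
  shows "(\<lambda>n. L1_dist N (smoothed k f (h n)) f) \<longlonglongrightarrow> 0"
proof (rule tendsto_sandwich[OF _ _ tendsto_const])
  have [measurable]: "k \<in> borel_measurable N" "f \<in> borel_measurable N" using k(1) f by auto
  show "\<forall>\<^sub>F n in sequentially. L1_dist N (smoothed k f (h n)) f \<le>
      (\<integral>\<^sup>+u. ennreal (k u) * L1_dist N (\<lambda>x. f (mv (h n) x u)) f \<partial>N)"
    using eventually_ge_at_top[of 1] by eventually_elim (rule bias_le[OF k], use h in auto)
  have fin: "(\<integral>\<^sup>+x. ennreal \<bar>f x\<bar> \<partial>N) < \<infinity>" using f by (simp add: integrable_iff_bounded)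
  have k1: "(\<integral>\<^sup>+u. ennreal (k u) \<partial>N) = 1"
    using k by (subst nn_integral_eq_integral) auto
  have near: "L1_near_identity N (\<lambda>n x. mv (h n) x u)" if "u \<in> space N" for u
    using mv_near[OF that h(1)] .
  have [measurable]: "(\<lambda>u. L1_dist N (\<lambda>x. f (mv (h n) x u)) f) \<in> borel_measurable N" for n
    unfolding L1_dist_def by measurable
  have "(\<lambda>n. \<integral>\<^sup>+u. ennreal (k u) * L1_dist N (\<lambda>x. f (mv (h n) x u)) f \<partial>N) \<longlonglongrightarrow> (\<integral>\<^sup>+u. 0 \<partial>N)"
  proof (rule nn_integral_dominated_convergence)
    let ?w = "\<lambda>u. ennreal (k u) * (2 * (\<integral>\<^sup>+x. ennreal \<bar>f x\<bar> \<partial>N))"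
    have "(\<integral>\<^sup>+u. ?w u \<partial>N) = 2 * (\<integral>\<^sup>+x. ennreal \<bar>f x\<bar> \<partial>N)" by (simp add: nn_integral_multc k1)
    then show "(\<integral>\<^sup>+u. ?w u \<partial>N) < \<infinity>" using fin by (simp add: ennreal_mult_less_top)
    show "AE u in N. ennreal (k u) * L1_dist N (\<lambda>x. f (mv (h n) x u)) f \<le> ?w u" for n
    proof (intro AE_I2 mult_left_mono)
      fix u assume u[measurable]: "u \<in> space N"
      have r: "rescales N (\<lambda>x. mv (h n) x u) 1" using near[OF u] by (simp add: L1_near_identity_def)
      have "L1_dist N (\<lambda>x. f (mv (h n) x u)) f \<le>
          L1_dist N (\<lambda>x. f (mv (h n) x u)) (\<lambda>_. 0) + L1_dist N (\<lambda>_. 0) f"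
        by (rule L1_dist_triangle) measurable
      also have "L1_dist N (\<lambda>x. f (mv (h n) x u)) (\<lambda>_. 0) = (\<integral>\<^sup>+x. ennreal \<bar>f x\<bar> \<partial>N)"
        unfolding L1_dist_def using rescales_nn_integral[OF r, of "\<lambda>x. ennreal \<bar>f x\<bar>"] by simp
      also have "L1_dist N (\<lambda>_. 0) f = (\<integral>\<^sup>+x. ennreal \<bar>f x\<bar> \<partial>N)" by (simp add: L1_dist_def)
      finally show "L1_dist N (\<lambda>x. f (mv (h n) x u)) f \<le> 2 * (\<integral>\<^sup>+x. ennreal \<bar>f x\<bar> \<partial>N)"
        by (simp add: mult_2)
    qed auto
    show "AE u in N. (\<lambda>n. ennreal (k u) * L1_dist N (\<lambda>x. f (mv (h n) x u)) f) \<longlonglongrightarrow> 0"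
    proof (rule AE_I2)
      fix u assume u: "u \<in> space N"
      have "(\<lambda>n. L1_dist N (\<lambda>x. f (mv (h n) x u)) f) \<longlonglongrightarrow> 0"
        using near[OF u] f by (simp add: L1_near_identity_def)
      from ennreal_tendsto_cmult[OF _ this, of "ennreal (k u)"]
      show "(\<lambda>n. ennreal (k u) * L1_dist N (\<lambda>x. f (mv (h n) x u)) f) \<longlonglongrightarrow> 0" by simp
    qed
  qed measurable
  then show "(\<lambda>n. \<integral>\<^sup>+u. ennreal (k u) * L1_dist N (\<lambda>x. f (mv (h n) x u)) f \<partial>N) \<longlonglongrightarrow> 0" by simp
qed auto

lemma kde_measurable[measurable (raw)]:
  assumes [measurable]: "k \<in> borel_measurable N" "x \<in> measurable L N" "\<And>i. i \<in> {1..n} \<Longrightarrow> Y i \<in> measurable L N"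
  shows "(\<lambda>z. kde k b n (\<lambda>i. Y i z) (x z)) \<in> borel_measurable L"
  unfolding kde_def by measurable

lemma smoothed_measurable[measurable]:
  assumes [measurable]: "k \<in> borel_measurable N" "f \<in> borel_measurable N"
  shows "smoothed k f b \<in> borel_measurable N"
  unfolding smoothed_def by measurable

text \<open>
The estimator at \<open>x\<close> is a mean of independent terms with expectation \<open>smoothed k f b x\<close>. Where
their second moment is infinite the right-hand side is infinite.
\<close>

lemma kde_deviation_le:
  fixes M :: "'w measure" and Y :: "nat \<Rightarrow> 'w \<Rightarrow> 'a"
  assumes "prob_space M"
    and ind: "prob_space.indep_vars M (\<lambda>_. N) Y {1..n}"
    and dis: "\<And>i. i \<in> {1..n} \<Longrightarrow> distr M N (Y i) = density N (\<lambda>x. ennreal (f x))"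
    and f[measurable]: "f \<in> borel_measurable N" "\<And>x. x \<in> space N \<Longrightarrow> 0 \<le> f x"
    and k[measurable]: "k \<in> borel_measurable N"
    and b: "0 < b" and n: "1 \<le> n" and x[measurable]: "x \<in> space N" and e: "0 < e"
  shows "(\<integral>\<^sup>+\<omega>. ennreal \<bar>kde k b n (\<lambda>i. Y i \<omega>) x - smoothed k f b x\<bar> \<partial>M) \<le>
    ennreal (e / 2) + ennreal (1 / (2 * e * n * b ^ (2 * s))) * (\<integral>\<^sup>+y. ennreal ((k (sd b x y))\<^sup>2) * ennreal (f y) \<partial>N)"
proof -
  interpret prob_space M by fact
  have [measurable]: "Y i \<in> measurable M N" if "i \<in> {1..n}" for i
    using ind that by (auto simp: indep_vars_def)
  define Q where "Q = (\<integral>\<^sup>+y. ennreal ((k (sd b x y))\<^sup>2) * ennreal (f y) \<partial>N)"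
  show ?thesis
  proof (cases "Q < \<infinity>")
    case False
    then have "Q = \<top>" by (simp add: less_top[symmetric])
    moreover have "ennreal (1 / (2 * e * n * b ^ (2 * s))) \<noteq> 0" using e n b by (simp del: divide_eq_0_iff)
    ultimately show ?thesis unfolding Q_def[symmetric] by simp
  next
    case True
    then obtain q where q: "Q = ennreal q" "0 \<le> q" by (cases Q) auto
    define W where "W i \<omega> = k (sd b x (Y i \<omega>)) / b ^ s" for i \<omega>
    have bs: "0 < b ^ s" using b by simp
    have [measurable]: "W i \<in> borel_measurable M" if "i \<in> {1..n}" for i
      using that unfolding W_def by measurable
    have indW: "indep_vars (\<lambda>_. borel) W {1..n}"
      unfolding W_def by (rule indep_vars_compose2[OF ind]) measurable
    have nnsq: "(\<integral>\<^sup>+\<omega>. ennreal ((W i \<omega>)\<^sup>2) \<partial>M) = ennreal (q / (b ^ s)\<^sup>2)" if i: "i \<in> {1..n}" for i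
    proof -
      note [measurable] = i
      have "(\<integral>\<^sup>+\<omega>. ennreal ((W i \<omega>)\<^sup>2) \<partial>M) = (\<integral>\<^sup>+\<omega>. ennreal (1 / (b ^ s)\<^sup>2) * ennreal ((k (sd b x (Y i \<omega>)))\<^sup>2) \<partial>M)"
        by (simp add: W_def power_divide flip: ennreal_mult)
      also have "\<dots> = ennreal (1 / (b ^ s)\<^sup>2) * (\<integral>\<^sup>+\<omega>. ennreal ((k (sd b x (Y i \<omega>)))\<^sup>2) \<partial>M)"
        using i by (intro nn_integral_cmult) measurable
      also have "(\<integral>\<^sup>+\<omega>. ennreal ((k (sd b x (Y i \<omega>)))\<^sup>2) \<partial>M) = (\<integral>\<^sup>+y. ennreal ((k (sd b x y))\<^sup>2) \<partial>distr M N (Y i))"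
        using i by (intro nn_integral_distr[symmetric]) measurable
      also have "\<dots> = Q"
        unfolding dis[OF i] Q_def by (subst nn_integral_density) (auto simp: mult.commute)
      finally show ?thesis using q bs by (simp flip: ennreal_mult)
    qed
    have sq: "integrable M (\<lambda>\<omega>. (W i \<omega>)\<^sup>2)" if i: "i \<in> {1..n}" for i
      using i nnsq[OF i] by (intro integrableI_nonneg) auto
    have Eq: "expectation (\<lambda>\<omega>. (W i \<omega>)\<^sup>2) = q / (b ^ s)\<^sup>2" if i: "i \<in> {1..n}" for i
      using i nnsq[OF i] q by (intro integral_eq_nn_integral[THEN trans]) auto
    have Em: "expectation (W i) = smoothed k f b x" if i: "i \<in> {1..n}" for i
    proof -
      have "expectation (W i) = (LINT y|distr M N (Y i). k (sd b x y) / b ^ s)"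
        unfolding W_def using i by (intro integral_distr[symmetric]) measurable
      also have "\<dots> = (LINT y|N. f y * (k (sd b x y) / b ^ s))"
        unfolding dis[OF i] using f(2) by (subst integral_density) auto
      also have "\<dots> = (LINT y|N. (k (sd b x y) * f y) / b ^ s)" by (simp add: mult.commute)
      finally show ?thesis by (simp add: smoothed_def)
    qed
    have kde: "kde k b n (\<lambda>i. Y i \<omega>) x = (\<Sum>i=1..n. W i \<omega>) / n" for \<omega>
      by (simp add: kde_def W_def sum_divide_distrib[symmetric] field_simps)
    have "(\<integral>\<^sup>+\<omega>. ennreal \<bar>kde k b n (\<lambda>i. Y i \<omega>) x - smoothed k f b x\<bar> \<partial>M) \<le>
      ennreal (e / 2) + ennreal (1 / (2 * e)) * (\<integral>\<^sup>+\<omega>. ennreal (((\<Sum>i=1..n. W i \<omega>) / n - smoothed k f b x)\<^sup>2) \<partial>M)"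
      unfolding kde using e by (intro expectation_abs_le) measurable
    also have "\<dots> \<le> ennreal (e / 2) + ennreal (1 / (2 * e)) * ennreal (q / (b ^ s)\<^sup>2 / n)"
      by (intro add_left_mono mult_left_mono mean_deviation_square[OF indW sq Em Eq n]) auto
    also have "ennreal (1 / (2 * e)) * ennreal (q / (b ^ s)\<^sup>2 / n) = ennreal (1 / (2 * e * n * b ^ (2 * s))) * Q"
      using e q bs n b by (simp add: power_mult mult.commute[of 2] flip: ennreal_mult)
    finally show ?thesis by (simp add: Q_def)
  qed
qed

text \<open>
The error is split into the stochastic part and the bias. Integrating the second moment over \<open>x\<close>
first produces \<open>b^s\<close> times the squared norm of the kernel, whatever the density is, so that the
stochastic part is of order \<open>\<epsilon> + 1 / (\<epsilon> n b^s)\<close>; the choice \<open>\<epsilon> = 1 / sqrt (n b^s)\<close> balances the two.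
Only this part requires a set of finite measure.
\<close>

proposition kde_L1_consistent:
  fixes M :: "'w measure" and Y :: "nat \<Rightarrow> 'w \<Rightarrow> 'a"
  assumes "prob_space M"
    and ind: "prob_space.indep_vars M (\<lambda>_. N) Y {1..}"
    and dis: "\<And>i. i \<ge> 1 \<Longrightarrow> distr M N (Y i) = density N (\<lambda>x. ennreal (f x))"
    and f: "integrable N f" "\<And>x. x \<in> space N \<Longrightarrow> 0 \<le> f x" "(LINT x|N. f x) = 1"
    and k: "integrable N k" "\<And>u. u \<in> space N \<Longrightarrow> 0 \<le> k u" "(LINT u|N. k u) = 1"
    and k2: "integrable N (\<lambda>u. (k u)\<^sup>2)"
    and h: "h \<longlonglongrightarrow> 0" "\<And>n. n \<ge> 1 \<Longrightarrow> 0 < h n"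
    and nh: "filterlim (\<lambda>n. real n * h n ^ s) at_top sequentially"
    and A[measurable]: "A \<in> sets N" and Afin: "emeasure N A < \<infinity>"
  shows "(\<lambda>n. \<integral>\<^sup>+\<omega>. (\<integral>\<^sup>+x\<in>A. ennreal \<bar>kde k (h n) n (\<lambda>i. Y i \<omega>) x - f x\<bar> \<partial>N) \<partial>M) \<longlonglongrightarrow> 0"
proof -
  interpret prob_space M by fact
  have [measurable]: "k \<in> borel_measurable N" "f \<in> borel_measurable N" using k(1) f(1) by auto
  have Y[measurable]: "Y i \<in> measurable M N" if "i \<in> {1..n}" for i n
    using ind that by (auto simp: indep_vars_def)
  interpret MN: pair_sigma_finite M N ..
  define \<epsilon> where "\<epsilon> n = 1 / sqrt (real n * h n ^ s)" for n
  define \<mu> where "\<mu> = measure N A"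
  have \<mu>: "emeasure N A = ennreal \<mu>" using Afin by (simp add: \<mu>_def emeasure_eq_ennreal_measure less_top)
  define \<kappa> where "\<kappa> = (LINT u|N. (k u)\<^sup>2)"
  have \<kappa>: "0 \<le> \<kappa>" "(\<integral>\<^sup>+u. ennreal ((k u)\<^sup>2) \<partial>N) = ennreal \<kappa>"
    using k2 by (auto simp: \<kappa>_def nn_integral_eq_integral)
  have f1: "(\<integral>\<^sup>+x. ennreal (f x) \<partial>N) = 1" using f by (subst nn_integral_eq_integral) auto
  let ?m = "\<lambda>n. smoothed k f (h n)"
  have bound: "(\<integral>\<^sup>+\<omega>. (\<integral>\<^sup>+x\<in>A. ennreal \<bar>kde k (h n) n (\<lambda>i. Y i \<omega>) x - f x\<bar> \<partial>N) \<partial>M) \<le>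
      ennreal (\<epsilon> n * (\<mu> + \<kappa>) / 2) + L1_dist N (?m n) f" if n: "1 \<le> n" for n
  proof -
    have b: "0 < h n" and bs: "0 < h n ^ s" using h(2) n by auto
    have e: "0 < \<epsilon> n" using n bs by (simp add: \<epsilon>_def)
    have ind_n: "indep_vars (\<lambda>_. N) Y {1..n}" by (rule indep_vars_subset[OF ind]) auto
    note Y[of _ n, measurable]
    have [measurable]: "(\<lambda>(\<omega>, x). kde k (h n) n (\<lambda>i. Y i \<omega>) x) \<in> borel_measurable (M \<Otimes>\<^sub>M N)"
      unfolding kde_def by measurable
    have "(\<integral>\<^sup>+\<omega>. (\<integral>\<^sup>+x\<in>A. ennreal \<bar>kde k (h n) n (\<lambda>i. Y i \<omega>) x - f x\<bar> \<partial>N) \<partial>M) \<le>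
      (\<integral>\<^sup>+\<omega>. (\<integral>\<^sup>+x. ennreal \<bar>kde k (h n) n (\<lambda>i. Y i \<omega>) x - ?m n x\<bar> * indicator A x + ennreal \<bar>?m n x - f x\<bar> \<partial>N) \<partial>M)"
      by (intro nn_integral_mono) (auto split: split_indicator simp flip: ennreal_plus)
    also have "\<dots> = (\<integral>\<^sup>+\<omega>. (\<integral>\<^sup>+x. ennreal \<bar>kde k (h n) n (\<lambda>i. Y i \<omega>) x - ?m n x\<bar> * indicator A x \<partial>N) \<partial>M) + L1_dist N (?m n) f"
    proof -
      have "(\<integral>\<^sup>+x. ennreal \<bar>kde k (h n) n (\<lambda>i. Y i \<omega>) x - ?m n x\<bar> * indicator A x + ennreal \<bar>?m n x - f x\<bar> \<partial>N) =
         (\<integral>\<^sup>+x. ennreal \<bar>kde k (h n) n (\<lambda>i. Y i \<omega>) x - ?m n x\<bar> * indicator A x \<partial>N) + L1_dist N (?m n) f"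
        if [measurable]: "\<omega> \<in> space M" for \<omega>
        unfolding L1_dist_def by (intro nn_integral_add) measurable
      then show ?thesis
        by (subst nn_integral_add[symmetric, where M = M, of _ "\<lambda>_. L1_dist N (?m n) f", simplified, unfolded emeasure_space_1 mult_1_right])
           (auto intro!: nn_integral_cong)
    qed
    finally have split: "(\<integral>\<^sup>+\<omega>. (\<integral>\<^sup>+x\<in>A. ennreal \<bar>kde k (h n) n (\<lambda>i. Y i \<omega>) x - f x\<bar> \<partial>N) \<partial>M) \<le> \<dots>" .
    have "(\<integral>\<^sup>+\<omega>. (\<integral>\<^sup>+x. ennreal \<bar>kde k (h n) n (\<lambda>i. Y i \<omega>) x - ?m n x\<bar> * indicator A x \<partial>N) \<partial>M) =
       (\<integral>\<^sup>+x. (\<integral>\<^sup>+\<omega>. ennreal \<bar>kde k (h n) n (\<lambda>i. Y i \<omega>) x - ?m n x\<bar> * indicator A x \<partial>M) \<partial>N)"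
      by (rule MN.Fubini'[symmetric]) measurable
    also have "\<dots> = (\<integral>\<^sup>+x. (\<integral>\<^sup>+\<omega>. ennreal \<bar>kde k (h n) n (\<lambda>i. Y i \<omega>) x - ?m n x\<bar> \<partial>M) * indicator A x \<partial>N)"
      by (intro nn_integral_cong nn_integral_multc) measurable
    also have "\<dots> \<le> (\<integral>\<^sup>+x. (ennreal (\<epsilon> n / 2) + ennreal (1 / (2 * \<epsilon> n * n * h n ^ (2 * s))) *
        (\<integral>\<^sup>+y. ennreal ((k (sd (h n) x y))\<^sup>2) * ennreal (f y) \<partial>N)) * indicator A x \<partial>N)"
      by (intro nn_integral_mono mult_right_mono kde_deviation_le[OF \<open>prob_space M\<close> ind_n dis _ f(2) _ b n _ e]) auto
    also have "\<dots> \<le> (\<integral>\<^sup>+x. ennreal (\<epsilon> n / 2) * indicator A x + ennreal (1 / (2 * \<epsilon> n * n * h n ^ (2 * s))) *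
        (\<integral>\<^sup>+y. ennreal ((k (sd (h n) x y))\<^sup>2) * ennreal (f y) \<partial>N) \<partial>N)"
      by (intro nn_integral_mono) (auto split: split_indicator)
    also have "\<dots> = ennreal (\<epsilon> n / 2) * ennreal \<mu> + ennreal (1 / (2 * \<epsilon> n * n * h n ^ (2 * s))) *
        (\<integral>\<^sup>+x. (\<integral>\<^sup>+y. ennreal ((k (sd (h n) x y))\<^sup>2) * ennreal (f y) \<partial>N) \<partial>N)"
      by (subst nn_integral_add) (auto simp: nn_integral_cmult nn_integral_cmult_indicator \<mu>)
    also have "(\<integral>\<^sup>+x. (\<integral>\<^sup>+y. ennreal ((k (sd (h n) x y))\<^sup>2) * ennreal (f y) \<partial>N) \<partial>N) =
        (\<integral>\<^sup>+y. (\<integral>\<^sup>+x. ennreal ((k (sd (h n) x y))\<^sup>2) * ennreal (f y) \<partial>N) \<partial>N)"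
    proof -
      interpret NN: pair_sigma_finite N N ..
      show ?thesis by (rule NN.Fubini'[symmetric]) measurable
    qed
    also have "\<dots> = (\<integral>\<^sup>+y. ennreal (h n ^ s * \<kappa>) * ennreal (f y) \<partial>N)"
    proof (intro nn_integral_cong)
      fix y assume y[measurable]: "y \<in> space N"
      have "(\<integral>\<^sup>+x. ennreal ((k (sd (h n) x y))\<^sup>2) * ennreal (f y) \<partial>N) = (\<integral>\<^sup>+x. ennreal ((k (sd (h n) x y))\<^sup>2) \<partial>N) * ennreal (f y)"
        by (intro nn_integral_multc) measurable
      also have "(\<integral>\<^sup>+x. ennreal ((k (sd (h n) x y))\<^sup>2) \<partial>N) = ennreal (h n ^ s) * ennreal \<kappa>"
        using rescales_nn_integral[OF sd_left[OF b y], of "\<lambda>u. ennreal ((k u)\<^sup>2)"] by (simp add: \<kappa>)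
      finally show "(\<integral>\<^sup>+x. ennreal ((k (sd (h n) x y))\<^sup>2) * ennreal (f y) \<partial>N) = ennreal (h n ^ s * \<kappa>) * ennreal (f y)"
        using bs \<kappa> by (simp flip: ennreal_mult)
    qed
    also have "\<dots> = ennreal (h n ^ s * \<kappa>)" by (simp add: nn_integral_cmult f1)
    also have "ennreal (\<epsilon> n / 2) * ennreal \<mu> + ennreal (1 / (2 * \<epsilon> n * n * h n ^ (2 * s))) * ennreal (h n ^ s * \<kappa>) =
        ennreal (\<epsilon> n * (\<mu> + \<kappa>) / 2)"
    proof -
      have n0: "0 < real n * h n ^ s" using n bs by simp
      have "1 / sqrt r * (1 / sqrt r) * r = 1" if "0 < r" for r :: real
        using that by simp
      from this[OF n0] have ee: "\<epsilon> n * \<epsilon> n * (real n * h n ^ s) = 1"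
        by (simp only: \<epsilon>_def)
      have "1 / (2 * E * m * (a * a)) * (a * \<kappa>) = E * \<kappa> / 2"
        if "E * E * (m * a) = 1" "0 < a" "0 < E" for E m a :: real
      proof -
        have "1 / (2 * E * m * (a * a)) * (a * \<kappa>) = \<kappa> / (2 * E * (m * a))"
          using that(2) by simp
        also have "m * a = 1 / (E * E)" using that by (simp add: eq_divide_eq mult.commute)
        finally show ?thesis using that(3) by simp
      qed
      from this[OF ee bs e]
      have "1 / (2 * \<epsilon> n * n * h n ^ (2 * s)) * (h n ^ s * \<kappa>) = \<epsilon> n * \<kappa> / 2"
        by (simp only: mult_2 power_add)
      moreover have "0 \<le> \<mu>" by (simp add: \<mu>_def)
      ultimately show ?thesis using e \<kappa>(1) bs n
        by (simp add: distrib_left add_divide_distrib flip: ennreal_mult ennreal_plus)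
    qed
    finally show ?thesis by (intro order_trans[OF split add_right_mono])
  qed
  have "(\<lambda>n. \<epsilon> n) \<longlonglongrightarrow> 0"
    unfolding \<epsilon>_def by (intro tendsto_divide_0[OF tendsto_const] filterlim_at_top_imp_at_infinity
        filterlim_compose[OF sqrt_at_top nh])
  then have "(\<lambda>n. \<epsilon> n * (\<mu> + \<kappa>) / 2) \<longlonglongrightarrow> 0" by (auto intro!: tendsto_eq_intros)
  from tendsto_add[OF tendsto_ennrealI[OF this] bias_tendsto[OF k f(1) h]]
  have lim: "(\<lambda>n. ennreal (\<epsilon> n * (\<mu> + \<kappa>) / 2) + L1_dist N (?m n) f) \<longlonglongrightarrow> 0" by simp
  show ?thesis
    by (rule tendsto_sandwich[OF _ _ tendsto_const lim])
       (auto intro!: eventually_mono[OF eventually_ge_at_top[of 1] bound])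
qed

end

section \<open>Euclidean spaces and their finite products\<close>

definition vshift :: "nat \<Rightarrow> real \<Rightarrow> (nat \<Rightarrow> real) \<Rightarrow> (nat \<Rightarrow> real) \<Rightarrow> nat \<Rightarrow> real" where
  "vshift s b x u = (\<lambda>k\<in>{1..s}. x k - b * u k)"

definition block_diff :: "nat \<Rightarrow> (nat \<Rightarrow> nat) \<Rightarrow> real \<Rightarrow> (nat \<Rightarrow> nat \<Rightarrow> real) \<Rightarrow> (nat \<Rightarrow> nat \<Rightarrow> real) \<Rightarrow> nat \<Rightarrow> nat \<Rightarrow> real" where
  "block_diff p d b x y = (\<lambda>l\<in>{1..p}. scaled_diff (d l) b (x l) (y l))"

definition block_shift :: "nat \<Rightarrow> (nat \<Rightarrow> nat) \<Rightarrow> real \<Rightarrow> (nat \<Rightarrow> nat \<Rightarrow> real) \<Rightarrow> (nat \<Rightarrow> nat \<Rightarrow> real) \<Rightarrow> nat \<Rightarrow> nat \<Rightarrow> real" where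
  "block_shift p d b x u = (\<lambda>l\<in>{1..p}. vshift (d l) b (x l) (u l))"

lemma product_sigma_finite_lborel: "product_sigma_finite (\<lambda>_::nat. lborel :: real measure)"
  by (simp add: product_sigma_finite_def sigma_finite_lborel)

lemma space_euclid: "space (euclid s) = {1..s} \<rightarrow>\<^sub>E UNIV"
  by (simp add: euclid_def space_PiM)

lemma space_blocks: "space (blocks p d) = (\<Pi>\<^sub>E l\<in>{1..p}. space (euclid (d l)))"
  by (simp add: blocks_def space_PiM)

lemma sigma_finite_euclid: "sigma_finite_measure (euclid s)"
  unfolding euclid_def by (rule product_sigma_finite.sigma_finite[OF product_sigma_finite_lborel]) simp

lemma product_sigma_finite_euclid: "product_sigma_finite (\<lambda>l. euclid (d l))"
  by (simp add: product_sigma_finite_def sigma_finite_euclid)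

lemma sigma_finite_blocks: "sigma_finite_measure (blocks p d)"
  unfolding blocks_def by (rule product_sigma_finite.sigma_finite[OF product_sigma_finite_euclid]) simp

lemma measurable_euclid_component:
  "f \<in> measurable M (euclid s) \<Longrightarrow> k \<in> {1..s} \<Longrightarrow> (\<lambda>x. f x k) \<in> borel_measurable M"
  unfolding euclid_def using measurable_compose[OF _ measurable_component_singleton, of f M "{1..s}" "\<lambda>_. lborel" k]
  by simp

lemma measurable_blocks_component:
  "f \<in> measurable M (blocks p d) \<Longrightarrow> l \<in> {1..p} \<Longrightarrow> (\<lambda>x. f x l) \<in> measurable M (euclid (d l))"
  unfolding blocks_def using measurable_compose[OF _ measurable_component_singleton, of f M "{1..p}" "\<lambda>l. euclid (d l)" l]
  by simp

lemma measurable_restrict_euclid: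
  "(\<And>k. k \<in> {1..s} \<Longrightarrow> (\<lambda>x. f x k) \<in> borel_measurable M) \<Longrightarrow> (\<lambda>x. \<lambda>k\<in>{1..s}. f x k) \<in> measurable M (euclid s)"
  unfolding euclid_def by (rule measurable_restrict) simp

lemma measurable_restrict_blocks:
  "(\<And>l. l \<in> {1..p} \<Longrightarrow> (\<lambda>x. f x l) \<in> measurable M (euclid (d l))) \<Longrightarrow>
    (\<lambda>x. \<lambda>l\<in>{1..p}. f x l) \<in> measurable M (blocks p d)"
  unfolding blocks_def by (rule measurable_restrict)

lemma scaled_diff_measurable[measurable (raw)]:
  "f \<in> measurable M (euclid s) \<Longrightarrow> g \<in> measurable M (euclid s) \<Longrightarrow>
    (\<lambda>x. scaled_diff s b (f x) (g x)) \<in> measurable M (euclid s)"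
  unfolding scaled_diff_def
  by (intro measurable_restrict_euclid borel_measurable_divide borel_measurable_diff
      measurable_euclid_component borel_measurable_const)

lemma vshift_measurable[measurable (raw)]:
  "f \<in> measurable M (euclid s) \<Longrightarrow> g \<in> measurable M (euclid s) \<Longrightarrow>
    (\<lambda>x. vshift s b (f x) (g x)) \<in> measurable M (euclid s)"
  unfolding vshift_def
  by (intro measurable_restrict_euclid borel_measurable_times borel_measurable_diff
      measurable_euclid_component borel_measurable_const)

lemma kernel_space_euclid: "kernel_space (euclid s) s (scaled_diff s) (vshift s)"
proof -
  interpret sigma_finite_measure "euclid s" by (rule sigma_finite_euclid)
  have pow: "(\<Prod>k\<in>{1..s}. b) = b ^ s" for b :: real by simp
  show ?thesis
  proof
    show "(\<lambda>(x, y). scaled_diff s b x y) \<in> measurable (euclid s \<Otimes>\<^sub>M euclid s) (euclid s)" for b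
      by measurable
    show "(\<lambda>(x, u). vshift s b x u) \<in> measurable (euclid s \<Otimes>\<^sub>M euclid s) (euclid s)" for b
      by measurable
  next
    fix b :: real and y :: "nat \<Rightarrow> real" assume b: "0 < b"
    have "rescales lborel (\<lambda>x. (x - y k) / b) b" for k
      using rescales_affine[of "1 / b" "- y k / b"] b by (simp add: diff_divide_distrib)
    from rescales_PiM[OF product_sigma_finite_lborel, of "{1..s}" "\<lambda>k x. (x - y k) / b" "\<lambda>_. b"] this b
    show "rescales (euclid s) (\<lambda>x. scaled_diff s b x y) (b ^ s)"
      unfolding euclid_def scaled_diff_def by simp
  next
    fix b :: real and x :: "nat \<Rightarrow> real" assume b: "0 < b"
    have "rescales lborel (\<lambda>y. (x k - y) / b) b" for k
      using rescales_affine[of "- 1 / b" "x k / b"] b by (simp add: diff_divide_distrib)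
    from rescales_PiM[OF product_sigma_finite_lborel, of "{1..s}" "\<lambda>k y. (x k - y) / b" "\<lambda>_. b"] this b
    show "rescales (euclid s) (\<lambda>y. scaled_diff s b x y) (b ^ s)"
      unfolding euclid_def scaled_diff_def by simp
  next
    fix b :: real and x y assume "0 < b" "y \<in> space (euclid s)"
    then show "vshift s b x (scaled_diff s b x y) = y"
      by (auto simp: vshift_def scaled_diff_def space_euclid PiE_iff extensional_def fun_eq_iff)
  next
    fix u h :: "nat \<Rightarrow> real" assume "h \<longlonglongrightarrow> 0"
    then have "(\<lambda>n. h n * u k) \<longlonglongrightarrow> 0" for k by (rule tendsto_mult_left_zero)
    from L1_near_identity_translation[OF this]
    have "L1_near_identity (PiM {1..s} (\<lambda>_. lborel)) (\<lambda>n x. \<lambda>k\<in>{1..s}. x k - h n * u k)"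
      by (intro L1_near_identity_PiM[OF product_sigma_finite_lborel]) auto
    then show "L1_near_identity (euclid s) (\<lambda>n x. vshift s (h n) x u)"
      by (simp add: euclid_def vshift_def)
  qed
qed

lemma kernel_space_blocks:
  "kernel_space (blocks p d) (\<Sum>l=1..p. d l) (block_diff p d) (block_shift p d)"
proof -
  interpret sigma_finite_measure "blocks p d" by (rule sigma_finite_blocks)
  note E = kernel_space_euclid
  have sp: "x l \<in> space (euclid (d l))" if "x \<in> space (blocks p d)" "l \<in> {1..p}" for x l
    using that by (auto simp: space_blocks)
  show ?thesis
  proof
    show "(\<lambda>(x, y). block_diff p d b x y) \<in> measurable (blocks p d \<Otimes>\<^sub>M blocks p d) (blocks p d)" for b
      unfolding block_diff_def case_prod_beta
      by (intro measurable_restrict_blocks scaled_diff_measurable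
          measurable_blocks_component[OF measurable_fst] measurable_blocks_component[OF measurable_snd])
    show "(\<lambda>(x, u). block_shift p d b x u) \<in> measurable (blocks p d \<Otimes>\<^sub>M blocks p d) (blocks p d)" for b
      unfolding block_shift_def case_prod_beta
      by (intro measurable_restrict_blocks vshift_measurable
          measurable_blocks_component[OF measurable_fst] measurable_blocks_component[OF measurable_snd])
  next
    fix b :: real and y assume b: "0 < b" and y: "y \<in> space (blocks p d)"
    show "rescales (blocks p d) (\<lambda>x. block_diff p d b x y) (b ^ (\<Sum>l=1..p. d l))"
      unfolding blocks_def block_diff_def power_sum using b sp[OF y]
      by (intro rescales_PiM[OF product_sigma_finite_euclid] kernel_space.sd_left[OF E]) auto
  next
    fix b :: real and x assume b: "0 < b" and x: "x \<in> space (blocks p d)"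
    show "rescales (blocks p d) (\<lambda>y. block_diff p d b x y) (b ^ (\<Sum>l=1..p. d l))"
      unfolding blocks_def block_diff_def power_sum using b sp[OF x]
      by (intro rescales_PiM[OF product_sigma_finite_euclid] kernel_space.sd_right[OF E]) auto
  next
    fix b :: real and x y assume b: "0 < b" and x: "x \<in> space (blocks p d)" and y: "y \<in> space (blocks p d)"
    then have "block_shift p d b x (block_diff p d b x y) l = y l" for l
      using kernel_space.mv_sd[OF E b sp[OF x] sp[OF y], of l]
      by (auto simp: block_shift_def block_diff_def space_blocks PiE_iff extensional_def)
    then show "block_shift p d b x (block_diff p d b x y) = y" by auto
  next
    fix u and h :: "nat \<Rightarrow> real" assume u: "u \<in> space (blocks p d)" and h: "h \<longlonglongrightarrow> 0"
    show "L1_near_identity (blocks p d) (\<lambda>n x. block_shift p d (h n) x u)"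
      unfolding blocks_def block_shift_def using kernel_space.mv_near[OF E sp[OF u] h]
      by (intro L1_near_identity_PiM[OF product_sigma_finite_euclid]) auto
  qed
qed

interpretation euclid: kernel_space "euclid s" s "scaled_diff s" "vshift s" for s
  by (rule kernel_space_euclid)

interpretation blocks: kernel_space "blocks p d" "\<Sum>l=1..p. d l" "block_diff p d" "block_shift p d" for p d
  by (rule kernel_space_blocks)

abbreviation (input) joint_kernel :: "nat \<Rightarrow> (nat \<Rightarrow> (nat \<Rightarrow> real) \<Rightarrow> real) \<Rightarrow> (nat \<Rightarrow> nat \<Rightarrow> real) \<Rightarrow> real" where
  "joint_kernel p K u \<equiv> (\<Prod>l=1..p. K l (u l))"

lemma f_marg_eq_kde: "f_marg s k b n Y x = euclid.kde s k b n Y x"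
  by (simp add: f_marg_def euclid.kde_def)

lemma f_joint_eq_kde: "f_joint p d K b n Y x = blocks.kde d p (joint_kernel p K) b n Y x"
  unfolding f_joint_def blocks.kde_def block_diff_def 
  by (intro arg_cong2[where f = "(/)"] sum.cong prod.cong refl) simp

lemma joint_kernel_pdf:
  assumes "\<And>l. l \<in> {1..p} \<Longrightarrow> is_pdf (euclid (d l)) (K l)"
  shows "integrable (blocks p d) (joint_kernel p K)" "(LINT u|blocks p d. joint_kernel p K u) = 1"
    "\<And>u. u \<in> space (blocks p d) \<Longrightarrow> 0 \<le> joint_kernel p K u"
proof -
  interpret product_sigma_finite "\<lambda>l. euclid (d l)" by (rule product_sigma_finite_euclid)
  have K: "integrable (euclid (d l)) (K l)" "(LINT u|euclid (d l). K l u) = 1"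
    "\<And>u. u \<in> space (euclid (d l)) \<Longrightarrow> 0 \<le> K l u" if "l \<in> {1..p}" for l
    using assms[OF that] by (auto simp: is_pdf_def has_bochner_integral_iff)
  show "integrable (blocks p d) (joint_kernel p K)" unfolding blocks_def
    using K by (intro product_integrable_prod) auto
  show "(LINT u|blocks p d. joint_kernel p K u) = 1" unfolding blocks_def
    using K by (subst product_integral_prod) auto
  show "\<And>u. u \<in> space (blocks p d) \<Longrightarrow> 0 \<le> joint_kernel p K u"
    unfolding space_blocks by (rule prod_nonneg) (blast intro: K(3) dest: PiE_mem)
qed

lemma joint_kernel_square_integrable:
  assumes "\<And>l. l \<in> {1..p} \<Longrightarrow> integrable (euclid (d l)) (\<lambda>u. (K l u)\<^sup>2)"
  shows "integrable (blocks p d) (\<lambda>u. (joint_kernel p K u)\<^sup>2)"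
proof -
  interpret product_sigma_finite "\<lambda>l. euclid (d l)" by (rule product_sigma_finite_euclid)
  show ?thesis unfolding blocks_def prod_power_distrib
    using assms by (intro product_integrable_prod) auto
qed

section \<open>Covariance of the absolute values of two correlated normal variables\<close>

interpretation std_normal: prob_space std_normal_distribution
  by (rule prob_space_normal_density) simp

interpretation std_normal_pair: pair_prob_space std_normal_distribution std_normal_distribution ..

lemma integrable_std_normal_even:
  "integrable std_normal_distribution (\<lambda>z. z\<^sup>2)" "integrable std_normal_distribution (\<lambda>z. \<bar>z\<bar>)"
  using integrable_std_normal_moment[of 2] integrable_std_normal_moment_abs[of 1]
  by (simp_all add: integrable_real_density)

text \<open>
The normal law has full support.
\<close>

lemma AE_std_normal_imp_ex:
  assumes "AE z in std_normal_distribution. P z" and "a < b"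
  obtains z where "a < z" "z < b" "P z"
proof -
  have "AE z in lborel. P z"
    using assms(1) by (subst (asm) AE_density) (auto simp: normal_density_pos)
  moreover have "\<not> (AE z in lborel. z \<notin> {a<..<b})"
    using assms(2) by (subst AE_iff_measurable[where N = "{a<..<b}"]) auto
  ultimately have "\<not> (\<forall>z. P z \<longrightarrow> z \<notin> {a<..<b})"
    using eventually_mono[of P "ae_filter lborel" "\<lambda>z. z \<notin> {a<..<b}"] by blast
  then show thesis using that by auto
qed

lemma std_normal_reflect:
  fixes g :: "real \<Rightarrow> real"
  assumes [measurable]: "g \<in> borel_measurable borel"
  shows "(LINT z|std_normal_distribution. g (- z)) = (LINT z|std_normal_distribution. g z)"
proof -
  have "(LINT z|std_normal_distribution. g (- z)) = (LINT z|lborel. std_normal_density z * g (- z))"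
    by (subst integral_real_density) auto
  also have "\<dots> = (LINT z|lborel. std_normal_density z * g z)"
    using lborel_integral_real_affine[of "-1" "\<lambda>z. std_normal_density z * g z" 0]
    by (simp add: normal_density_def)
  also have "\<dots> = (LINT z|std_normal_distribution. g z)"
    by (subst integral_real_density) auto
  finally show ?thesis .
qed

lemma std_normal_abs_mean_pos: "0 < (LINT z|std_normal_distribution. \<bar>z\<bar>)"
  using std_normal_distribution_odd_moments_abs[of 0] by simp

text \<open>
All functions of the two normal variables that occur below grow at most quadratically.
\<close>

lemma integrable_normal_pairI:
  fixes F :: "real \<Rightarrow> real \<Rightarrow> real"
  assumes [measurable]: "case_prod F \<in> borel_measurable (borel \<Otimes>\<^sub>M borel)"
    and bound: "\<And>x y. \<bar>F x y\<bar> \<le> c * (1 + x\<^sup>2 + y\<^sup>2)"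
  shows "integrable normal_pair (case_prod F)"
proof (rule Bochner_Integration.integrable_bound)
  have c: "\<bar>F x y\<bar> \<le> \<bar>c\<bar> * (1 + x\<^sup>2 + y\<^sup>2)" for x y
    by (rule order_trans[OF bound]) (intro mult_right_mono, auto)
  have "(\<integral>\<^sup>+x. (\<integral>\<^sup>+y. ennreal (\<bar>c\<bar> * (1 + x\<^sup>2 + y\<^sup>2)) \<partial>std_normal_distribution) \<partial>std_normal_distribution) < \<infinity>"
  proof -
    let ?q = "LINT y|std_normal_distribution. y\<^sup>2"
    have "(\<integral>\<^sup>+y. ennreal (\<bar>c\<bar> * (1 + x\<^sup>2 + y\<^sup>2)) \<partial>std_normal_distribution) = ennreal (\<bar>c\<bar> * (1 + x\<^sup>2 + ?q))" for x
      using integrable_std_normal_even(1) std_normal.prob_space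
      by (subst nn_integral_eq_integral) auto
    moreover have "(\<integral>\<^sup>+x. ennreal (\<bar>c\<bar> * (1 + x\<^sup>2 + ?q)) \<partial>std_normal_distribution) < \<infinity>"
      using integrable_std_normal_even(1) by (subst nn_integral_eq_integral) auto
    ultimately show ?thesis by simp
  qed
  then show "integrable normal_pair (\<lambda>(x, y). \<bar>c\<bar> * (1 + x\<^sup>2 + y\<^sup>2))"
    by (subst integrable_iff_bounded) (simp add: std_normal.nn_integral_fst[symmetric] case_prod_beta)
  show "AE z in normal_pair. norm (case_prod F z) \<le> norm (case z of (x, y) \<Rightarrow> \<bar>c\<bar> * (1 + x\<^sup>2 + y\<^sup>2))"
    using c by (intro AE_I2) (auto simp: abs_mult split: prod.split)
qed measurable

definition normal_abs_cov :: "real \<Rightarrow> real" where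
  "normal_abs_cov r = covariance normal_pair (\<lambda>(z1, z2). \<bar>sqrt (1 - r\<^sup>2) * z1 + r * z2\<bar>) (\<lambda>(z1, z2). \<bar>z2\<bar>)"

text \<open>
The law of \<open>Z1\<close> is symmetric, so \<open>\<bar>a Z1 + r Z2\<bar>\<close> may be replaced by its average with
\<open>\<bar>- a Z1 + r Z2\<bar>\<close>, which is \<open>max \<bar>a Z1\<bar> \<bar>r Z2\<bar>\<close>. Subtracting a function of \<open>Z1\<close> alone changes nothing,
as \<open>\<bar>Z2\<bar> - m\<close> is centered and independent of \<open>Z1\<close>; the function is chosen such that the first factor
changes sign together with \<open>\<bar>Z2\<bar> - m\<close>.
\<close>

lemma normal_abs_cov_eq:
  fixes r :: real
  defines "m \<equiv> (LINT z|std_normal_distribution. \<bar>z\<bar>)" and "a \<equiv> sqrt (1 - r\<^sup>2)"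
  assumes r: "0 \<le> r" "r \<le> 1"
  defines "G \<equiv> \<lambda>x y. (max (a * \<bar>x\<bar>) (r * \<bar>y\<bar>) - max (a * \<bar>x\<bar>) (r * m)) * (\<bar>y\<bar> - m)"
  shows "integrable normal_pair (case_prod G)" "normal_abs_cov r = (LINT z|normal_pair. case_prod G z)"
proof -
  let ?P = std_normal_distribution
  let ?Q = normal_pair
  have a: "0 \<le> a" "a \<le> 1" using r by (auto simp: a_def power_le_one)
  have m: "0 < m" unfolding m_def by (rule std_normal_abs_mean_pos)
  \<comment> \<open>A constant with \<open>3 (x\<^sup>2 + y\<^sup>2 + m\<^sup>2) \<le> c (1 + x\<^sup>2 + y\<^sup>2)\<close>, for the integrability of all products below.\<close>
  define c where "c = 4 * (1 + m) * (1 + m)"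
  have sq: "\<bar>x\<bar> \<le> 1 + x\<^sup>2" for x :: real
  proof -
    have "0 \<le> (\<bar>x\<bar> - 1)\<^sup>2" by simp
    then have "2 * \<bar>x\<bar> \<le> 1 + x\<^sup>2" by (simp add: power2_eq_square algebra_simps)
    then show ?thesis by simp
  qed
  have prodb: "\<bar>u * v\<bar> \<le> c * (1 + x\<^sup>2 + y\<^sup>2)"
    if u: "\<bar>u\<bar> \<le> \<bar>x\<bar> + \<bar>y\<bar> + m" and v: "\<bar>v\<bar> \<le> \<bar>y\<bar> + m" for u v x y
  proof -
    have "\<bar>u * v\<bar> \<le> (\<bar>x\<bar> + \<bar>y\<bar> + m) * (\<bar>x\<bar> + \<bar>y\<bar> + m)"
      unfolding abs_mult using u v by (intro mult_mono) auto
    also have "\<dots> \<le> 3 * (\<bar>x\<bar>\<^sup>2 + \<bar>y\<bar>\<^sup>2 + m\<^sup>2)"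
    proof -
      have "0 \<le> (\<bar>x\<bar> - \<bar>y\<bar>)\<^sup>2 + (\<bar>x\<bar> - m)\<^sup>2 + (\<bar>y\<bar> - m)\<^sup>2" by simp
      then show ?thesis by (simp add: power2_eq_square algebra_simps)
    qed
    also have "\<dots> \<le> c * (1 + x\<^sup>2 + y\<^sup>2)"
    proof -
      have "c = 4 + 8 * m + 4 * m\<^sup>2" by (simp add: c_def power2_eq_square algebra_simps)
      then have "c * (1 + x\<^sup>2 + y\<^sup>2) = 4 * (x\<^sup>2 + y\<^sup>2) + 4 * m\<^sup>2 + (4 + 8 * m + (8 * m + 4 * m\<^sup>2) * (x\<^sup>2 + y\<^sup>2))"
        by (simp add: algebra_simps)
      moreover have "0 \<le> 4 + 8 * m + (8 * m + 4 * m\<^sup>2) * (x\<^sup>2 + y\<^sup>2)" using m by simp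
      ultimately show ?thesis by simp
    qed
    finally show ?thesis .
  qed
  have ax: "a * \<bar>x\<bar> \<le> \<bar>x\<bar>" "0 \<le> a * \<bar>x\<bar>" for x using a by (auto intro: mult_left_le_one_le)
  have rx: "r * \<bar>x\<bar> \<le> \<bar>x\<bar>" "0 \<le> r * \<bar>x\<bar>" for x using r by (auto intro: mult_left_le_one_le)
  have rm: "0 \<le> r * m" "r * m \<le> m" using r m by (auto intro: mult_left_le_one_le)
  let ?X = "\<lambda>x y. \<bar>a * x + r * y\<bar>"
  have Xle: "?X x y \<le> \<bar>x\<bar> + \<bar>y\<bar>" for x y
    using ax[of x] rx[of y] a r abs_triangle_ineq[of "a * x" "r * y"] by (simp add: abs_mult)
  have int: "integrable ?Q (\<lambda>(x, y). U x y * (\<bar>y\<bar> - m))"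
    if [measurable]: "case_prod U \<in> borel_measurable (borel \<Otimes>\<^sub>M borel)" and U: "\<And>x y. \<bar>U x y\<bar> \<le> \<bar>x\<bar> + \<bar>y\<bar> + m" for U
    using m by (intro integrable_normal_pairI[where c = c] prodb U) auto
  have iX: "integrable ?Q (\<lambda>(x, y). ?X x y * (\<bar>y\<bar> - m))"
    using Xle m by (intro int) (auto simp: le_add_same_cancel1 intro: order_trans[OF Xle])
  have iXr: "integrable ?Q (\<lambda>(x, y). ?X (- x) y * (\<bar>y\<bar> - m))"
  proof (intro int)
    show "\<bar>?X (- x) y\<bar> \<le> \<bar>x\<bar> + \<bar>y\<bar> + m" for x y using Xle[of "- x" y] m by simp
  qed measurable
  have iM: "integrable ?Q (\<lambda>(x, y). max (a * \<bar>x\<bar>) (r * \<bar>y\<bar>) * (\<bar>y\<bar> - m))"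
  proof (intro int)
    show "\<bar>max (a * \<bar>x\<bar>) (r * \<bar>y\<bar>)\<bar> \<le> \<bar>x\<bar> + \<bar>y\<bar> + m" for x y using ax[of x] rx[of y] m by (auto simp: max_def)
  qed measurable
  have iC: "integrable ?Q (\<lambda>(x, y). max (a * \<bar>x\<bar>) (r * m) * (\<bar>y\<bar> - m))"
  proof (intro int)
    show "\<bar>max (a * \<bar>x\<bar>) (r * m)\<bar> \<le> \<bar>x\<bar> + \<bar>y\<bar> + m" for x y using ax[of x] rm m abs_ge_zero[of x] abs_ge_zero[of y] by linarith
  qed measurable
  have G: "case_prod G z = (case z of (x, y) \<Rightarrow> max (a * \<bar>x\<bar>) (r * \<bar>y\<bar>) * (\<bar>y\<bar> - m)) - (case z of (x, y) \<Rightarrow> max (a * \<bar>x\<bar>) (r * m) * (\<bar>y\<bar> - m))" for z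
    by (cases z) (simp add: G_def left_diff_distrib)
  show iG: "integrable ?Q (case_prod G)" unfolding G[abs_def] using iM iC by (rule Bochner_Integration.integrable_diff)
  have c0: "(LINT z|?Q. (case z of (x, y) \<Rightarrow> k x * (\<bar>y\<bar> - m))) = 0"
    if "integrable ?Q (\<lambda>(x, y). k x * (\<bar>y\<bar> - m))" for k
  proof -
    have "(LINT z|?Q. (case z of (x, y) \<Rightarrow> k x * (\<bar>y\<bar> - m))) = (LINT x|?P. (LINT y|?P. k x * (\<bar>y\<bar> - m)))"
      using std_normal_pair.integral_fst'[OF that] by simp
    also have "\<dots> = 0" using integrable_std_normal_even(2) std_normal.prob_space by (simp add: m_def)
    finally show ?thesis .
  qed
  have m': "(LINT z|?Q. (case z of (x, y) \<Rightarrow> \<bar>y\<bar>)) = m"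
  proof -
    have "integrable ?Q (\<lambda>(x, y). \<bar>y\<bar>)"
    proof (rule integrable_normal_pairI[where c = 1])
      show "\<bar>\<bar>y\<bar>\<bar> \<le> 1 * (1 + x\<^sup>2 + y\<^sup>2)" for x y :: real using sq[of y] zero_le_power2[of x] unfolding abs_idempotent mult_1 by linarith
    qed measurable
    from std_normal_pair.integral_fst'[OF this] show ?thesis
      using std_normal.prob_space by (simp add: m_def)
  qed
  define e where "e = (LINT z|?Q. (case z of (x, y) \<Rightarrow> ?X x y))"
  have ie: "integrable ?Q (\<lambda>(x, y). e * (\<bar>y\<bar> - m))"
  proof (rule integrable_normal_pairI[where c = "\<bar>e\<bar> * (1 + m)"])
    show "\<bar>e * (\<bar>y\<bar> - m)\<bar> \<le> \<bar>e\<bar> * (1 + m) * (1 + x\<^sup>2 + y\<^sup>2)" for x y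
    proof -
      have "\<bar>\<bar>y\<bar> - m\<bar> \<le> (1 + y\<^sup>2) + m" using sq[of y] m by simp
      also have "\<dots> \<le> (1 + m) * (1 + x\<^sup>2 + y\<^sup>2)" using m by (simp add: algebra_simps)
      finally show ?thesis by (simp add: abs_mult mult_left_mono mult.assoc)
    qed
  qed measurable
  have "normal_abs_cov r = (LINT z|?Q. (case z of (x, y) \<Rightarrow> ?X x y * (\<bar>y\<bar> - m)) - (case z of (x, y) \<Rightarrow> e * (\<bar>y\<bar> - m)))"
    unfolding normal_abs_cov_def covariance_def m' a_def[symmetric] e_def[symmetric]
    by (intro Bochner_Integration.integral_cong refl) (auto simp: left_diff_distrib)
  also have "\<dots> = (LINT z|?Q. (case z of (x, y) \<Rightarrow> ?X x y * (\<bar>y\<bar> - m)))"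
    unfolding Bochner_Integration.integral_diff[OF iX ie] c0[OF ie] by (rule diff_zero)
  also have "\<dots> = (LINT z|?Q. (case z of (x, y) \<Rightarrow> max (a * \<bar>x\<bar>) (r * \<bar>y\<bar>) * (\<bar>y\<bar> - m)))"
  proof -
    have "(LINT z|?Q. (case z of (x, y) \<Rightarrow> ?X x y * (\<bar>y\<bar> - m))) = (LINT y|?P. (LINT x|?P. ?X x y * (\<bar>y\<bar> - m)))"
      using std_normal_pair.integral_snd[OF iX] by simp
    also have "\<dots> = (LINT y|?P. (LINT x|?P. ?X (- x) y * (\<bar>y\<bar> - m)))"
      by (intro Bochner_Integration.integral_cong refl
          std_normal_reflect[symmetric, of "\<lambda>x. ?X x y * (\<bar>y\<bar> - m)" for y]) measurable
    also have "\<dots> = (LINT z|?Q. (case z of (x, y) \<Rightarrow> ?X (- x) y * (\<bar>y\<bar> - m)))"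
      using std_normal_pair.integral_snd[OF iXr] by simp
    finally have "2 * (LINT z|?Q. (case z of (x, y) \<Rightarrow> ?X x y * (\<bar>y\<bar> - m))) =
        (LINT z|?Q. (case z of (x, y) \<Rightarrow> ?X x y * (\<bar>y\<bar> - m)) + (case z of (x, y) \<Rightarrow> ?X (- x) y * (\<bar>y\<bar> - m)))"
      unfolding Bochner_Integration.integral_add[OF iX iXr] by linarith
    also have "\<dots> = (LINT z|?Q. 2 * (case z of (x, y) \<Rightarrow> max (a * \<bar>x\<bar>) (r * \<bar>y\<bar>) * (\<bar>y\<bar> - m)))"
    proof (intro Bochner_Integration.integral_cong refl)
      fix z :: "real \<times> real"
      have "\<bar>u + v\<bar> + \<bar>- u + v\<bar> = 2 * max \<bar>u\<bar> \<bar>v\<bar>" for u v :: real by (auto simp: max_def abs_if)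
      from this[of "a * fst z" "r * snd z"] a r
      show "(case z of (x, y) \<Rightarrow> ?X x y * (\<bar>y\<bar> - m)) + (case z of (x, y) \<Rightarrow> ?X (- x) y * (\<bar>y\<bar> - m)) =
          2 * (case z of (x, y) \<Rightarrow> max (a * \<bar>x\<bar>) (r * \<bar>y\<bar>) * (\<bar>y\<bar> - m))"
        by (cases z) (simp add: abs_mult distrib_right[symmetric])
    qed
    also have "\<dots> = 2 * (LINT z|?Q. (case z of (x, y) \<Rightarrow> max (a * \<bar>x\<bar>) (r * \<bar>y\<bar>) * (\<bar>y\<bar> - m)))"
      by simp
    finally show ?thesis by simp
  qed
  also have "\<dots> = (LINT z|?Q. case_prod G z)"
    unfolding G[abs_def] Bochner_Integration.integral_diff[OF iM iC] c0[OF iC] by (rule diff_zero[symmetric])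
  finally show "normal_abs_cov r = (LINT z|?Q. case_prod G z)" .
qed

text \<open>
The integrand is nonnegative, and it is positive where \<open>Z1\<close> is small and \<open>Z2\<close> exceeds its mean
absolute value.
\<close>

lemma normal_abs_cov_pos:
  assumes r: "0 < r" "r \<le> 1"
  shows "0 < normal_abs_cov r"
proof -
  define m where "m = (LINT z|std_normal_distribution. \<bar>z\<bar>)"
  define a where "a = sqrt (1 - r\<^sup>2)"
  define G where "G = (\<lambda>x y. (max (a * \<bar>x\<bar>) (r * \<bar>y\<bar>) - max (a * \<bar>x\<bar>) (r * m)) * (\<bar>y\<bar> - m))"
  have m: "0 < m" unfolding m_def by (rule std_normal_abs_mean_pos)
  have a: "0 \<le> a" "a \<le> 1" using r by (auto simp: a_def power_le_one)
  have iG: "integrable normal_pair (case_prod G)" and eq: "normal_abs_cov r = (LINT z|normal_pair. case_prod G z)"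
    using normal_abs_cov_eq[of r] r unfolding G_def a_def m_def by auto
  have G0: "0 \<le> G x y" for x y
  proof (cases "m \<le> \<bar>y\<bar>")
    case True
    then have "r * m \<le> r * \<bar>y\<bar>" using r by simp
    with True show ?thesis unfolding G_def by (intro mult_nonneg_nonneg) auto
  next
    case False
    then have "r * \<bar>y\<bar> \<le> r * m" using r by simp
    with False show ?thesis unfolding G_def by (intro mult_nonpos_nonpos) auto
  qed
  have "normal_abs_cov r \<noteq> 0"
  proof
    assume "normal_abs_cov r = 0"
    then have "AE z in normal_pair. case_prod G z = 0"
      using integral_nonneg_eq_0_iff_AE[OF iG] G0 unfolding eq by (simp add: case_prod_beta')
    then have "AE x in std_normal_distribution. AE y in std_normal_distribution. G x y = 0"
      using std_normal_pair.AE_pair by fastforce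
    then obtain x where x: "0 < x" "x < r * m" "AE y in std_normal_distribution. G x y = 0"
      using AE_std_normal_imp_ex[of _ 0 "r * m"] r m by auto
    from x(3) obtain y where y: "m < y" "y < m + 1" "G x y = 0"
      using AE_std_normal_imp_ex[of _ m "m + 1"] by auto
    have "a * \<bar>x\<bar> \<le> x" using a x(1) by (simp add: mult_left_le_one_le)
    then have "a * \<bar>x\<bar> < r * m" using x(2) by simp
    moreover have "r * m < r * \<bar>y\<bar>" using r y(1) by simp
    ultimately have "0 < G x y" using y(1) unfolding G_def by (intro mult_pos_pos) (auto simp: max_def)
    with y(3) show False by simp
  qed
  moreover have "0 \<le> normal_abs_cov r" unfolding eq using G0 by (intro integral_nonneg_AE AE_I2) auto
  ultimately show ?thesis by simp
qed

text \<open>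
The map \<open>t \<mapsto> max c (r t)\<close> is \<open>r\<close>-Lipschitz. A bound that is linear in the correlation makes the
integrand of the asymptotic variance integrable over the whole space, so that no bound on the size
of the unit balls has to be derived.
\<close>

lemma normal_abs_cov_le:
  obtains B where "\<And>r. 0 \<le> r \<Longrightarrow> r \<le> 1 \<Longrightarrow> 0 \<le> normal_abs_cov r \<and> normal_abs_cov r \<le> B * r"
proof
  define m where "m = (LINT z|std_normal_distribution. \<bar>z\<bar>)"
  let ?B = "LINT z|normal_pair. (case z of (x, y) \<Rightarrow> (\<bar>y\<bar> - m)\<^sup>2)"
  have m: "0 < m" unfolding m_def by (rule std_normal_abs_mean_pos)
  have iB: "integrable normal_pair (\<lambda>(x, y). (\<bar>y\<bar> - m)\<^sup>2)"
  proof (rule integrable_normal_pairI[where c = "2 * (1 + m\<^sup>2)"])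
    show "\<bar>(\<bar>y\<bar> - m)\<^sup>2\<bar> \<le> 2 * (1 + m\<^sup>2) * (1 + x\<^sup>2 + y\<^sup>2)" for x y
    proof -
      have "(\<bar>y\<bar> - m)\<^sup>2 \<le> 2 * (y\<^sup>2 + m\<^sup>2)"
        using zero_le_power2[of "\<bar>y\<bar> + m"] by (simp add: power2_eq_square algebra_simps)
      also have "\<dots> \<le> 2 * (1 + m\<^sup>2) * (1 + x\<^sup>2 + y\<^sup>2)" by (simp add: algebra_simps)
      finally show ?thesis by simp
    qed
  qed measurable
  fix r :: real assume r: "0 \<le> r" "r \<le> 1"
  define a where "a = sqrt (1 - r\<^sup>2)"
  define G where "G = (\<lambda>x y. (max (a * \<bar>x\<bar>) (r * \<bar>y\<bar>) - max (a * \<bar>x\<bar>) (r * m)) * (\<bar>y\<bar> - m))"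
  have iG: "integrable normal_pair (case_prod G)" and eq: "normal_abs_cov r = (LINT z|normal_pair. case_prod G z)"
    using normal_abs_cov_eq[of r] r unfolding G_def a_def m_def by auto
  have G: "0 \<le> G x y" "G x y \<le> r * (\<bar>y\<bar> - m)\<^sup>2" for x y
  proof -
    have "r * (\<bar>y\<bar> - m)\<^sup>2 = (r * \<bar>y\<bar> - r * m) * (\<bar>y\<bar> - m)" by (simp add: power2_eq_square algebra_simps)
    moreover have "0 \<le> G x y \<and> G x y \<le> (r * \<bar>y\<bar> - r * m) * (\<bar>y\<bar> - m)"
    proof (cases "m \<le> \<bar>y\<bar>")
      case True
      then have "r * m \<le> r * \<bar>y\<bar>" using r by (simp add: mult_left_mono)
      with True show ?thesis unfolding G_def by (auto intro!: mult_nonneg_nonneg mult_right_mono)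
    next
      case False
      then have "r * \<bar>y\<bar> \<le> r * m" using r by (simp add: mult_left_mono)
      with False show ?thesis unfolding G_def by (auto intro!: mult_nonpos_nonpos mult_right_mono_neg)
    qed
    ultimately show "0 \<le> G x y" "G x y \<le> r * (\<bar>y\<bar> - m)\<^sup>2" by auto
  qed
  have "normal_abs_cov r \<le> (LINT z|normal_pair. r * (case z of (x, y) \<Rightarrow> (\<bar>y\<bar> - m)\<^sup>2))"
    unfolding eq using iG iB G by (intro integral_mono) (auto split: prod.split)
  moreover have "0 \<le> normal_abs_cov r" unfolding eq using G(1) by (intro integral_nonneg_AE AE_I2) auto
  ultimately show "0 \<le> normal_abs_cov r \<and> normal_abs_cov r \<le> ?B * r" by (simp add: mult.commute)
qed

lemma normal_abs_cov_measurable[measurable]: "normal_abs_cov \<in> borel_measurable borel"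
  unfolding normal_abs_cov_def covariance_def by measurable

section \<open>Positivity of the asymptotic variance\<close>

lemma vadd_eq_vshift: "vadd s u t = vshift s (- 1) u t"
  by (simp add: vadd_def vshift_def)

lemma vadd_measurable[measurable (raw)]:
  "f \<in> measurable M (euclid s) \<Longrightarrow> g \<in> measurable M (euclid s) \<Longrightarrow>
    (\<lambda>x. vadd s (f x) (g x)) \<in> measurable M (euclid s)"
  unfolding vadd_eq_vshift by (rule vshift_measurable)

lemma rescales_vadd: "rescales (euclid s) (\<lambda>u. vadd s u t) 1"
proof -
  have "rescales lborel (\<lambda>x. x + t k) 1" for k
    using rescales_affine[of 1 "t k"] by (simp add: add.commute)
  from rescales_PiM[OF product_sigma_finite_lborel, of "{1..s}" "\<lambda>k x. x + t k" "\<lambda>_. 1"] this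
  show ?thesis unfolding euclid_def vadd_def by simp
qed

text \<open>
Expand \<open>u\<close> in the unit vectors and apply the triangle inequality.
\<close>

lemma norm_le_weighted_l1:
  assumes "is_norm s N"
  obtains c where "\<And>k. 0 \<le> c k" "\<And>u. u \<in> space (euclid s) \<Longrightarrow> N u \<le> (\<Sum>k=1..s. c k * \<bar>u k\<bar>)"
proof
  let ?e = "\<lambda>k. \<lambda>j\<in>{1..s}. if j = k then 1 else (0::real)"
  have N: "\<And>u. u \<in> space (euclid s) \<Longrightarrow> 0 \<le> N u"
    "\<And>u. u \<in> space (euclid s) \<Longrightarrow> (\<forall>k\<in>{1..s}. u k = 0) \<Longrightarrow> N u = 0"
    "\<And>a u. u \<in> space (euclid s) \<Longrightarrow> N (vscale s a u) = \<bar>a\<bar> * N u"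
    "\<And>u v. u \<in> space (euclid s) \<Longrightarrow> v \<in> space (euclid s) \<Longrightarrow> N (vadd s u v) \<le> N u + N v"
    using assms unfolding is_norm_def by blast+
  have e: "?e k \<in> space (euclid s)" for k by (simp add: space_euclid)
  show "0 \<le> N (?e k)" for k using N(1) e .
  fix u assume u: "u \<in> space (euclid s)"
  have part: "N (\<lambda>j\<in>{1..s}. if j \<in> F then u j else 0) \<le> (\<Sum>k\<in>F. N (?e k) * \<bar>u k\<bar>)" if "finite F" for F
    using that
  proof (induct F)
    case empty
    have "N (\<lambda>j\<in>{1..s}. if j \<in> {} then u j else 0) = 0" by (rule N(2)) (auto simp: space_euclid)
    then show ?case by (simp only: sum.empty order_refl)
  next
    case (insert k F)
    let ?r = "\<lambda>j\<in>{1..s}. if j \<in> F then u j else 0"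
    have eq: "(\<lambda>j\<in>{1..s}. if j \<in> insert k F then u j else 0) = vadd s ?r (vscale s (u k) (?e k))"
      using insert(2) by (auto simp: vadd_def vscale_def fun_eq_iff)
    have "N (vadd s ?r (vscale s (u k) (?e k))) \<le> N ?r + N (vscale s (u k) (?e k))"
      by (intro N(4)) (auto simp: space_euclid vscale_def)
    moreover have "N (vscale s (u k) (?e k)) = N (?e k) * \<bar>u k\<bar>"
      using N(3)[OF e, of "u k" k] by (simp only: mult.commute)
    ultimately show ?case
      unfolding sum.insert[OF insert(1,2)] eq using insert(3) by linarith
  qed
  have "(\<lambda>j\<in>{1..s}. if j \<in> {1..s} then u j else 0) = u"
    using u by (auto simp: space_euclid PiE_iff extensional_def fun_eq_iff)
  with part[of "{1..s}"] show "N u \<le> (\<Sum>k=1..s. N (?e k) * \<bar>u k\<bar>)" by simp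
qed

text \<open>
By the previous bound the norm is Lipschitz for a weighted \<open>L\<^sub>1\<close> distance. It lies below \<open>a\<close> at \<open>u\<close>
exactly if some rational point near \<open>u\<close> certifies this through the Lipschitz bound, which
writes the sublevel set as a countable union of measurable sets.
\<close>

lemma norm_borel_measurable:
  assumes "is_norm s N"
  shows "N \<in> borel_measurable (euclid s)"
  unfolding borel_measurable_iff_less
proof
  fix a :: real
  obtain c where c: "\<And>k. 0 \<le> c k" "\<And>u. u \<in> space (euclid s) \<Longrightarrow> N u \<le> (\<Sum>k=1..s. c k * \<bar>u k\<bar>)"
    using norm_le_weighted_l1[OF assms] by blast
  have lip: "N u \<le> N v + (\<Sum>k=1..s. c k * \<bar>u k - v k\<bar>)"
    if u: "u \<in> space (euclid s)" and v: "v \<in> space (euclid s)" for u v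
  proof -
    let ?w = "\<lambda>k\<in>{1..s}. u k - v k"
    have w: "?w \<in> space (euclid s)" by (simp add: space_euclid)
    have "u = vadd s v ?w"
      using u by (auto simp: space_euclid PiE_iff extensional_def fun_eq_iff vadd_def)
    then have "N u \<le> N v + N ?w" using assms v w unfolding is_norm_def by metis
    with c(2)[OF w] show ?thesis by simp
  qed
  define R where "R = {1..s} \<rightarrow>\<^sub>E (\<rat> :: real set)"
  have R: "countable R" unfolding R_def by (intro countable_PiE) (auto simp: countable_rat)
  have Rsp: "q \<in> space (euclid s)" if "q \<in> R" for q using that by (auto simp: R_def space_euclid)
  let ?S = "\<lambda>q. {u \<in> space (euclid s). N q + (\<Sum>k=1..s. c k * \<bar>u k - q k\<bar>) < a}"
  have "{u \<in> space (euclid s). N u < a} = (\<Union>q\<in>R. ?S q)"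
  proof (intro equalityI subsetI)
    fix u assume "u \<in> {u \<in> space (euclid s). N u < a}"
    then have u: "u \<in> space (euclid s)" "N u < a" by auto
    \<comment> \<open>Passing from \<open>u\<close> to the rational point and back costs the distance twice; the summand 1 keeps \<open>C\<close>
    positive and makes the final inequality strict.\<close>
    define C where "C = 1 + 2 * (\<Sum>k=1..s. c k)"
    have C: "0 < C" using c(1) by (simp add: C_def add_pos_nonneg sum_nonneg)
    define e where "e = (a - N u) / C"
    have e: "0 < e" using u C by (simp add: e_def)
    have "\<exists>q\<in>\<rat>. u k < q \<and> q < u k + e" for k using Rats_dense_in_real[of "u k" "u k + e"] e by simp
    then obtain q where q: "\<And>k. q k \<in> \<rat>" "\<And>k. u k < q k" "\<And>k. q k < u k + e" by metis
    let ?q = "restrict q {1..s}"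
    have qR: "?q \<in> R" using q by (simp add: R_def)
    have "(\<Sum>k=1..s. c k * \<bar>u k - ?q k\<bar>) \<le> (\<Sum>k=1..s. c k * e)"
    proof (intro sum_mono mult_left_mono c(1))
      fix k assume "k \<in> {1..s}"
      then show "\<bar>u k - ?q k\<bar> \<le> e" using q(2,3)[of k] by simp
    qed
    moreover have "(\<Sum>k=1..s. c k * \<bar>?q k - u k\<bar>) = (\<Sum>k=1..s. c k * \<bar>u k - ?q k\<bar>)"
      by (simp add: abs_minus_commute)
    ultimately have "N ?q + (\<Sum>k=1..s. c k * \<bar>u k - ?q k\<bar>) \<le> N u + 2 * (\<Sum>k=1..s. c k) * e"
      using lip[OF Rsp[OF qR] u(1)] by (simp only: sum_distrib_right[symmetric] mult.assoc)
    also have "\<dots> < N u + C * e" using e by (simp add: C_def)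
    also have "\<dots> = a" using C by (simp add: e_def)
    finally show "u \<in> (\<Union>q\<in>R. ?S q)" using qR u by blast
  next
    fix u assume "u \<in> (\<Union>q\<in>R. ?S q)"
    then obtain q where "q \<in> R" "u \<in> space (euclid s)" "N q + (\<Sum>k=1..s. c k * \<bar>u k - q k\<bar>) < a" by blast
    with lip[of u q] Rsp show "u \<in> {u \<in> space (euclid s). N u < a}" by force
  qed
  moreover have "?S q \<in> sets (euclid s)" for q
  proof -
    have [measurable]: "(\<lambda>u. u k) \<in> borel_measurable (euclid s)" if "k \<in> {1..s}" for k
      using that by (intro measurable_euclid_component) auto
    show ?thesis by measurable
  qed
  then have "(\<Union>q\<in>R. ?S q) \<in> sets (euclid s)" by (intro sets.countable_UN'[OF R]) blast
  ultimately show "{u \<in> space (euclid s). N u < a} \<in> sets (euclid s)" by (simp only:)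
qed

lemma norm_ball_measurable:
  "is_norm s N \<Longrightarrow> {u \<in> space (euclid s). N u \<le> 1} \<in> sets (euclid s)"
  using norm_borel_measurable[of s N] by measurable

lemma norm_ball_contains_cube:
  assumes "is_norm s N"
  obtains \<delta> where "0 < \<delta>" "\<And>u. u \<in> space (euclid s) \<Longrightarrow> (\<And>k. k \<in> {1..s} \<Longrightarrow> \<bar>u k\<bar> < \<delta>) \<Longrightarrow> N u \<le> 1"
proof -
  obtain c where c: "\<And>k. 0 \<le> c k" "\<And>u. u \<in> space (euclid s) \<Longrightarrow> N u \<le> (\<Sum>k=1..s. c k * \<bar>u k\<bar>)"
    using norm_le_weighted_l1[OF assms] by blast
  let ?C = "1 + (\<Sum>k=1..s. c k)"
  have C: "0 < ?C" using c(1) by (simp add: add_pos_nonneg sum_nonneg)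
  show thesis
  proof (rule that[of "1 / ?C"])
    fix u assume u: "u \<in> space (euclid s)" "\<And>k. k \<in> {1..s} \<Longrightarrow> \<bar>u k\<bar> < 1 / ?C"
    have "N u \<le> (\<Sum>k=1..s. c k * (1 / ?C))"
      using u by (intro order_trans[OF c(2)] sum_mono mult_left_mono c(1)) (auto intro: less_imp_le)
    also have "\<dots> = (\<Sum>k=1..s. c k) / ?C" by (simp add: sum_divide_distrib)
    also have "\<dots> \<le> 1" using C by simp
    finally show "N u \<le> 1" .
  qed (use C in simp)
qed

text \<open>
The autocorrelation of one kernel: \<open>overlap\<close> is the numerator of the correlation \<open>rho_block\<close>, and
\<open>energy\<close> is its denominator.
\<close>

locale square_integrable_kernel =
  fixes s :: nat and k :: "(nat \<Rightarrow> real) \<Rightarrow> real"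
  assumes pdf: "is_pdf (euclid s) k" and sq: "integrable (euclid s) (\<lambda>u. (k u)\<^sup>2)"
begin

lemma k: "integrable (euclid s) k" "(LINT u|euclid s. k u) = 1"
    "\<And>u. u \<in> space (euclid s) \<Longrightarrow> 0 \<le> k u"
  and k_measurable[measurable]: "k \<in> borel_measurable (euclid s)"
  using pdf by (auto simp: is_pdf_def has_bochner_integral_iff)

lemma vadd_space: "u \<in> space (euclid s) \<Longrightarrow> t \<in> space (euclid s) \<Longrightarrow> vadd s u t \<in> space (euclid s)"
  by (simp add: vadd_def space_euclid)

definition energy where "energy = (LINT u|euclid s. (k u)\<^sup>2)"

lemma L2_norm_sq: "(L2_norm_on (euclid s) k)\<^sup>2 = energy"
  by (simp add: L2_norm_on_def energy_def)

lemma energy_pos: "0 < energy"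
proof -
  have "energy \<noteq> 0"
  proof
    assume "energy = 0"
    then have "AE u in euclid s. (k u)\<^sup>2 = 0"
      using integral_nonneg_eq_0_iff_AE[OF sq] by (simp add: energy_def)
    then have "(LINT u|euclid s. k u) = (LINT u|euclid s. 0)"
      by (intro integral_cong_AE) auto
    with k(2) show False by simp
  qed
  moreover have "0 \<le> energy" by (simp add: energy_def)
  ultimately show ?thesis by simp
qed

definition overlap where "overlap t = (LINT u|euclid s. k u * k (vadd s u t))"

lemma rho_block_eq: "rho_block s k t = overlap t / energy"
  by (simp add: rho_block_def L2_norm_sq overlap_def)

text \<open>
The inequality \<open>2 k(u) k(u + t) \<le> k(u)\<^sup>2 + k(u + t)\<^sup>2\<close> and translation invariance.
\<close>

lemma overlap_bounds:
  assumes t: "t \<in> space (euclid s)"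
  shows "integrable (euclid s) (\<lambda>u. k u * k (vadd s u t))" and "overlap t \<le> energy" and "0 \<le> overlap t"
proof -
  note [measurable] = t
  have sq': "integrable (euclid s) (\<lambda>u. (k (vadd s u t))\<^sup>2)" "(LINT u|euclid s. (k (vadd s u t))\<^sup>2) = energy"
    using rescales_integral[OF rescales_vadd _ sq, of t] by (auto simp: energy_def)
  have le: "k u * k (vadd s u t) \<le> (1/2) * (k u)\<^sup>2 + (1/2) * (k (vadd s u t))\<^sup>2" for u
  proof -
    have "0 \<le> (k u - k (vadd s u t))\<^sup>2" by simp
    then show ?thesis by (simp add: power2_eq_square algebra_simps)
  qed
  have nn: "0 \<le> k u * k (vadd s u t)" if "u \<in> space (euclid s)" for u
    using that t by (intro mult_nonneg_nonneg k(3) vadd_space)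
  show i: "integrable (euclid s) (\<lambda>u. k u * k (vadd s u t))"
  proof (rule Bochner_Integration.integrable_bound)
    show "integrable (euclid s) (\<lambda>u. (1/2) * (k u)\<^sup>2 + (1/2) * (k (vadd s u t))\<^sup>2)" using sq sq' by simp
    show "AE u in euclid s. norm (k u * k (vadd s u t)) \<le> norm ((1/2) * (k u)\<^sup>2 + (1/2) * (k (vadd s u t))\<^sup>2)"
      using nn le by (intro AE_I2) simp
  qed measurable
  have "overlap t \<le> (LINT u|euclid s. (1/2) * (k u)\<^sup>2 + (1/2) * (k (vadd s u t))\<^sup>2)"
    unfolding overlap_def using i sq sq' le by (intro integral_mono) simp_all
  also have "\<dots> = energy" using sq sq' by (simp add: energy_def)
  finally show "overlap t \<le> energy" .
  show "0 \<le> overlap t" unfolding overlap_def using nn by (intro integral_nonneg_AE AE_I2)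
qed

lemma nn_overlap:
  assumes t: "t \<in> space (euclid s)"
  shows "ennreal (overlap t) = (\<integral>\<^sup>+u. ennreal (k u) * ennreal (k (vadd s u t)) \<partial>euclid s)"
proof -
  have "ennreal (overlap t) = (\<integral>\<^sup>+u. ennreal (k u * k (vadd s u t)) \<partial>euclid s)"
    unfolding overlap_def using overlap_bounds[OF t] t
    by (intro nn_integral_eq_integral[symmetric] AE_I2 mult_nonneg_nonneg k(3) vadd_space)
  then show ?thesis using t by (simp add: k(3) vadd_space ennreal_mult cong: nn_integral_cong_simp)
qed

lemma overlap_measurable[measurable]: "overlap \<in> borel_measurable (euclid s)"
  unfolding overlap_def by measurable

text \<open>
Fubini's theorem and the substitution \<open>v = u + t\<close>.
\<close>

lemma overlap_integral_eq:
  assumes [measurable]: "B \<in> sets (euclid s)"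
  shows "(\<integral>\<^sup>+t. indicator B t * ennreal (overlap t) \<partial>euclid s) =
    (\<integral>\<^sup>+u. (\<integral>\<^sup>+v. indicator B (scaled_diff s 1 v u) * (ennreal (k u) * ennreal (k v)) \<partial>euclid s) \<partial>euclid s)"
proof -
  interpret EE: pair_sigma_finite "euclid s" "euclid s" ..
  have "(\<integral>\<^sup>+t. indicator B t * ennreal (overlap t) \<partial>euclid s) =
      (\<integral>\<^sup>+t. (\<integral>\<^sup>+u. indicator B t * (ennreal (k u) * ennreal (k (vadd s u t))) \<partial>euclid s) \<partial>euclid s)"
  proof (intro nn_integral_cong)
    fix t assume t[measurable]: "t \<in> space (euclid s)"
    show "indicator B t * ennreal (overlap t) = (\<integral>\<^sup>+u. indicator B t * (ennreal (k u) * ennreal (k (vadd s u t))) \<partial>euclid s)"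
      unfolding nn_overlap[OF t] by (rule nn_integral_cmult[symmetric]) measurable
  qed
  also have "\<dots> = (\<integral>\<^sup>+u. (\<integral>\<^sup>+t. indicator B t * (ennreal (k u) * ennreal (k (vadd s u t))) \<partial>euclid s) \<partial>euclid s)"
    by (rule EE.Fubini'[symmetric]) measurable
  also have "\<dots> = (\<integral>\<^sup>+u. (\<integral>\<^sup>+v. indicator B (scaled_diff s 1 v u) * (ennreal (k u) * ennreal (k v)) \<partial>euclid s) \<partial>euclid s)"
  proof (rule nn_integral_cong)
    fix u assume u[measurable]: "u \<in> space (euclid s)"
    have "vadd s u (scaled_diff s 1 v u) = v" if "v \<in> space (euclid s)" for v
      using that by (auto simp: vadd_def scaled_diff_def space_euclid PiE_iff extensional_def fun_eq_iff)
    moreover have "(\<integral>\<^sup>+v. indicator B (scaled_diff s 1 v u) * (ennreal (k u) * ennreal (k (vadd s u (scaled_diff s 1 v u)))) \<partial>euclid s)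
        = (\<integral>\<^sup>+t. indicator B t * (ennreal (k u) * ennreal (k (vadd s u t))) \<partial>euclid s)"
      using rescales_nn_integral[OF euclid.sd_left[of 1 u s],
          of "\<lambda>t. indicator B t * (ennreal (k u) * ennreal (k (vadd s u t)))"] u by simp
    ultimately show "(\<integral>\<^sup>+t. indicator B t * (ennreal (k u) * ennreal (k (vadd s u t))) \<partial>euclid s) =
        (\<integral>\<^sup>+v. indicator B (scaled_diff s 1 v u) * (ennreal (k u) * ennreal (k v)) \<partial>euclid s)"
      by (simp cong: nn_integral_cong_simp)
  qed
  finally show ?thesis .
qed

lemma overlap_integrable: "integrable (euclid s) overlap"
proof (rule integrableI_nonneg)
  have k1: "(\<integral>\<^sup>+u. ennreal (k u) \<partial>euclid s) = 1"
    using k by (subst nn_integral_eq_integral) auto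
  have "(\<integral>\<^sup>+t. ennreal (overlap t) \<partial>euclid s) = (\<integral>\<^sup>+t. indicator (space (euclid s)) t * ennreal (overlap t) \<partial>euclid s)"
    by (intro nn_integral_cong) simp
  also have "\<dots> = (\<integral>\<^sup>+u. (\<integral>\<^sup>+v. indicator (space (euclid s)) (scaled_diff s 1 v u) * (ennreal (k u) * ennreal (k v)) \<partial>euclid s) \<partial>euclid s)"
    by (rule overlap_integral_eq) simp
  also have "\<dots> \<le> (\<integral>\<^sup>+u. (\<integral>\<^sup>+v. ennreal (k u) * ennreal (k v) \<partial>euclid s) \<partial>euclid s)"
    by (intro nn_integral_mono) (auto split: split_indicator)
  also have "\<dots> = 1" by (simp add: nn_integral_cmult nn_integral_multc k1)
  finally show "(\<integral>\<^sup>+t. ennreal (overlap t) \<partial>euclid s) < \<infinity>" by (auto intro: le_less_trans)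
qed (use overlap_bounds in auto)

text \<open>
If the integral vanished, \<open>k(u) k(v) = 0\<close> would hold for almost all \<open>u, v\<close> with \<open>v - u\<close> in the ball.
Divide the space into grid cells so small that differences within a cell lie in the ball. The square
of the integral of \<open>k\<close> over each cell is then 0; there are countably many cells, so \<open>k\<close> vanishes almost
everywhere, in contradiction to its integral being 1.
\<close>

lemma ball_overlap_pos:
  assumes N: "is_norm s N"
  shows "0 < (LINT t|euclid s. indicator {u \<in> space (euclid s). N u \<le> 1} t * overlap t)"
proof -
  let ?B = "{u \<in> space (euclid s). N u \<le> 1}"
  have B[measurable]: "?B \<in> sets (euclid s)" by (rule norm_ball_measurable[OF N])
  obtain \<delta> where \<delta>: "0 < \<delta>"
      "\<And>u. u \<in> space (euclid s) \<Longrightarrow> (\<And>k. k \<in> {1..s} \<Longrightarrow> \<bar>u k\<bar> < \<delta>) \<Longrightarrow> N u \<le> 1"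
    using norm_ball_contains_cube[OF N] by blast
  have "(\<integral>\<^sup>+t. indicator ?B t * ennreal (overlap t) \<partial>euclid s) \<noteq> 0"
  proof
    assume "(\<integral>\<^sup>+t. indicator ?B t * ennreal (overlap t) \<partial>euclid s) = 0"
    then have zero: "(\<integral>\<^sup>+u. (\<integral>\<^sup>+v. indicator ?B (scaled_diff s 1 v u) * (ennreal (k u) * ennreal (k v)) \<partial>euclid s) \<partial>euclid s) = 0"
      using overlap_integral_eq[OF B] by simp
    define cell where "cell c = {u \<in> space (euclid s). \<forall>j\<in>{1..s}. \<lfloor>u j / \<delta>\<rfloor> = c j}" for c
    have [measurable]: "(\<lambda>u. u j) \<in> borel_measurable (euclid s)" if "j \<in> {1..s}" for j
      using that by (intro measurable_euclid_component) auto
    have cell[measurable]: "cell c \<in> sets (euclid s)" for c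
      unfolding cell_def by measurable
    have close: "scaled_diff s 1 v u \<in> ?B" if "u \<in> cell c" "v \<in> cell c" for u v c
    proof -
      have "\<bar>v j - u j\<bar> < \<delta>" if "j \<in> {1..s}" for j
      proof -
        have "\<lfloor>u j / \<delta>\<rfloor> = \<lfloor>v j / \<delta>\<rfloor>" using \<open>u \<in> cell c\<close> \<open>v \<in> cell c\<close> that by (auto simp: cell_def)
        then have "\<bar>v j / \<delta> - u j / \<delta>\<bar> < 1" by linarith
        then have "\<bar>v j - u j\<bar> / \<delta> < 1" using \<delta>(1) by (simp add: diff_divide_distrib[symmetric] abs_divide)
        then show ?thesis using \<delta>(1) by simp
      qed
      then show ?thesis using \<delta>(2)[of "scaled_diff s 1 v u"] by (simp add: scaled_diff_def space_euclid)
    qed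
    \<comment> \<open>The square of the integral over a cell is an integral over pairs of points of the cell,
    whose differences lie in the ball.\<close>
    have cell0: "AE u in euclid s. u \<in> cell c \<longrightarrow> k u = 0" for c
    proof -
      let ?I = "\<integral>\<^sup>+u. indicator (cell c) u * ennreal (k u) \<partial>euclid s"
      have "?I * ?I = (\<integral>\<^sup>+u. (\<integral>\<^sup>+v. indicator (cell c) u * ennreal (k u) * (indicator (cell c) v * ennreal (k v)) \<partial>euclid s) \<partial>euclid s)"
        by (simp add: nn_integral_cmult nn_integral_multc)
      also have "\<dots> \<le> (\<integral>\<^sup>+u. (\<integral>\<^sup>+v. indicator ?B (scaled_diff s 1 v u) * (ennreal (k u) * ennreal (k v)) \<partial>euclid s) \<partial>euclid s)"
      proof (intro nn_integral_mono)
        fix u v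
        show "indicator (cell c) u * ennreal (k u) * (indicator (cell c) v * ennreal (k v)) \<le>
            indicator ?B (scaled_diff s 1 v u) * (ennreal (k u) * ennreal (k v))"
        proof (cases "u \<in> cell c \<and> v \<in> cell c")
          case True then have "scaled_diff s 1 v u \<in> ?B" using close by blast
          then show ?thesis using True by simp
        qed auto
      qed
      finally have "?I = 0" using zero by simp
      then have "AE u in euclid s. indicator (cell c) u * ennreal (k u) = 0"
        by (subst (asm) nn_integral_0_iff_AE) auto
      then show ?thesis
        by (rule AE_mp) (auto intro!: AE_I2 simp: k(3) antisym)
    qed
    define Z where "Z = {1..s} \<rightarrow>\<^sub>E (UNIV :: int set)"
    have Z: "countable Z" unfolding Z_def by (intro countable_PiE) auto
    have "AE u in euclid s. \<forall>c\<in>Z. u \<in> cell c \<longrightarrow> k u = 0"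
      unfolding AE_ball_countable[OF Z] using cell0 by blast
    moreover have "\<exists>c\<in>Z. u \<in> cell c" if "u \<in> space (euclid s)" for u
      using that by (intro bexI[of _ "\<lambda>j\<in>{1..s}. \<lfloor>u j / \<delta>\<rfloor>"]) (auto simp: cell_def Z_def)
    ultimately have "AE u in euclid s. k u = 0"
      by (auto elim!: AE_mp intro!: AE_I2)
    then have "(LINT u|euclid s. k u) = (LINT u|euclid s. 0)" by (intro integral_cong_AE) auto
    then show False using k(2) by simp
  qed
  moreover have "(\<integral>\<^sup>+t. indicator ?B t * ennreal (overlap t) \<partial>euclid s) = ennreal (LINT t|euclid s. indicator ?B t * overlap t)"
  proof -
    have i: "integrable (euclid s) (\<lambda>t. indicator ?B t * overlap t)"
      using integrable_real_mult_indicator[OF B overlap_integrable] by (simp add: mult.commute)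
    have "(\<integral>\<^sup>+t. indicator ?B t * ennreal (overlap t) \<partial>euclid s) = (\<integral>\<^sup>+t. ennreal (indicator ?B t * overlap t) \<partial>euclid s)"
      by (intro nn_integral_cong) (auto split: split_indicator)
    also have "\<dots> = ennreal (LINT t|euclid s. indicator ?B t * overlap t)"
      using overlap_bounds(3) by (intro nn_integral_eq_integral[OF i] AE_I2) auto
    finally show ?thesis .
  qed
  ultimately show ?thesis by (metis ennreal_neg not_less)
qed

end

text \<open>
The integrand vanishes only where the correlation does. If it vanished almost everywhere on the
product of the balls, the product of the block correlations would have integral 0 there; but this
integral factorises into positive integrals over the single balls.
\<close>

lemma sigma2_pos:
  assumes nrm: "\<And>s. is_norm s (nrm s)"
    and pdf: "\<And>l. l \<in> {1..p} \<Longrightarrow> is_pdf (euclid (d l)) (K l)"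
    and sq: "\<And>l. l \<in> {1..p} \<Longrightarrow> integrable (euclid (d l)) (\<lambda>u. (K l u)\<^sup>2)"
  shows "0 < sigma2 p d nrm K"
proof -
  interpret product_sigma_finite "\<lambda>l. euclid (d l)" by (rule product_sigma_finite_euclid)
  have ker: "square_integrable_kernel (d l) (K l)" if "l \<in> {1..p}" for l
    using pdf[OF that] sq[OF that] by unfold_locales
  let ?\<kappa> = "\<lambda>l. square_integrable_kernel.energy (d l) (K l)" and ?R = "\<lambda>l. square_integrable_kernel.overlap (d l) (K l)"
  let ?r = "\<lambda>l. rho_block (d l) (K l)"
  have \<kappa>: "0 < ?\<kappa> l" if "l \<in> {1..p}" for l
    using square_integrable_kernel.energy_pos[OF ker[OF that]] .
  have r_eq: "?r l t = ?R l t / ?\<kappa> l" if "l \<in> {1..p}" for l t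
    using square_integrable_kernel.rho_block_eq[OF ker[OF that]] .
  have K_tilde: "0 < K_tilde p d K"
    unfolding K_tilde_def using \<kappa> by (intro prod_pos) (simp add: square_integrable_kernel.L2_norm_sq[OF ker])
  have r01: "0 \<le> ?r l t \<and> ?r l t \<le> 1" if "l \<in> {1..p}" "t \<in> space (euclid (d l))" for l t
    using square_integrable_kernel.overlap_bounds(2,3)[OF ker[OF that(1)] that(2)] \<kappa>[OF that(1)]
    by (simp add: r_eq[OF that(1)])
  have r_int: "integrable (euclid (d l)) (?r l)" if "l \<in> {1..p}" for l
    using square_integrable_kernel.overlap_integrable[OF ker[OF that]] by (simp add: r_eq[OF that, abs_def])
  let ?B = "\<lambda>l. {u \<in> space (euclid (d l)). nrm (d l) u \<le> 1}"
  have Bm: "?B l \<in> sets (euclid (d l))" for l by (rule norm_ball_measurable[OF nrm])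
  have BB[measurable]: "ball_blocks p d nrm \<in> sets (blocks p d)"
    unfolding ball_blocks_def blocks_def using Bm by (intro sets_PiM_I_finite) auto
  let ?\<rho> = "rho p d K" and ?N = "blocks p d"
  have \<rho>01: "0 \<le> ?\<rho> t" "?\<rho> t \<le> 1" if t: "t \<in> space ?N" for t
  proof -
    have "t l \<in> space (euclid (d l))" if "l \<in> {1..p}" for l using t that by (auto simp: space_blocks)
    then show "0 \<le> ?\<rho> t" "?\<rho> t \<le> 1"
      unfolding rho_def using r01 by (auto intro!: prod_nonneg prod_le_1)
  qed
  have \<rho>_int: "integrable ?N ?\<rho>"
    unfolding rho_def[abs_def] blocks_def using r_int by (intro product_integrable_prod) auto
  have [measurable]: "?\<rho> \<in> borel_measurable ?N" using \<rho>_int by auto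
  obtain b where b: "\<And>r. 0 \<le> r \<Longrightarrow> r \<le> 1 \<Longrightarrow> 0 \<le> normal_abs_cov r \<and> normal_abs_cov r \<le> b * r"
    using normal_abs_cov_le by blast
  let ?G = "\<lambda>t. indicator (ball_blocks p d nrm) t * normal_abs_cov (?\<rho> t)"
  have G0: "0 \<le> ?G t" if "t \<in> space ?N" for t using b[OF \<rho>01[OF that]] by simp
  have iG: "integrable ?N ?G"
  proof (rule Bochner_Integration.integrable_bound)
    show "integrable ?N (\<lambda>t. b * ?\<rho> t)" using \<rho>_int by simp
    show "AE t in ?N. norm (?G t) \<le> norm (b * ?\<rho> t)"
    proof (rule AE_I2)
      fix t assume "t \<in> space ?N"
      from b[OF \<rho>01[OF this]] show "norm (?G t) \<le> norm (b * ?\<rho> t)"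
        by (auto split: split_indicator)
    qed
  qed measurable
  have "(LINT t|?N. ?G t) \<noteq> 0"
  proof
    assume "(LINT t|?N. ?G t) = 0"
    then have "AE t in ?N. ?G t = 0"
      using integral_nonneg_eq_0_iff_AE[OF iG] G0 by simp
    then have "AE t in ?N. (\<Prod>l=1..p. indicator (?B l) (t l) * ?r l (t l)) = 0"
    proof (rule AE_mp, intro AE_I2 impI)
      fix t assume t: "t \<in> space ?N" and G: "?G t = 0"
      have "(\<Prod>l=1..p. indicator (?B l) (t l) * ?r l (t l)) = indicator (ball_blocks p d nrm) t * ?\<rho> t"
      proof -
        have "(\<Prod>l=1..p. indicator (?B l) (t l) :: real) = indicator (ball_blocks p d nrm) t"
          using t by (auto simp: ball_blocks_def space_blocks PiE_iff indicator_def intro!: prod_zero)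
        then show ?thesis by (simp only: prod.distrib rho_def)
      qed
      also have "\<dots> = 0"
        using G \<rho>01[OF t] normal_abs_cov_pos[of "?\<rho> t"] by (cases "?\<rho> t = 0") auto
      finally show "(\<Prod>l=1..p. indicator (?B l) (t l) * ?r l (t l)) = 0" .
    qed
    then have "(LINT t|?N. (\<Prod>l=1..p. indicator (?B l) (t l) * ?r l (t l))) = 0"
      by (rule integral_eq_zero_AE)
    moreover have "(LINT t|?N. (\<Prod>l=1..p. indicator (?B l) (t l) * ?r l (t l))) =
        (\<Prod>l=1..p. LINT t|euclid (d l). indicator (?B l) t * ?r l t)"
      unfolding blocks_def
    proof (rule product_integral_prod)
      fix l assume l: "l \<in> {1..p}"
      show "integrable (euclid (d l)) (\<lambda>t. indicator (?B l) t * ?r l t)"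
        using integrable_real_mult_indicator[OF Bm r_int[OF l]] by (simp add: mult.commute)
    qed simp
    moreover have "0 < (\<Prod>l=1..p. LINT t|euclid (d l). indicator (?B l) t * ?r l t)"
    proof (rule prod_pos)
      fix l assume l: "l \<in> {1..p}"
      from square_integrable_kernel.ball_overlap_pos[OF ker[OF l] nrm] \<kappa>[OF l]
      show "0 < (LINT t|euclid (d l). indicator (?B l) t * ?r l t)"
        by (simp add: r_eq[OF l])
    qed
    ultimately show False by linarith
  qed
  moreover have "0 \<le> (LINT t|?N. ?G t)" using G0 by (intro integral_nonneg_AE AE_I2)
  moreover have "sigma2 p d nrm K = K_tilde p d K * (LINT t|?N. ?G t)"
    by (simp add: sigma2_def set_lebesgue_integral_def normal_abs_cov_def)
  ultimately show ?thesis using K_tilde by simp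
qed

section \<open>The centering term and the integrated error on a fixed sample\<close>

lemma is_pdfD:
  assumes "is_pdf N g"
  shows "integrable N g" "(LINT x|N. g x) = 1" "\<And>x. x \<in> space N \<Longrightarrow> 0 \<le> g x"
    "g \<in> borel_measurable N" "(\<integral>\<^sup>+x. ennreal (g x) \<partial>N) = 1"
proof -
  show 1: "integrable N g" "(LINT x|N. g x) = 1" "\<And>x. x \<in> space N \<Longrightarrow> 0 \<le> g x"
    using assms by (auto simp: is_pdf_def has_bochner_integral_iff)
  then show "g \<in> borel_measurable N" by auto
  show "(\<integral>\<^sup>+x. ennreal (g x) \<partial>N) = 1"
    using 1 by (subst nn_integral_eq_integral) auto
qed

text \<open>
The condition \<open>distributed\<close> speaks about the density as an extended nonnegative function; the real
density is recovered from it because it is nonnegative on the space.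
\<close>

lemma (in prob_space) has_density_is_pdf:
  assumes "has_density M N Y g"
  shows "is_pdf N g" and "distr M N Y = density N (\<lambda>x. ennreal (g x))" and "Y \<in> measurable M N"
proof -
  have g0: "\<And>x. x \<in> space N \<Longrightarrow> 0 \<le> g x" and dis: "distributed M N Y (\<lambda>x. ennreal (g x))"
    using assms by (auto simp: has_density_def)
  show "distr M N Y = density N (\<lambda>x. ennreal (g x))" and Y[measurable]: "Y \<in> measurable M N"
    using dis by (auto simp: distributed_def)
  have [measurable]: "(\<lambda>x. ennreal (g x)) \<in> borel_measurable N" using dis by (auto simp: distributed_def)
  have "(\<lambda>x. enn2real (ennreal (g x))) \<in> borel_measurable N" by measurable
  then have [measurable]: "g \<in> borel_measurable N"
    by (rule measurable_cong[THEN iffD1, rotated]) (simp add: g0)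
  have "(\<integral>\<^sup>+x. ennreal (g x) \<partial>N) = emeasure (density N (\<lambda>x. ennreal (g x))) (space N)"
    by (subst emeasure_density) (auto intro!: nn_integral_cong)
  also have "\<dots> = emeasure (distr M N Y) (space N)" using dis by (simp add: distributed_def)
  also have "\<dots> = 1"
    using prob_space.emeasure_space_1[OF prob_space_distr[OF Y]] by simp
  finally have "(\<integral>\<^sup>+x. ennreal (g x) \<partial>N) = ennreal 1" by simp
  then show "is_pdf N g"
    using g0 by (auto simp: is_pdf_def intro!: has_bochner_integral_nn_integral)
qed

lemma v_hat_nonneg: "0 < b \<Longrightarrow> 0 \<le> v_hat s k b n Y x"
  by (auto simp: v_hat_def intro!: divide_nonneg_nonneg sum_nonneg mult_nonneg_nonneg)

text \<open>
The sum over \<open>i \<noteq> j\<close> is \<open>(\<Sum> a\<^sub>i)\<^sup>2 - \<Sum> a\<^sub>i\<^sup>2\<close>, at most \<open>(n - 1) \<Sum> a\<^sub>i\<^sup>2\<close> by the Cauchy-Schwarz inequality.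
\<close>

lemma g_hat_bounds:
  assumes k: "\<And>u. u \<in> space (euclid s) \<Longrightarrow> 0 \<le> k u" and b: "0 < b" and n: "2 \<le> n"
  shows "0 \<le> g_hat s k b n Y x" and "g_hat s k b n Y x \<le> v_hat s k b n Y x"
proof -
  define a where "a i = k (scaled_diff s b x (Y i))" for i
  have a: "0 \<le> a i" for i unfolding a_def by (rule k) (simp add: scaled_diff_def space_euclid)
  have den: "0 < real n * (real n - 1) * b ^ (2 * s)" using b n by simp
  show "0 \<le> g_hat s k b n Y x"
    unfolding g_hat_def a_def[symmetric] using den a
    by (intro divide_nonneg_nonneg sum_nonneg mult_nonneg_nonneg less_imp_le[OF den])
  have "(\<Sum>i=1..n. \<Sum>j\<in>{1..n} - {i}. a i * a j) = (\<Sum>i=1..n. (\<Sum>j=1..n. a i * a j) - (a i)\<^sup>2)"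
    by (intro sum.cong refl) (simp add: sum_diff1 power2_eq_square)
  also have "\<dots> = (\<Sum>i=1..n. a i)\<^sup>2 - (\<Sum>i=1..n. (a i)\<^sup>2)"
    by (simp add: sum_subtractf power2_eq_square sum_product)
  also have "\<dots> \<le> (real n - 1) * (\<Sum>i=1..n. (a i)\<^sup>2)"
    using sum_squared_le_sum_of_squares[of a "{1..n}"] by (simp add: algebra_simps)
  finally have "g_hat s k b n Y x \<le> ((real n - 1) * (\<Sum>i=1..n. (a i)\<^sup>2)) / (real n * (real n - 1) * b ^ (2 * s))"
    unfolding g_hat_def a_def[symmetric] using den by (intro divide_right_mono) auto
  also have "\<dots> = v_hat s k b n Y x"
    unfolding v_hat_def a_def[symmetric] using n by simp
  finally show "g_hat s k b n Y x \<le> v_hat s k b n Y x" .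
qed

lemma L_hat_le:
  assumes K: "\<And>l u. l \<in> {1..p} \<Longrightarrow> u \<in> space (euclid (d l)) \<Longrightarrow> 0 \<le> K l u"
    and b: "0 < b" and n: "2 \<le> n" and p: "1 \<le> p"
  shows "L_hat p d K b n Y x \<le> real p * (\<Prod>l=1..p. v_hat (d l) (K l) b n (\<lambda>i. Y i l) (x l))"
proof -
  define v where "v l = v_hat (d l) (K l) b n (\<lambda>i. Y i l) (x l)" for l
  define g where "g l = g_hat (d l) (K l) b n (\<lambda>i. Y i l) (x l)" for l
  have g: "0 \<le> g l" "g l \<le> v l" if "l \<in> {1..p}" for l
    unfolding g_def v_def using g_hat_bounds[of "d l" "K l"] K[OF that] b n by auto
  have v: "0 \<le> v l" for l unfolding v_def using b by (rule v_hat_nonneg)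
  have "0 \<le> (\<Sum>l=1..p. v l * (\<Prod>j\<in>{1..p} - {l}. g j))"
    using v g by (intro sum_nonneg mult_nonneg_nonneg prod_nonneg) auto
  moreover have "(real p - 1) * (\<Prod>l=1..p. g l) \<le> (real p - 1) * (\<Prod>l=1..p. v l)"
    using p g by (intro mult_left_mono prod_mono) auto
  moreover have "L_hat p d K b n Y x = (\<Prod>l=1..p. v l) - (\<Sum>l=1..p. v l * (\<Prod>j\<in>{1..p} - {l}. g j))
      + (real p - 1) * (\<Prod>l=1..p. g l)"
    unfolding L_hat_def v_def g_def by (simp add: Let_def)
  ultimately have "L_hat p d K b n Y x \<le> real p * (\<Prod>l=1..p. v l)" by (simp add: algebra_simps)
  then show ?thesis by (simp add: v_def)
qed

lemma v_hat_integral: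
  assumes sq: "integrable (euclid s) (\<lambda>u. (k u)\<^sup>2)" and b: "0 < b" and n: "1 \<le> n"
    and Y: "\<And>i. i \<in> {1..n} \<Longrightarrow> Y i \<in> space (euclid s)"
  shows "integrable (euclid s) (v_hat s k b n Y)"
    and "(LINT x|euclid s. v_hat s k b n Y x) = (L2_norm_on (euclid s) k)\<^sup>2 / b ^ s"
proof -
  have i: "integrable (euclid s) (\<lambda>x. (k (scaled_diff s b x (Y i)))\<^sup>2)"
    "(LINT x|euclid s. (k (scaled_diff s b x (Y i)))\<^sup>2) = b ^ s * (L2_norm_on (euclid s) k)\<^sup>2"
    if "i \<in> {1..n}" for i
    using rescales_integral[OF euclid.sd_left[OF b Y[OF that]] _ sq] b by (auto simp: L2_norm_on_def)
  show "integrable (euclid s) (v_hat s k b n Y)"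
    unfolding v_hat_def[abs_def] using i by (intro integrable_divide Bochner_Integration.integrable_sum)
  have "(LINT x|euclid s. v_hat s k b n Y x) = (\<Sum>i=1..n. b ^ s * (L2_norm_on (euclid s) k)\<^sup>2) / (real n * b ^ (2 * s))"
    unfolding v_hat_def[abs_def] integral_divide_zero using i by (subst Bochner_Integration.integral_sum) auto
  also have "\<dots> = (L2_norm_on (euclid s) k)\<^sup>2 / b ^ s"
    using b n by (simp add: power_mult power2_eq_square mult.commute[of 2])
  finally show "(LINT x|euclid s. v_hat s k b n Y x) = (L2_norm_on (euclid s) k)\<^sup>2 / b ^ s" .
qed

text \<open>
Bound \<open>sqrt w\<close> by \<open>\<epsilon> / 2 + w / (2 \<epsilon>)\<close> with \<open>w = p * \<Prod> v_hat\<close>. The integral of \<open>w\<close> is of order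
\<open>b^(- d)\<close>, so \<open>\<epsilon> = b^(- d / 2)\<close> balances the two terms. A negative value of \<open>L_hat\<close> has a
nonpositive root and only decreases the left-hand side.
\<close>

lemma a_center_le:
  assumes K: "\<And>l. l \<in> {1..p} \<Longrightarrow> is_pdf (euclid (d l)) (K l)"
    and sq: "\<And>l. l \<in> {1..p} \<Longrightarrow> integrable (euclid (d l)) (\<lambda>u. (K l u)\<^sup>2)"
    and b: "0 < b" and n: "2 \<le> n" and p: "1 \<le> p"
    and Y: "\<And>i. i \<in> {1..n} \<Longrightarrow> Y i \<in> space (blocks p d)"
    and D: "D \<in> sets (blocks p d)" "emeasure (blocks p d) D < \<infinity>"
  shows "a_center p d K b n Y D \<le> (LINT z|std_normal_distribution. \<bar>z\<bar>) *
    ((measure (blocks p d) D + real p * K_tilde p d K) / 2 / sqrt (b ^ (\<Sum>l=1..p. d l)))"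
  unfolding a_center_def
proof (rule mult_left_mono)
  interpret product_sigma_finite "\<lambda>l. euclid (d l)" by (rule product_sigma_finite_euclid)
  let ?N = "blocks p d"
  let ?v = "\<lambda>l. v_hat (d l) (K l) b n (\<lambda>i. Y i l)"
  let ?V = "\<lambda>x. \<Prod>l=1..p. ?v l (x l)"
  define B where "B = b ^ (\<Sum>l=1..p. d l)"
  have B: "0 < B" using b by (simp add: B_def)
  have Yl: "Y i l \<in> space (euclid (d l))" if "i \<in> {1..n}" "l \<in> {1..p}" for i l
    using Y[OF that(1)] that(2) by (auto simp: space_blocks)
  have v: "integrable (euclid (d l)) (?v l)" "(LINT x|euclid (d l). ?v l x) = (L2_norm_on (euclid (d l)) (K l))\<^sup>2 / b ^ d l"
    if "l \<in> {1..p}" for l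
    using v_hat_integral[OF sq[OF that] b, of n "\<lambda>i. Y i l"] n Yl that by auto
  have iV: "integrable ?N ?V" unfolding blocks_def using v by (intro product_integrable_prod) auto
  have V: "(LINT x|?N. ?V x) = K_tilde p d K / B"
  proof -
    have "(LINT x|?N. ?V x) = (\<Prod>l=1..p. (L2_norm_on (euclid (d l)) (K l))\<^sup>2 / b ^ d l)"
      unfolding blocks_def using v by (subst product_integral_prod) auto
    then show ?thesis by (simp add: prod_dividef K_tilde_def B_def power_sum)
  qed
  have V0: "0 \<le> ?V x" for x using b by (intro prod_nonneg v_hat_nonneg)
  define \<epsilon> where "\<epsilon> = 1 / sqrt B"
  have e: "0 < \<epsilon>" using B by (simp add: \<epsilon>_def)
  let ?g = "\<lambda>x. \<epsilon> / 2 * indicator D x + p / (2 * \<epsilon>) * ?V x"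
  have iD: "integrable ?N (indicator D :: _ \<Rightarrow> real)" using D by (simp add: integrable_indicator_iff)
  have "(LINT x:D|?N. sqrt (L_hat p d K b n Y x)) \<le> (LINT x|?N. ?g x)"
    unfolding set_lebesgue_integral_def
  proof (rule integral_mono')
    show "integrable ?N ?g" using iD iV by simp
    show "0 \<le> ?g x" for x using V0 e by (intro add_nonneg_nonneg mult_nonneg_nonneg) auto
    show "indicator D x *\<^sub>R sqrt (L_hat p d K b n Y x) \<le> ?g x" for x
    proof (cases "x \<in> D")
      case True
      let ?w = "real p * ?V x"
      have w: "0 \<le> ?w" using V0 by simp
      have "sqrt (L_hat p d K b n Y x) \<le> sqrt ?w"
        using L_hat_le[of p d K b n Y x] K b n p by (auto simp: is_pdf_def)
      also have "\<dots> \<le> \<epsilon> / 2 + ?w / (2 * \<epsilon>)"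
      proof -
        have "0 \<le> (sqrt ?w - \<epsilon>)\<^sup>2" by simp
        then have "2 * \<epsilon> * sqrt ?w \<le> \<epsilon> * \<epsilon> + ?w"
          using real_sqrt_pow2[OF w] by (simp add: power2_diff) (simp add: power2_eq_square algebra_simps)
        then have "sqrt ?w \<le> (\<epsilon> * \<epsilon> + ?w) / (2 * \<epsilon>)" using e by (simp add: pos_le_divide_eq mult.commute)
        also have "\<dots> = \<epsilon> / 2 + ?w / (2 * \<epsilon>)" using e by (simp add: add_divide_distrib)
        finally show ?thesis .
      qed
      finally show ?thesis using True by simp
    next
      case False then show ?thesis using V0[of x] e by simp
    qed
  qed
  also have "\<dots> = \<epsilon> / 2 * measure ?N D + p / (2 * \<epsilon>) * (K_tilde p d K / B)"
    using iD iV D V by (simp add: sets.Int_space_eq2 Int_absorb2 sets.sets_into_space)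
  also have "\<dots> = (measure ?N D + real p * K_tilde p d K) / 2 / sqrt B"
  proof -
    have "sqrt B * sqrt B = B" using B by simp
    then have "1 / \<epsilon> / B = 1 / sqrt B" using B by (simp add: \<epsilon>_def divide_simps)
    then have "p / (2 * \<epsilon>) * (K_tilde p d K / B) = real p * K_tilde p d K / 2 / sqrt B"
      by (metis (no_types, opaque_lifting) divide_divide_eq_left mult.commute times_divide_eq_left times_divide_eq_right mult_1)
    then show ?thesis by (simp add: \<epsilon>_def add_divide_distrib)
  qed
  finally show "(LINT x:D|?N. sqrt (L_hat p d K b n Y x)) \<le>
      (measure ?N D + real p * K_tilde p d K) / 2 / sqrt (b ^ (\<Sum>l=1..p. d l))"
    by (simp add: B_def)
qed simp

text \<open>
The sets \<open>A l\<close> will be cubes that contain the projections of the domain of integration.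
\<close>

definition estimation_error ::
  "nat \<Rightarrow> (nat \<Rightarrow> nat) \<Rightarrow> (nat \<Rightarrow> (nat \<Rightarrow> real) \<Rightarrow> real) \<Rightarrow> ((nat \<Rightarrow> nat \<Rightarrow> real) \<Rightarrow> real)
    \<Rightarrow> (nat \<Rightarrow> (nat \<Rightarrow> real) \<Rightarrow> real) \<Rightarrow> (nat \<Rightarrow> (nat \<Rightarrow> real) set) \<Rightarrow> real \<Rightarrow> nat
    \<Rightarrow> (nat \<Rightarrow> nat \<Rightarrow> nat \<Rightarrow> real) \<Rightarrow> ennreal" where
  "estimation_error p d K f fl A b n Y =
     (\<integral>\<^sup>+x\<in>(\<Pi>\<^sub>E l\<in>{1..p}. A l). ennreal \<bar>f_joint p d K b n Y x - f x\<bar> \<partial>blocks p d) +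
     (\<Sum>l=1..p. \<integral>\<^sup>+x\<in>A l. ennreal \<bar>f_marg (d l) (K l) b n (\<lambda>i. Y i l) x - fl l x\<bar> \<partial>euclid (d l))"

text \<open>
Compare \<open>f - \<Prod> f\<^sub>l\<close> with its empirical version: the error is at most that of the joint estimator plus
that of the product of the marginal estimators. In the latter all factors are probability densities,
so the telescoping bound applies with the constant 1.
\<close>

lemma V_pop_le:
  assumes K: "\<And>l. l \<in> {1..p} \<Longrightarrow> is_pdf (euclid (d l)) (K l)"
    and f: "is_pdf (blocks p d) f" and fl: "\<And>l. l \<in> {1..p} \<Longrightarrow> is_pdf (euclid (d l)) (fl l)"
    and b: "0 < b" and n: "1 \<le> n"
    and Y: "\<And>i. i \<in> {1..n} \<Longrightarrow> Y i \<in> space (blocks p d)"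
    and D: "D \<in> sets (blocks p d)" "D \<subseteq> (\<Pi>\<^sub>E l\<in>{1..p}. A l)"
    and A: "\<And>l. l \<in> {1..p} \<Longrightarrow> A l \<in> sets (euclid (d l))"
  shows "ennreal (V_pop p d f fl D) \<le> ennreal (V_emp p d K b n Y D) + estimation_error p d K f fl A b n Y"
proof -
  interpret product_sigma_finite "\<lambda>l. euclid (d l)" by (rule product_sigma_finite_euclid)
  let ?N = "blocks p d" and ?A = "\<Pi>\<^sub>E l\<in>{1..p}. A l"
  let ?fn = "f_joint p d K b n Y" and ?fnl = "\<lambda>l. f_marg (d l) (K l) b n (\<lambda>i. Y i l)"
  have Yl: "Y i l \<in> space (euclid (d l))" if "i \<in> {1..n}" "l \<in> {1..p}" for i l
    using Y[OF that(1)] that(2) by (auto simp: space_blocks)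
  have Am: "?A \<in> sets ?N" unfolding blocks_def using A by (intro sets_PiM_I_finite) auto
  note J = joint_kernel_pdf[of p d K, OF K]
  note fD = is_pdfD[OF f]
  note flD = is_pdfD[OF fl]
  have fnm[measurable]: "?fn \<in> borel_measurable ?N" and fn_nn: "\<And>x. x \<in> space ?N \<Longrightarrow> 0 \<le> ?fn x"
    and fn1: "(\<integral>\<^sup>+x. ennreal (?fn x) \<partial>?N) = 1"
  proof -
    have Jm: "joint_kernel p K \<in> borel_measurable ?N" using J(1) by auto
    show "?fn \<in> borel_measurable ?N"
      unfolding f_joint_eq_kde[abs_def] using Jm Y by (intro blocks.kde_measurable) auto
    show "0 \<le> ?fn x" if x: "x \<in> space ?N" for x
    proof -
      have "block_diff p d b x (Y i) \<in> space ?N" for i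
        by (simp add: block_diff_def space_blocks scaled_diff_def space_euclid)
      then show ?thesis unfolding f_joint_eq_kde blocks.kde_def using b J(3)
        by (intro divide_nonneg_nonneg sum_nonneg) auto
    qed
    show "(\<integral>\<^sup>+x. ennreal (?fn x) \<partial>?N) = 1"
      unfolding f_joint_eq_kde using J Y b n by (intro blocks.kde_nn_integral) auto
  qed
  have fnl: "?fnl l \<in> borel_measurable (euclid (d l))" "(\<integral>\<^sup>+x. ennreal (?fnl l x) \<partial>euclid (d l)) = 1"
    "\<And>x. 0 \<le> ?fnl l x" if l: "l \<in> {1..p}" for l
  proof -
    note KD = is_pdfD[OF K[OF l]]
    show "?fnl l \<in> borel_measurable (euclid (d l))"
      unfolding f_marg_eq_kde[abs_def] using KD Yl l by (intro euclid.kde_measurable) auto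
    show "(\<integral>\<^sup>+x. ennreal (?fnl l x) \<partial>euclid (d l)) = 1"
      unfolding f_marg_eq_kde using KD Yl l b n by (intro euclid.kde_nn_integral) auto
    have "0 \<le> K l (scaled_diff (d l) b x (Y i l))" for x i
      by (rule KD(3)) (simp add: scaled_diff_def space_euclid)
    then show "0 \<le> ?fnl l x" for x unfolding f_marg_def using b
      by (intro divide_nonneg_nonneg sum_nonneg) auto
  qed
  have i_fn: "integrable ?N ?fn"
    using fn1 fn_nn by (intro integrableI_nonneg AE_I2) auto
  have i_fnl: "integrable (euclid (d l)) (?fnl l)" if "l \<in> {1..p}" for l
    using fnl[OF that] by (intro integrableI_nonneg AE_I2) auto
  let ?P = "\<lambda>x. \<Prod>l=1..p. ?fnl l (x l)" and ?Q = "\<lambda>x. \<Prod>l=1..p. fl l (x l)"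
  have i_P: "integrable ?N ?P" and i_Q: "integrable ?N ?Q"
    unfolding blocks_def using i_fnl flD(1) by (auto intro!: product_integrable_prod)
  have meas: "?P \<in> borel_measurable ?N" "?Q \<in> borel_measurable ?N" "f \<in> borel_measurable ?N"
    "D \<in> sets ?N" "?A \<in> sets ?N"
    using i_P i_Q fD D Am by auto
  have split: "(\<integral>\<^sup>+x. ennreal \<bar>a x - b x\<bar> * indicator D x + (ennreal \<bar>a x - c x\<bar> * indicator ?A x +
      ennreal \<bar>b x - e x\<bar> * indicator D x) \<partial>?N) = (\<integral>\<^sup>+x\<in>D. ennreal \<bar>a x - b x\<bar> \<partial>?N) +
      ((\<integral>\<^sup>+x\<in>?A. ennreal \<bar>a x - c x\<bar> \<partial>?N) + (\<integral>\<^sup>+x\<in>D. ennreal \<bar>b x - e x\<bar> \<partial>?N))"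
    if "a \<in> borel_measurable ?N" "b \<in> borel_measurable ?N" "c \<in> borel_measurable ?N" "e \<in> borel_measurable ?N" for a b c e
    using that meas(4,5) by (simp add: nn_integral_add)
  have set_nn: "ennreal (LINT x:D|?N. \<bar>u x - w x\<bar>) = (\<integral>\<^sup>+x\<in>D. ennreal \<bar>u x - w x\<bar> \<partial>?N)"
    if "integrable ?N u" "integrable ?N w" for u w
  proof -
    have "integrable ?N (\<lambda>x. \<bar>u x - w x\<bar> * indicator D x)"
      using that D(1) by (intro integrable_real_mult_indicator) auto
    then have "ennreal (LINT x|?N. \<bar>u x - w x\<bar> * indicator D x) = (\<integral>\<^sup>+x. ennreal (\<bar>u x - w x\<bar> * indicator D x) \<partial>?N)"
      by (intro nn_integral_eq_integral[symmetric]) auto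
    then show ?thesis
      by (simp add: set_lebesgue_integral_def mult.commute[of "indicator D _"] ennreal_mult ennreal_indicator)
  qed
  have marg: "(\<integral>\<^sup>+x\<in>D. ennreal \<bar>?P x - ?Q x\<bar> \<partial>?N) \<le>
      (\<Sum>l=1..p. \<integral>\<^sup>+x\<in>A l. ennreal \<bar>?fnl l x - fl l x\<bar> \<partial>euclid (d l))"
  proof -
    let ?a = "\<lambda>l x. indicator (A l) x * ?fnl l x" and ?b = "\<lambda>l x. indicator (A l) x * fl l x"
    have "(\<integral>\<^sup>+x\<in>D. ennreal \<bar>?P x - ?Q x\<bar> \<partial>?N) \<le> L1_dist ?N (\<lambda>x. \<Prod>l=1..p. ?a l (x l)) (\<lambda>x. \<Prod>l=1..p. ?b l (x l))"
      unfolding L1_dist_def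
    proof (intro nn_integral_mono)
      fix x
      show "ennreal \<bar>?P x - ?Q x\<bar> * indicator D x \<le> ennreal \<bar>(\<Prod>l=1..p. ?a l (x l)) - (\<Prod>l=1..p. ?b l (x l))\<bar>"
      proof (cases "x \<in> D")
        case True
        then have "x l \<in> A l" if "l \<in> {1..p}" for l using D(2) that by blast
        then have "(\<Prod>l=1..p. ?a l (x l)) = ?P x" "(\<Prod>l=1..p. ?b l (x l)) = ?Q x"
          by (auto intro!: prod.cong)
        then show ?thesis using True by simp
      qed simp
    qed
    also have "\<dots> \<le> 1 ^ card {1..p} * (\<Sum>l=1..p. L1_dist (euclid (d l)) (?a l) (?b l))"
      unfolding blocks_def
    proof (rule L1_dist_prod_le[OF product_sigma_finite_euclid])
      fix l assume l: "l \<in> {1..p}"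
      note [measurable] = A[OF l] fnl(1)[OF l] flD(4)[OF l]
      show "?a l \<in> borel_measurable (euclid (d l))" "?b l \<in> borel_measurable (euclid (d l))" by measurable
      show "0 \<le> ?a l x" for x using fnl(3)[OF l] by simp
      show "0 \<le> ?b l x" if "x \<in> space (euclid (d l))" for x using flD(3)[OF l that] by simp
      have "(\<integral>\<^sup>+x. ennreal (?a l x) \<partial>euclid (d l)) \<le> (\<integral>\<^sup>+x. ennreal (?fnl l x) \<partial>euclid (d l))"
        using fnl(3)[OF l] by (intro nn_integral_mono ennreal_leI) (auto split: split_indicator)
      then show "(\<integral>\<^sup>+x. ennreal (?a l x) \<partial>euclid (d l)) \<le> 1" using fnl(2)[OF l] by simp
      have "(\<integral>\<^sup>+x. ennreal (?b l x) \<partial>euclid (d l)) \<le> (\<integral>\<^sup>+x. ennreal (fl l x) \<partial>euclid (d l))"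
        using flD(3)[OF l] by (intro nn_integral_mono ennreal_leI) (auto split: split_indicator)
      then show "(\<integral>\<^sup>+x. ennreal (?b l x) \<partial>euclid (d l)) \<le> 1" using flD(5)[OF l] by simp
    qed auto
    also have "\<dots> = (\<Sum>l=1..p. \<integral>\<^sup>+x\<in>A l. ennreal \<bar>?fnl l x - fl l x\<bar> \<partial>euclid (d l))"
      unfolding L1_dist_def power_one mult_1
      by (intro sum.cong refl nn_integral_cong) (auto split: split_indicator)
    finally show ?thesis .
  qed
  have "ennreal (V_pop p d f fl D) = (\<integral>\<^sup>+x\<in>D. ennreal \<bar>f x - ?Q x\<bar> \<partial>?N)"
    unfolding V_pop_def using fD(1) i_Q by (rule set_nn)
  also have "\<dots> \<le> (\<integral>\<^sup>+x. ennreal \<bar>?fn x - ?P x\<bar> * indicator D x + (ennreal \<bar>?fn x - f x\<bar> * indicator ?A x +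
      ennreal \<bar>?P x - ?Q x\<bar> * indicator D x) \<partial>?N)"
  proof (intro nn_integral_mono)
    fix x
    show "ennreal \<bar>f x - ?Q x\<bar> * indicator D x \<le> ennreal \<bar>?fn x - ?P x\<bar> * indicator D x + (ennreal \<bar>?fn x - f x\<bar> * indicator ?A x +
      ennreal \<bar>?P x - ?Q x\<bar> * indicator D x)"
    proof (cases "x \<in> D")
      case True
      then have "x \<in> ?A" using D(2) by blast
      have "\<bar>f x - ?Q x\<bar> \<le> \<bar>?fn x - ?P x\<bar> + (\<bar>?fn x - f x\<bar> + \<bar>?P x - ?Q x\<bar>)" by linarith
      then show ?thesis using True \<open>x \<in> ?A\<close> by (simp flip: ennreal_plus)
    qed simp
  qed
  also have "\<dots> = (\<integral>\<^sup>+x\<in>D. ennreal \<bar>?fn x - ?P x\<bar> \<partial>?N) + ((\<integral>\<^sup>+x\<in>?A. ennreal \<bar>?fn x - f x\<bar> \<partial>?N) +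
      (\<integral>\<^sup>+x\<in>D. ennreal \<bar>?P x - ?Q x\<bar> \<partial>?N))"
    by (rule split[OF fnm meas(1,3,2)])
  also have "(\<integral>\<^sup>+x\<in>D. ennreal \<bar>?fn x - ?P x\<bar> \<partial>?N) = ennreal (V_emp p d K b n Y D)"
    unfolding V_emp_def using i_fn i_P by (rule set_nn[symmetric])
  also have "ennreal (V_emp p d K b n Y D) + ((\<integral>\<^sup>+x\<in>?A. ennreal \<bar>?fn x - f x\<bar> \<partial>?N) +
      (\<integral>\<^sup>+x\<in>D. ennreal \<bar>?P x - ?Q x\<bar> \<partial>?N)) \<le> ennreal (V_emp p d K b n Y D) + estimation_error p d K f fl A b n Y"
    unfolding estimation_error_def by (intro add_left_mono marg)
  finally show ?thesis .
qed

section \<open>Measurability, convergence and the consistency of the test\<close>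

context
  fixes M :: "'w measure" and p :: nat and d :: "nat \<Rightarrow> nat"
    and K :: "nat \<Rightarrow> (nat \<Rightarrow> real) \<Rightarrow> real" and Xs :: "nat \<Rightarrow> 'w \<Rightarrow> nat \<Rightarrow> nat \<Rightarrow> real" and n :: nat
  assumes K: "\<And>l. l \<in> {1..p} \<Longrightarrow> K l \<in> borel_measurable (euclid (d l))"
    and Xs: "\<And>i. i \<in> {1..n} \<Longrightarrow> Xs i \<in> measurable M (blocks p d)"
begin

lemma kernel_term_measurable:
  assumes "i \<in> {1..n}" "l \<in> {1..p}"
  shows "(\<lambda>z. K l (scaled_diff (d l) b (snd z l) (Xs i (fst z) l))) \<in> borel_measurable (M \<Otimes>\<^sub>M blocks p d)"
  by (rule measurable_compose[OF _ K[OF assms(2)]])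
     (intro scaled_diff_measurable measurable_blocks_component[OF measurable_snd assms(2)]
        measurable_blocks_component[OF measurable_compose[OF measurable_fst Xs[OF assms(1)]] assms(2)])

lemma f_joint_measurable:
  "(\<lambda>z. f_joint p d K b n (\<lambda>i. Xs i (fst z)) (snd z)) \<in> borel_measurable (M \<Otimes>\<^sub>M blocks p d)"
  unfolding f_joint_def
  by (intro borel_measurable_divide borel_measurable_sum borel_measurable_prod kernel_term_measurable
      borel_measurable_const)

lemma f_marg_measurable:
  "l \<in> {1..p} \<Longrightarrow> (\<lambda>z. f_marg (d l) (K l) b n (\<lambda>i. Xs i (fst z) l) (snd z l)) \<in> borel_measurable (M \<Otimes>\<^sub>M blocks p d)"
  unfolding f_marg_def
  by (intro borel_measurable_divide borel_measurable_sum kernel_term_measurable borel_measurable_const)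

lemma v_hat_measurable:
  "l \<in> {1..p} \<Longrightarrow> (\<lambda>z. v_hat (d l) (K l) b n (\<lambda>i. Xs i (fst z) l) (snd z l)) \<in> borel_measurable (M \<Otimes>\<^sub>M blocks p d)"
  unfolding v_hat_def
  by (intro borel_measurable_divide borel_measurable_sum borel_measurable_power kernel_term_measurable
      borel_measurable_const)

lemma g_hat_measurable:
  "l \<in> {1..p} \<Longrightarrow> (\<lambda>z. g_hat (d l) (K l) b n (\<lambda>i. Xs i (fst z) l) (snd z l)) \<in> borel_measurable (M \<Otimes>\<^sub>M blocks p d)"
  unfolding g_hat_def
  by (intro borel_measurable_divide borel_measurable_sum borel_measurable_times kernel_term_measurable
      borel_measurable_const) auto

lemma L_hat_measurable:
  "(\<lambda>z. L_hat p d K b n (\<lambda>i. Xs i (fst z)) (snd z)) \<in> borel_measurable (M \<Otimes>\<^sub>M blocks p d)"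
  unfolding L_hat_def Let_def
  by (intro borel_measurable_add borel_measurable_diff borel_measurable_sum borel_measurable_prod
      borel_measurable_times v_hat_measurable g_hat_measurable borel_measurable_const) auto

lemma test_stat_measurable:
  assumes D: "D \<in> sets (blocks p d)"
  shows "(\<lambda>\<omega>. test_stat p d nrm K b n (\<lambda>i. Xs i \<omega>) D) \<in> borel_measurable M"
proof -
  have ind: "(\<lambda>z. indicator D (snd z) :: real) \<in> borel_measurable (M \<Otimes>\<^sub>M blocks p d)"
    by (rule measurable_compose[OF measurable_snd borel_measurable_indicator[OF D]])
  have "(\<lambda>z. indicator D (snd z) * \<bar>f_joint p d K b n (\<lambda>i. Xs i (fst z)) (snd z) -
      (\<Prod>l=1..p. f_marg (d l) (K l) b n (\<lambda>i. Xs i (fst z) l) (snd z l))\<bar>) \<in> borel_measurable (M \<Otimes>\<^sub>M blocks p d)"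
    by (intro borel_measurable_times ind borel_measurable_abs borel_measurable_diff f_joint_measurable
        borel_measurable_prod f_marg_measurable)
  then have V: "(\<lambda>\<omega>. V_emp p d K b n (\<lambda>i. Xs i \<omega>) D) \<in> borel_measurable M"
    unfolding V_emp_def set_lebesgue_integral_def real_scaleR_def
    by (intro sigma_finite_measure.borel_measurable_lebesgue_integral[OF sigma_finite_blocks]) (simp add: case_prod_beta')
  have "(\<lambda>z. indicator D (snd z) * sqrt (L_hat p d K b n (\<lambda>i. Xs i (fst z)) (snd z))) \<in> borel_measurable (M \<Otimes>\<^sub>M blocks p d)"
    by (intro borel_measurable_times ind measurable_compose[OF L_hat_measurable borel_measurable_sqrt])
  then have A: "(\<lambda>\<omega>. a_center p d K b n (\<lambda>i. Xs i \<omega>) D) \<in> borel_measurable M"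
    unfolding a_center_def set_lebesgue_integral_def real_scaleR_def
    by (intro borel_measurable_times borel_measurable_const sigma_finite_measure.borel_measurable_lebesgue_integral[OF sigma_finite_blocks]) (simp add: case_prod_beta')
  show ?thesis unfolding test_stat_def using V A by measurable
qed

end

lemma estimation_error_terms_measurable:
  assumes "\<And>l. l \<in> {1..p} \<Longrightarrow> K l \<in> borel_measurable (euclid (d l))"
    and "\<And>i. i \<in> {1..n} \<Longrightarrow> Xs i \<in> measurable M (blocks p d)"
    and f: "f \<in> borel_measurable (blocks p d)" and fl: "\<And>l. l \<in> {1..p} \<Longrightarrow> fl l \<in> borel_measurable (euclid (d l))"
    and A: "\<And>l. l \<in> {1..p} \<Longrightarrow> A l \<in> sets (euclid (d l))"
  shows "(\<lambda>\<omega>. \<integral>\<^sup>+x\<in>(\<Pi>\<^sub>E l\<in>{1..p}. A l). ennreal \<bar>f_joint p d K b n (\<lambda>i. Xs i \<omega>) x - f x\<bar> \<partial>blocks p d) \<in> borel_measurable M"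
    and "\<And>l. l \<in> {1..p} \<Longrightarrow> (\<lambda>\<omega>. \<integral>\<^sup>+x\<in>A l. ennreal \<bar>f_marg (d l) (K l) b n (\<lambda>i. Xs i \<omega> l) x - fl l x\<bar> \<partial>euclid (d l)) \<in> borel_measurable M"
proof -
  have Am: "(\<Pi>\<^sub>E l\<in>{1..p}. A l) \<in> sets (blocks p d)" unfolding blocks_def using A by (intro sets_PiM_I_finite) auto
  have "(\<lambda>z. ennreal \<bar>f_joint p d K b n (\<lambda>i. Xs i (fst z)) (snd z) - f (snd z)\<bar> * indicator (\<Pi>\<^sub>E l\<in>{1..p}. A l) (snd z))
      \<in> borel_measurable (M \<Otimes>\<^sub>M blocks p d)"
    using f_joint_measurable[OF assms(1,2)] f Am by measurable
  then show "(\<lambda>\<omega>. \<integral>\<^sup>+x\<in>(\<Pi>\<^sub>E l\<in>{1..p}. A l). ennreal \<bar>f_joint p d K b n (\<lambda>i. Xs i \<omega>) x - f x\<bar> \<partial>blocks p d) \<in> borel_measurable M"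
    by (intro sigma_finite_measure.borel_measurable_nn_integral[OF sigma_finite_blocks]) (simp add: case_prod_beta')
  fix l assume l: "l \<in> {1..p}"
  have "(\<lambda>z. K l (scaled_diff (d l) b (snd z) (Xs i (fst z) l))) \<in> borel_measurable (M \<Otimes>\<^sub>M euclid (d l))" if i: "i \<in> {1..n}" for i
    by (rule measurable_compose[OF _ assms(1)[OF l]])
       (intro scaled_diff_measurable measurable_snd
          measurable_blocks_component[OF measurable_compose[OF measurable_fst assms(2)[OF i]] l])
  then have "(\<lambda>z. f_marg (d l) (K l) b n (\<lambda>i. Xs i (fst z) l) (snd z)) \<in> borel_measurable (M \<Otimes>\<^sub>M euclid (d l))"
    unfolding f_marg_def by (intro borel_measurable_divide borel_measurable_sum borel_measurable_const)
  then have "(\<lambda>z. ennreal \<bar>f_marg (d l) (K l) b n (\<lambda>i. Xs i (fst z) l) (snd z) - fl l (snd z)\<bar> * indicator (A l) (snd z))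
      \<in> borel_measurable (M \<Otimes>\<^sub>M euclid (d l))"
    using fl[OF l] A[OF l] by measurable
  then show "(\<lambda>\<omega>. \<integral>\<^sup>+x\<in>A l. ennreal \<bar>f_marg (d l) (K l) b n (\<lambda>i. Xs i \<omega> l) x - fl l x\<bar> \<partial>euclid (d l)) \<in> borel_measurable M"
    by (intro sigma_finite_measure.borel_measurable_nn_integral[OF sigma_finite_euclid]) (simp add: case_prod_beta')
qed

text \<open>
Bandwidths below 1 have larger lower powers.
\<close>

lemma bandwidth_power_at_top:
  fixes h :: "nat \<Rightarrow> real"
  assumes lim: "filterlim (\<lambda>n. real n * h n ^ m) at_top sequentially" and "r \<le> m"
    and h: "h \<longlonglongrightarrow> 0" "\<And>n. n \<ge> 1 \<Longrightarrow> 0 < h n"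
  shows "filterlim (\<lambda>n. real n * h n ^ r) at_top sequentially"
proof (rule filterlim_at_top_mono[OF lim])
  have "\<forall>\<^sub>F n in sequentially. h n < 1" using order_tendstoD(2)[OF h(1)] by simp
  then show "\<forall>\<^sub>F n in sequentially. real n * h n ^ m \<le> real n * h n ^ r"
    using eventually_ge_at_top[of 1]
  proof eventually_elim
    case (elim n)
    then have "h n ^ m \<le> h n ^ r" using h(2)[of n] \<open>r \<le> m\<close> by (intro power_decreasing) auto
    then show ?case by (intro mult_left_mono) auto
  qed
qed

text \<open>
Each summand is the mean error of a kernel estimator: on the full space with the product kernel, and
on the single blocks, where the projected observations are again independent with density \<open>fl l\<close>.
\<close>

lemma estimation_error_tendsto_0:
  fixes M :: "'w measure" and X :: "'w \<Rightarrow> nat \<Rightarrow> nat \<Rightarrow> real"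
  assumes M: "prob_space M"
    and f: "has_density M (blocks p d) X f"
    and fl: "\<And>l. l \<in> {1..p} \<Longrightarrow> has_density M (euclid (d l)) (\<lambda>\<omega>. X \<omega> l) (fl l)"
    and ind: "prob_space.indep_vars M (\<lambda>_. blocks p d) Xs {1..}"
    and dis: "\<And>i. i \<ge> 1 \<Longrightarrow> distr M (blocks p d) (Xs i) = distr M (blocks p d) X"
    and K: "\<And>l. l \<in> {1..p} \<Longrightarrow> is_pdf (euclid (d l)) (K l)"
    and sq: "\<And>l. l \<in> {1..p} \<Longrightarrow> integrable (euclid (d l)) (\<lambda>u. (K l u)\<^sup>2)"
    and h: "\<And>n. n \<ge> 1 \<Longrightarrow> h n > 0" "h \<longlonglongrightarrow> 0"
    and nh: "filterlim (\<lambda>n. real n * h n ^ (\<Sum>l=1..p. d l)) at_top sequentially"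
    and A: "\<And>l. l \<in> {1..p} \<Longrightarrow> A l \<in> sets (euclid (d l))"
      "\<And>l. l \<in> {1..p} \<Longrightarrow> emeasure (euclid (d l)) (A l) < \<infinity>"
  shows "(\<lambda>n. \<integral>\<^sup>+\<omega>. estimation_error p d K f fl A (h n) n (\<lambda>i. Xs i \<omega>) \<partial>M) \<longlonglongrightarrow> 0"
proof -
  interpret prob_space M by fact
  interpret product_sigma_finite "\<lambda>l. euclid (d l)" by (rule product_sigma_finite_euclid)
  note fD = has_density_is_pdf[OF f]
  note flD = has_density_is_pdf[OF fl]
  have Xs: "Xs i \<in> measurable M (blocks p d)" if "1 \<le> i" for i
    using ind that by (auto simp: indep_vars_def)
  let ?A = "\<Pi>\<^sub>E l\<in>{1..p}. A l"
  have Am: "?A \<in> sets (blocks p d)" unfolding blocks_def using A by (intro sets_PiM_I_finite) auto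
  have Afin: "emeasure (blocks p d) ?A < \<infinity>"
    unfolding blocks_def using A by (intro emeasure_PiM_less_top product_sigma_finite_euclid) auto
  have joint: "(\<lambda>n. \<integral>\<^sup>+\<omega>. (\<integral>\<^sup>+x\<in>?A. ennreal \<bar>f_joint p d K (h n) n (\<lambda>i. Xs i \<omega>) x - f x\<bar> \<partial>blocks p d) \<partial>M) \<longlonglongrightarrow> 0"
    unfolding f_joint_eq_kde
    using is_pdfD[OF fD(1)] joint_kernel_pdf[OF K] joint_kernel_square_integrable[OF sq] h nh Am Afin dis
    by (intro blocks.kde_L1_consistent[OF M ind]) (auto simp: fD(2))
  have marg: "(\<lambda>n. \<integral>\<^sup>+\<omega>. (\<integral>\<^sup>+x\<in>A l. ennreal \<bar>f_marg (d l) (K l) (h n) n (\<lambda>i. Xs i \<omega> l) x - fl l x\<bar> \<partial>euclid (d l)) \<partial>M) \<longlonglongrightarrow> 0"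
    if l: "l \<in> {1..p}" for l
  proof -
    have comp: "(\<lambda>x. x l) \<in> measurable (blocks p d) (euclid (d l))"
      by (rule measurable_blocks_component[OF _ l]) simp
    have ind_l: "indep_vars (\<lambda>_. euclid (d l)) (\<lambda>i \<omega>. Xs i \<omega> l) {1..}"
      by (rule indep_vars_compose2[OF ind comp])
    have dis_l: "distr M (euclid (d l)) (\<lambda>\<omega>. Xs i \<omega> l) = density (euclid (d l)) (\<lambda>x. ennreal (fl l x))" if "1 \<le> i" for i
    proof -
      have "distr M (euclid (d l)) (\<lambda>\<omega>. Xs i \<omega> l) = distr (distr M (blocks p d) (Xs i)) (euclid (d l)) (\<lambda>x. x l)"
        using comp Xs[OF that] by (subst distr_distr) (auto simp: comp_def)
      also have "\<dots> = distr M (euclid (d l)) (\<lambda>\<omega>. X \<omega> l)"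
        unfolding dis[OF that] using comp fD(3) by (subst distr_distr) (auto simp: comp_def)
      finally show ?thesis using flD(2)[OF l] by simp
    qed
    have "d l \<le> (\<Sum>l=1..p. d l)" using l by (intro member_le_sum) auto
    then have nh_l: "filterlim (\<lambda>n. real n * h n ^ d l) at_top sequentially"
      by (rule bandwidth_power_at_top[OF nh _ h(2,1)])
    show ?thesis
      unfolding f_marg_eq_kde
      using is_pdfD[OF flD(1)[OF l]] is_pdfD[OF K[OF l]] sq[OF l] h nh_l A[OF l] dis_l
      by (intro euclid.kde_L1_consistent[OF M ind_l]) auto
  qed
  have "(\<integral>\<^sup>+\<omega>. estimation_error p d K f fl A (h n) n (\<lambda>i. Xs i \<omega>) \<partial>M) =
      (\<integral>\<^sup>+\<omega>. (\<integral>\<^sup>+x\<in>?A. ennreal \<bar>f_joint p d K (h n) n (\<lambda>i. Xs i \<omega>) x - f x\<bar> \<partial>blocks p d) \<partial>M) +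
      (\<Sum>l=1..p. \<integral>\<^sup>+\<omega>. (\<integral>\<^sup>+x\<in>A l. ennreal \<bar>f_marg (d l) (K l) (h n) n (\<lambda>i. Xs i \<omega> l) x - fl l x\<bar> \<partial>euclid (d l)) \<partial>M)" for n
  proof -
    have m: "\<And>l. l \<in> {1..p} \<Longrightarrow> K l \<in> borel_measurable (euclid (d l))" "\<And>i. i \<in> {1..n} \<Longrightarrow> Xs i \<in> measurable M (blocks p d)"
      "f \<in> borel_measurable (blocks p d)" "\<And>l. l \<in> {1..p} \<Longrightarrow> fl l \<in> borel_measurable (euclid (d l))"
      using is_pdfD(4)[OF K] Xs is_pdfD(4)[OF fD(1)] is_pdfD(4)[OF flD(1)] by auto
    note mm = estimation_error_terms_measurable[OF m A(1)]
    have sum_swap: "(\<integral>\<^sup>+\<omega>. a \<omega> + (\<Sum>l=1..p. e l \<omega>) \<partial>M) = (\<integral>\<^sup>+\<omega>. a \<omega> \<partial>M) + (\<Sum>l=1..p. \<integral>\<^sup>+\<omega>. e l \<omega> \<partial>M)"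
      if "a \<in> borel_measurable M" "\<And>l. l \<in> {1..p} \<Longrightarrow> e l \<in> borel_measurable M" for a e
      using that by (subst nn_integral_add) (simp_all only: nn_integral_sum borel_measurable_sum)
    show ?thesis unfolding estimation_error_def by (rule sum_swap; intro mm)
  qed
  moreover have "(\<lambda>n. (\<integral>\<^sup>+\<omega>. (\<integral>\<^sup>+x\<in>?A. ennreal \<bar>f_joint p d K (h n) n (\<lambda>i. Xs i \<omega>) x - f x\<bar> \<partial>blocks p d) \<partial>M) +
      (\<Sum>l=1..p. \<integral>\<^sup>+\<omega>. (\<integral>\<^sup>+x\<in>A l. ennreal \<bar>f_marg (d l) (K l) (h n) n (\<lambda>i. Xs i \<omega> l) x - fl l x\<bar> \<partial>euclid (d l)) \<partial>M))
      \<longlonglongrightarrow> 0 + (\<Sum>l=1..p. 0)"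
    by (intro tendsto_add joint tendsto_sum marg)
  ultimately show ?thesis by simp
qed

lemma cube_euclid:
  "(\<Pi>\<^sub>E k\<in>{1..s}. {- C..C}) \<in> sets (euclid s)" "emeasure (euclid s) (\<Pi>\<^sub>E k\<in>{1..s}. {- C..C}) < \<infinity>"
proof -
  show "(\<Pi>\<^sub>E k\<in>{1..s}. {- C..C}) \<in> sets (euclid s)"
    unfolding euclid_def by (intro sets_PiM_I_finite) auto
  show "emeasure (euclid s) (\<Pi>\<^sub>E k\<in>{1..s}. {- C..C}) < \<infinity>"
    unfolding euclid_def
    by (intro emeasure_PiM_less_top product_sigma_finite_lborel) (auto simp: emeasure_lborel_Icc_eq)
qed

theorem theorem3p3:
  fixes M :: "'w measure"
    and p :: nat and d :: "nat \<Rightarrow> nat"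
    and X :: "'w \<Rightarrow> nat \<Rightarrow> nat \<Rightarrow> real"
    and Xs :: "nat \<Rightarrow> 'w \<Rightarrow> nat \<Rightarrow> nat \<Rightarrow> real"
    and f :: "(nat \<Rightarrow> nat \<Rightarrow> real) \<Rightarrow> real"
    and fl :: "nat \<Rightarrow> (nat \<Rightarrow> real) \<Rightarrow> real"
    and K :: "nat \<Rightarrow> (nat \<Rightarrow> real) \<Rightarrow> real"
    and nrm :: "nat \<Rightarrow> (nat \<Rightarrow> real) \<Rightarrow> real"
    and h :: "nat \<Rightarrow> real"
    and D :: "nat \<Rightarrow> (nat \<Rightarrow> real) set"
    and \<alpha> z :: real
  assumes "p \<ge> 2" and "\<And>l. l \<in> {1..p} \<Longrightarrow> d l \<ge> 1"
    and "prob_space M"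
    and "has_density M (blocks p d) X f"
    and "\<And>l. l \<in> {1..p} \<Longrightarrow> has_density M (euclid (d l)) (\<lambda>\<omega>. X \<omega> l) (fl l)"
    and "prob_space.indep_vars M (\<lambda>_. blocks p d) Xs {1..}"
    and "\<And>i. i \<ge> 1 \<Longrightarrow> distr M (blocks p d) (Xs i) = distr M (blocks p d) X"
    and "\<And>s. is_norm s (nrm s)"
    and "\<And>l. l \<in> {1..p} \<Longrightarrow> is_pdf (euclid (d l)) (K l)"
    and "\<And>l. l \<in> {1..p} \<Longrightarrow> integrable (euclid (d l)) (\<lambda>u. (K l u)\<^sup>2)"
    and "\<And>n. n \<ge> 1 \<Longrightarrow> h n > 0"
    and "h \<longlonglongrightarrow> 0"
    and "filterlim (\<lambda>n. real n * h n ^ (3 * (\<Sum>l=1..p. d l))) at_top sequentially"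
    and "0 < \<alpha>" and "\<alpha> < 1"
    and "measure std_normal_distribution {z<..} = \<alpha>"
    and "(LINT x|blocks p d. \<bar>f x - (\<Prod>l=1..p. fl l (x l))\<bar>) > 0"
    and "\<And>l. l \<in> {1..p} \<Longrightarrow> D l \<subseteq> space (euclid (d l))"
    and "(\<Pi>\<^sub>E l\<in>{1..p}. D l) \<in> sets (blocks p d)"
    and "bounded_blocks p d (\<Pi>\<^sub>E l\<in>{1..p}. D l)"
    and "V_pop p d f fl (\<Pi>\<^sub>E l\<in>{1..p}. D l) > 0"
  shows "(\<lambda>n. measure M {\<omega> \<in> space M.
            test_stat p d nrm K (h n) n (\<lambda>i. Xs i \<omega>) (\<Pi>\<^sub>E l\<in>{1..p}. D l) > z}) \<longlonglongrightarrow> 1"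
proof -
  interpret prob_space M by fact
  note K = assms(9) and sq = assms(10) and h = assms(11,12)
  let ?D = "\<Pi>\<^sub>E l\<in>{1..p}. D l" and ?S = "\<Sum>l=1..p. d l"
  note Dm = assms(19)
  have Xs: "Xs i \<in> measurable M (blocks p d)" if "1 \<le> i" for i
    using assms(6) that by (auto simp: indep_vars_def)
  obtain C where C: "\<And>x l k. x \<in> ?D \<Longrightarrow> l \<in> {1..p} \<Longrightarrow> k \<in> {1..d l} \<Longrightarrow> \<bar>x l k\<bar> \<le> C"
    using assms(20) unfolding bounded_blocks_def by blast
  define A where "A l = (\<Pi>\<^sub>E k\<in>{1..d l}. {- C..C})" for l
  have A: "A l \<in> sets (euclid (d l))" "emeasure (euclid (d l)) (A l) < \<infinity>" for l
    unfolding A_def by (rule cube_euclid)+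
  have DA: "?D \<subseteq> (\<Pi>\<^sub>E l\<in>{1..p}. A l)"
  proof
    fix x assume x: "x \<in> ?D"
    have "x l \<in> A l" if l: "l \<in> {1..p}" for l
    proof -
      have "x l \<in> space (euclid (d l))" using x l assms(18)[OF l] by blast
      then have ext: "x l \<in> extensional {1..d l}" unfolding space_euclid by (simp add: PiE_iff)
      show ?thesis unfolding A_def
        using C[OF x l] ext by (auto simp: PiE_iff abs_le_iff minus_le_iff)
    qed
    then show "x \<in> (\<Pi>\<^sub>E l\<in>{1..p}. A l)" using x by (auto simp: PiE_iff)
  qed
  have Dfin: "emeasure (blocks p d) ?D < \<infinity>"
  proof -
    have Am: "(\<Pi>\<^sub>E l\<in>{1..p}. A l) \<in> sets (blocks p d)" unfolding blocks_def using A by (intro sets_PiM_I_finite) auto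
    have "emeasure (blocks p d) (\<Pi>\<^sub>E l\<in>{1..p}. A l) < \<infinity>"
      unfolding blocks_def using A by (intro emeasure_PiM_less_top product_sigma_finite_euclid) auto
    then show ?thesis using emeasure_mono[OF DA Am] by (rule le_less_trans[rotated])
  qed
  have nh: "filterlim (\<lambda>n. real n * h n ^ ?S) at_top sequentially"
    by (rule bandwidth_power_at_top[OF assms(13) _ h(2,1)]) auto
  define R where "R n \<omega> = estimation_error p d K f fl A (h n) n (\<lambda>i. Xs i \<omega>)" for n \<omega>
  have R_lim: "(\<lambda>n. \<integral>\<^sup>+\<omega>. R n \<omega> \<partial>M) \<longlonglongrightarrow> 0"
    unfolding R_def by (rule estimation_error_tendsto_0[OF assms(3-7) K sq h nh A])
  have R_meas[measurable]: "R n \<in> borel_measurable M" for n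
  proof -
    have m: "\<And>l. l \<in> {1..p} \<Longrightarrow> K l \<in> borel_measurable (euclid (d l))" "\<And>i. i \<in> {1..n} \<Longrightarrow> Xs i \<in> measurable M (blocks p d)"
      "f \<in> borel_measurable (blocks p d)" "\<And>l. l \<in> {1..p} \<Longrightarrow> fl l \<in> borel_measurable (euclid (d l))"
      using is_pdfD(4)[OF K] Xs is_pdfD(4)[OF has_density_is_pdf(1)[OF assms(4)]]
        is_pdfD(4)[OF has_density_is_pdf(1)[OF assms(5)]] by auto
    note mm = estimation_error_terms_measurable[OF m A(1)]
    show ?thesis unfolding R_def[abs_def] estimation_error_def
      by (intro borel_measurable_add borel_measurable_sum mm)
  qed
  define v where "v = V_pop p d f fl ?D / 2"
  have v: "0 < v" using assms(21) by (simp add: v_def)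
  define \<sigma> where "\<sigma> = sqrt (sigma2 p d nrm K)"
  have \<sigma>: "0 < \<sigma>" unfolding \<sigma>_def using sigma2_pos[of nrm p d K] assms(8) K sq by simp
  define c where "c = (LINT z|std_normal_distribution. \<bar>z\<bar>) * ((measure (blocks p d) ?D + real p * K_tilde p d K) / 2)"
  \<comment> \<open>On the event that the error is below half of \<open>V\<close>, the statistic has a deterministic lower bound,
  which tends to infinity.\<close>
  have key: "sqrt (real n) * (v - c / sqrt (real n * h n ^ ?S)) / \<sigma> \<le> test_stat p d nrm K (h n) n (\<lambda>i. Xs i \<omega>) ?D"
    if n: "2 \<le> n" and \<omega>: "\<omega> \<in> space M" and R: "R n \<omega> < ennreal v" for n \<omega>
  proof -
    have b: "0 < h n" using h n by auto
    have Y: "Xs i \<omega> \<in> space (blocks p d)" if "i \<in> {1..n}" for i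
      using measurable_space[OF Xs \<omega>] that by auto
    have "ennreal (2 * v) \<le> ennreal (V_emp p d K (h n) n (\<lambda>i. Xs i \<omega>) ?D) + R n \<omega>"
      unfolding R_def v_def
      using V_pop_le[OF K has_density_is_pdf(1)[OF assms(4)] has_density_is_pdf(1)[OF assms(5)] b _ Y Dm DA A(1)] n by simp
    also have "\<dots> \<le> ennreal (V_emp p d K (h n) n (\<lambda>i. Xs i \<omega>) ?D) + ennreal v"
      using R by (intro add_left_mono) simp
    also have "\<dots> = ennreal (V_emp p d K (h n) n (\<lambda>i. Xs i \<omega>) ?D + v)"
    proof (rule ennreal_plus[symmetric])
      show "0 \<le> V_emp p d K (h n) n (\<lambda>i. Xs i \<omega>) ?D"
        unfolding V_emp_def set_lebesgue_integral_def by (intro integral_nonneg_AE AE_I2) simp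
    qed (use v in simp)
    finally have "2 * v \<le> V_emp p d K (h n) n (\<lambda>i. Xs i \<omega>) ?D + v"
      using v by (subst (asm) ennreal_le_iff2) auto
    then have V: "sqrt (real n) * v \<le> sqrt (real n) * V_emp p d K (h n) n (\<lambda>i. Xs i \<omega>) ?D"
      by (intro mult_left_mono) auto
    have "a_center p d K (h n) n (\<lambda>i. Xs i \<omega>) ?D \<le> c / sqrt (h n ^ ?S)"
      using a_center_le[OF K sq b n _ Y Dm Dfin] assms(1) by (simp add: c_def)
    also have "\<dots> = sqrt (real n) * (c / sqrt (real n * h n ^ ?S))"
      using n by (simp add: real_sqrt_mult)
    finally have "sqrt (real n) * (v - c / sqrt (real n * h n ^ ?S)) \<le>
        sqrt (real n) * V_emp p d K (h n) n (\<lambda>i. Xs i \<omega>) ?D - a_center p d K (h n) n (\<lambda>i. Xs i \<omega>) ?D"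
      using V by (simp add: right_diff_distrib)
    then show ?thesis unfolding test_stat_def \<sigma>_def[symmetric] using \<sigma> by (intro divide_right_mono) auto
  qed
  have "filterlim (\<lambda>n. sqrt (real n) * (v - c / sqrt (real n * h n ^ ?S)) / \<sigma>) at_top sequentially"
  proof -
    have "(\<lambda>n. c / sqrt (real n * h n ^ ?S)) \<longlonglongrightarrow> 0"
      by (intro tendsto_divide_0[OF tendsto_const] filterlim_at_top_imp_at_infinity
          filterlim_compose[OF sqrt_at_top nh])
    from tendsto_divide[OF tendsto_diff[OF tendsto_const this] tendsto_const, of \<sigma> v]
    have "(\<lambda>n. (v - c / sqrt (real n * h n ^ ?S)) / \<sigma>) \<longlonglongrightarrow> v / \<sigma>"
      using \<sigma> by simp
    then have "filterlim (\<lambda>n. (v - c / sqrt (real n * h n ^ ?S)) / \<sigma> * sqrt (real n)) at_top sequentially"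
      using v \<sigma> by (intro filterlim_tendsto_pos_mult_at_top[where c = "v / \<sigma>"]
          filterlim_compose[OF sqrt_at_top filterlim_real_sequentially]) auto
    then show ?thesis by (simp add: mult.commute)
  qed
  then have large: "\<forall>\<^sub>F n in sequentially. z < sqrt (real n) * (v - c / sqrt (real n * h n ^ ?S)) / \<sigma>"
    by (rule filterlim_at_top_dense[THEN iffD1, rule_format])
  let ?T = "\<lambda>n. {\<omega> \<in> space M. test_stat p d nrm K (h n) n (\<lambda>i. Xs i \<omega>) ?D > z}"
  let ?B = "\<lambda>n. {\<omega> \<in> space M. ennreal v \<le> R n \<omega>}"
  \<comment> \<open>A nonmeasurable set would have measure 0, so the lower bound for the probability relies on this.\<close>
  have T_meas: "?T n \<in> events" for n
  proof -
    have "(\<lambda>\<omega>. test_stat p d nrm K (h n) n (\<lambda>i. Xs i \<omega>) ?D) \<in> borel_measurable M"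
      by (rule test_stat_measurable[OF is_pdfD(4)[OF K] Xs Dm]) auto
    then show ?thesis by measurable
  qed
  have "(\<lambda>n. emeasure M (?B n)) \<longlonglongrightarrow> 0"
  proof (rule tendsto_0_dominated_ennreal)
    have "(\<lambda>n. ennreal (1 / v) * (\<integral>\<^sup>+\<omega>. R n \<omega> \<partial>M)) \<longlonglongrightarrow> ennreal (1 / v) * 0"
      by (intro ennreal_tendsto_cmult R_lim) simp
    then show "(\<lambda>n. ennreal (1 / v) * (\<integral>\<^sup>+\<omega>. R n \<omega> \<partial>M)) \<longlonglongrightarrow> 0" by simp
    fix n
    have "?B n = {\<omega> \<in> space M. 1 \<le> ennreal (1 / v) * R n \<omega>}"
    proof -
      have "ennreal v \<le> r \<longleftrightarrow> 1 \<le> ennreal (1 / v) * r" for r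
      proof (cases r)
        case (real q)
        then show ?thesis using v by (simp add: field_simps flip: ennreal_mult ennreal_1)
      qed (use v in \<open>simp add: ennreal_mult_top\<close>)
      then show ?thesis by simp
    qed
    then show "emeasure M (?B n) \<le> ennreal (1 / v) * (\<integral>\<^sup>+\<omega>. R n \<omega> \<partial>M)"
      using nn_integral_Markov_inequality[where M = M and u = "R n" and A = "space M" and c = "ennreal (1 / v)"]
      by (simp cong: nn_integral_cong_simp)
  qed
  then have "(\<lambda>n. ennreal (prob (?B n))) \<longlonglongrightarrow> ennreal 0" by (simp add: emeasure_eq_measure)
  then have B_lim: "(\<lambda>n. prob (?B n)) \<longlonglongrightarrow> 0" by (subst (asm) tendsto_ennreal_iff) auto
  show ?thesis
  proof (rule tendsto_sandwich)
    show "\<forall>\<^sub>F n in sequentially. 1 - prob (?B n) \<le> prob (?T n)"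
      using large eventually_ge_at_top[of 2]
    proof eventually_elim
      case (elim n)
      have "space M - ?B n \<subseteq> ?T n" using key[OF elim(2)] elim(1) by (force simp: not_le)
      moreover have "prob (space M - ?B n) = 1 - prob (?B n)" by (intro prob_compl) measurable
      ultimately show ?case using finite_measure_mono[OF _ T_meas, of "space M - ?B n" n] by simp
    qed
    show "\<forall>\<^sub>F n in sequentially. prob (?T n) \<le> 1" by simp
    show "(\<lambda>n. 1 - prob (?B n)) \<longlonglongrightarrow> 1" using tendsto_diff[OF tendsto_const B_lim, of 1] by simp
  qed simp
qed

end
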